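(* Let $X$ be a locally finite CAT(0) cube complex with a cocompact cellular action of a group $G$. Suppose that the stars of vertices are embedded in $X/G$, i.e. for every vertex $v$ of $X$ the projection $\pi:X\to X/G$ is injective on the closed cubical star $St(v)$. For $x,y\in Vert(X/G)$ (i.e. $G$-orbits of vertices of $X$) let $G_{xy}$ be the orbit growth series and $c_{xy}$ the coefficient, both as defined in the context. Then the finite square matrices $(G_{xy})_{x,y\in Vert(X/G)}$ and $(c_{xy})_{x,y\in Vert(X/G)}$ are inverses of each other.
   Context: $d(x,y)$ denotes the $\ell_1$-distance between vertices of $X$ (the edge-path distance in the 1-skeleton). The (closed cubical) star $St(v)$ of a vertex $v$ is the union of all cubes containing $v$. Locally finite means each vertex lies in finitely many cubes; cocompact means $X/G$ is compact, so there are finitely many $G$-orbits of vertices. $\pi:X\to X/G$ is the projection, and $Vert(X/G)$ is the set of $G$-orbits of vertices. Orbit growth series: for vertices $x,y$ of $X$, $G_{xy}=\sum_{z\in Gy}t^{d(x,z)}\in\mathbb{Z}[[t]]$. It depends only on the $G$-orbits of $x$ and $y$, so it is defined for $x,y\in Vert(X/G)$. The $f$-polynomial of a finite simplicial complex $L$ is $f_L(t)=\sum_{\sigma\in L}t^{\dim\sigma+1}$, where $L$ includes the empty simplex of dimension $-1$. For vertices $x,y$ of $X$ contained in a common cube, $\Box_{xy}$ is the minimal cube containing both, and $f_{xy}$ is the $f$-polynomial of the link of $\Box_{xy}$, i.e. $f_{xy}(s)=\sum_{Q\supseteq\Box_{xy}}s^{\dim Q-\dim\Box_{xy}}$, the sum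 being over cubes $Q$ of $X$. If $x,y$ are not in a common cube, $f_{xy}=0$. For vertices $x,y$ of $X$ put $$c_{xy}=\left(\frac{-t}{1-t^2}\right)^{d(x,y)}f_{xy}\left(\frac{t^2}{1-t^2}\right).$$ When stars are embedded, for $x,y\in Vert(X/G)$ choose a lift $\bar x$ of $x$; there is at most one lift $\bar y$ of $y$ in $St(\bar x)$. Set $c_{xy}=c_{\bar x\bar y}$ if such $\bar y$ exists and $c_{xy}=0$ otherwise; this is independent of the choice of $\bar x$. Rational functions regular at $t=0$ are identified with their power series expansions at $0$. *)

theory Defs
  imports
    "HOL-Analysis.Analysis"
    "HOL-Algebra.Group_Action"
    "HOL-Computational_Algebra.Polynomial_FPS"
begin

section \<open>Cubical complexes\<close>

text \<open>
  A cubical complex is given by the vertex sets of its cubes. A chart identifies the vertices of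
  an \<open>n\<close>-cube \<open>C\<close> with the corners of \<open>[0,1]\<^sup>n\<close>, a corner being the set of coordinates that are 1.
  Faces of the cube are intervals in the power set, and they are exactly the cubes contained in \<open>C\<close>.
\<close>

definition cube_chart :: "'v set set \<Rightarrow> 'v set \<Rightarrow> nat \<Rightarrow> (nat set \<Rightarrow> 'v) \<Rightarrow> bool" where
  "cube_chart K C n \<kappa> \<longleftrightarrow>
     bij_betw \<kappa> (Pow {..<n}) C \<and>
     {A \<in> K. A \<subseteq> C} = {\<kappa> ` {U. S \<subseteq> U \<and> U \<subseteq> T} | S T. S \<subseteq> T \<and> T \<subseteq> {..<n}}"

text \<open>
  As in Bridson--Haefliger, cubes are embedded and two cubes that meet do so in a common face.
  The vertices are the elements of \<open>\<Union>K\<close>; the singletons \<open>{v}\<close> are the 0-cubes.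
\<close>

definition cube_complex :: "'v set set \<Rightarrow> bool" where
  "cube_complex K \<longleftrightarrow>
     (\<forall>C\<in>K. \<exists>n \<kappa>. cube_chart K C n \<kappa>) \<and>
     (\<forall>C\<in>K. \<forall>D\<in>K. C \<inter> D \<noteq> {} \<longrightarrow> C \<inter> D \<in> K)"

definition cube_dim :: "'v set set \<Rightarrow> 'v set \<Rightarrow> nat" where
  "cube_dim K C = (THE n. \<exists>\<kappa>. cube_chart K C n \<kappa>)"

definition locally_finite_complex :: "'v set set \<Rightarrow> bool" where
  "locally_finite_complex K \<longleftrightarrow> (\<forall>v\<in>\<Union>K. finite {C \<in> K. v \<in> C})"

definition adjacent :: "'v set set \<Rightarrow> 'v \<Rightarrow> 'v \<Rightarrow> bool" where
  "adjacent K u v \<longleftrightarrow> u \<noteq> v \<and> {u, v} \<in> K"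

definition l1_dist :: "'v set set \<Rightarrow> 'v \<Rightarrow> 'v \<Rightarrow> nat" where
  "l1_dist K x y = (LEAST n. (adjacent K ^^ n) x y)"


section \<open>Geometric realization\<close>

text \<open>
  The point with coordinates \<open>p \<in> [0,1]\<^sup>n\<close> of an \<open>n\<close>-cube is represented by the weights with which it
  is the multi-affine combination of the corners: the corner \<open>U\<close> has weight
  \<open>\<Prod>i\<in>U. p i\<close> times \<open>\<Prod>i\<notin>U. (1 - p i)\<close>. A vertex is represented by its indicator function.
  This embeds the cube in the functions on the vertices, compatibly with passing to faces and
  independently of the chart, so that the cells are glued along common faces.
\<close>

definition cube_point :: "'v set \<Rightarrow> nat \<Rightarrow> (nat set \<Rightarrow> 'v) \<Rightarrow> (nat \<Rightarrow> real) \<Rightarrow> 'v \<Rightarrow> real" where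
  "cube_point C n \<kappa> p = (\<lambda>v. if v \<in> C
     then \<Prod>i<n. if i \<in> inv_into (Pow {..<n}) \<kappa> v then p i else 1 - p i
     else 0)"

definition cell :: "'v set set \<Rightarrow> 'v set \<Rightarrow> ('v \<Rightarrow> real) set" where
  "cell K C = {cube_point C n \<kappa> p | n \<kappa> p. cube_chart K C n \<kappa> \<and> (\<forall>i<n. 0 \<le> p i \<and> p i \<le> 1)}"

text \<open>
  The realization carries the subspace topology of the product topology on \<open>'v \<Rightarrow> real\<close>.
  For locally finite complexes this is the usual (weak and metric) topology, since the open star
  \<open>{w. w v > 0}\<close> of a vertex \<open>v\<close> is open and meets finitely many cells.
\<close>

definition realization :: "'v set set \<Rightarrow> ('v \<Rightarrow> real) set" where
  "realization K = (\<Union>C\<in>K. cell K C)"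

definition closed_star :: "'v set set \<Rightarrow> 'v \<Rightarrow> ('v \<Rightarrow> real) set" where
  "closed_star K v = (\<Union>C\<in>{C \<in> K. v \<in> C}. cell K C)"


section \<open>CAT(0) cube complexes\<close>

text \<open>The link of a vertex, as an abstract simplicial complex (with empty simplex) on its neighbours.\<close>

definition link :: "'v set set \<Rightarrow> 'v \<Rightarrow> 'v set set" where
  "link K v = {{u \<in> C. adjacent K v u} | C. C \<in> K \<and> v \<in> C}"

definition flag :: "'v set set \<Rightarrow> bool" where
  "flag L \<longleftrightarrow> (\<forall>A. finite A \<and> (\<forall>a\<in>A. \<forall>b\<in>A. {a, b} \<in> L) \<longrightarrow> A \<in> L)"

text \<open>
  A cube complex is CAT(0) if it is simply connected and the links of its vertices are flag.
  The topology on the realization is the right one here in the locally finite case only.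
\<close>

definition cat0_cube_complex :: "'v set set \<Rightarrow> bool" where
  "cat0_cube_complex K \<longleftrightarrow>
     cube_complex K \<and> simply_connected (realization K) \<and> (\<forall>v\<in>\<Union>K. flag (link K v))"


section \<open>Group actions\<close>

definition cellular_action ::
  "('g, 'm) monoid_scheme \<Rightarrow> ('g \<Rightarrow> 'v \<Rightarrow> 'v) \<Rightarrow> 'v set set \<Rightarrow> bool" where
  "cellular_action G \<phi> K \<longleftrightarrow>
     group_action G (\<Union>K) \<phi> \<and> (\<forall>g\<in>carrier G. \<forall>C\<in>K. \<phi> g ` C \<in> K)"

text \<open>The induced action on the realization, affine on cubes.\<close>

definition point_action ::
  "('g, 'm) monoid_scheme \<Rightarrow> ('g \<Rightarrow> 'v \<Rightarrow> 'v) \<Rightarrow> 'v set set \<Rightarrow> 'g \<Rightarrow> ('v \<Rightarrow> real) \<Rightarrow> 'v \<Rightarrow> real" where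
  "point_action G \<phi> K g w = (\<lambda>v. if v \<in> \<Union>K then w (\<phi> (inv\<^bsub>G\<^esub> g) v) else 0)"

definition quotient_proj ::
  "('g, 'm) monoid_scheme \<Rightarrow> ('g \<Rightarrow> 'v \<Rightarrow> 'v) \<Rightarrow> 'v set set \<Rightarrow> ('v \<Rightarrow> real) \<Rightarrow> ('v \<Rightarrow> real) set" where
  "quotient_proj G \<phi> K = orbit G (point_action G \<phi> K)"

text \<open>The topology \<open>Y\<close> is determined: it is the quotient topology on the set of orbits.\<close>

definition cocompact ::
  "('g, 'm) monoid_scheme \<Rightarrow> ('g \<Rightarrow> 'v \<Rightarrow> 'v) \<Rightarrow> 'v set set \<Rightarrow> bool" where
  "cocompact G \<phi> K \<longleftrightarrow>
     (\<exists>Y. quotient_map (top_of_set (realization K)) Y (quotient_proj G \<phi> K) \<and> compact_space Y)"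

definition stars_embedded ::
  "('g, 'm) monoid_scheme \<Rightarrow> ('g \<Rightarrow> 'v \<Rightarrow> 'v) \<Rightarrow> 'v set set \<Rightarrow> bool" where
  "stars_embedded G \<phi> K \<longleftrightarrow> (\<forall>v\<in>\<Union>K. inj_on (quotient_proj G \<phi> K) (closed_star K v))"

abbreviation vertex_orbits ::
  "('g, 'm) monoid_scheme \<Rightarrow> ('g \<Rightarrow> 'v \<Rightarrow> 'v) \<Rightarrow> 'v set set \<Rightarrow> 'v set set" where
  "vertex_orbits G \<phi> K \<equiv> orbits G (\<Union>K) \<phi>"

definition lift :: "'v set \<Rightarrow> 'v" where
  "lift a = (SOME x. x \<in> a)"


section \<open>Growth series and coefficients\<close>

text \<open>
  Integral power series are regarded as rational ones, \<open>rat\<close> being a field so that the expansions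
  of rational functions can be written as quotients.
\<close>

text \<open>The series \<open>\<Sum>z\<in>b. t^d(x,z)\<close>; the sets counted are finite in a locally finite complex.\<close>

definition growth_series :: "'v set set \<Rightarrow> 'v \<Rightarrow> 'v set \<Rightarrow> rat fps" where
  "growth_series K x b = Abs_fps (\<lambda>n. of_nat (card {z \<in> b. l1_dist K x z = n}))"

definition orbit_growth :: "'v set set \<Rightarrow> 'v set \<Rightarrow> 'v set \<Rightarrow> rat fps" where
  "orbit_growth K a b = growth_series K (lift a) b"

text \<open>The minimal cube containing two vertices, minimal with respect to inclusion.\<close>

definition min_cube :: "'v set set \<Rightarrow> 'v \<Rightarrow> 'v \<Rightarrow> 'v set" where
  "min_cube K x y = (LEAST C. C \<in> K \<and> x \<in> C \<and> y \<in> C)"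

definition f_poly :: "'v set set \<Rightarrow> 'v \<Rightarrow> 'v \<Rightarrow> rat poly" where
  "f_poly K x y =
     (if \<exists>C\<in>K. x \<in> C \<and> y \<in> C
      then \<Sum>Q | Q \<in> K \<and> min_cube K x y \<subseteq> Q. monom 1 (cube_dim K Q - cube_dim K (min_cube K x y))
      else 0)"

text \<open>Here \<open>f oo g\<close> is substitution of the series \<open>g\<close>, with zero constant term, into \<open>f\<close>.\<close>

definition vertex_coeff :: "'v set set \<Rightarrow> 'v \<Rightarrow> 'v \<Rightarrow> rat fps" where
  "vertex_coeff K x y =
     (- fps_X / (1 - fps_X\<^sup>2)) ^ l1_dist K x y *
     (fps_of_poly (f_poly K x y) oo (fps_X\<^sup>2 / (1 - fps_X\<^sup>2)))"

text \<open>The vertices of the star of \<open>x\<close> are the vertices of the cubes containing \<open>x\<close>.\<close>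

definition orbit_coeff :: "'v set set \<Rightarrow> 'v set \<Rightarrow> 'v set \<Rightarrow> rat fps" where
  "orbit_coeff K a b =
     (let x = lift a; S = \<Union>{C \<in> K. x \<in> C} in
      if \<exists>y. y \<in> b \<inter> S then vertex_coeff K x (THE y. y \<in> b \<inter> S) else 0)"

definition inverse_matrices :: "'i set \<Rightarrow> ('i \<Rightarrow> 'i \<Rightarrow> 'a::comm_ring_1) \<Rightarrow> ('i \<Rightarrow> 'i \<Rightarrow> 'a) \<Rightarrow> bool" where
  "inverse_matrices I A B \<longleftrightarrow> finite I \<and>
     (\<forall>i\<in>I. \<forall>j\<in>I. (\<Sum>k\<in>I. A i k * B k j) = (if i = j then 1 else 0)) \<and>
     (\<forall>i\<in>I. \<forall>j\<in>I. (\<Sum>k\<in>I. B i k * A k j) = (if i = j then 1 else 0))"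

end

theory Submission
  imports Defs "Jordan_Normal_Form.Determinant"
begin

text \<open>
  Writing \<open>a = -t/(1-t\<^sup>2)\<close> and \<open>b = t\<^sup>2/(1-t\<^sup>2)\<close>, the coefficient \<open>c\<close> of two vertices \<open>x\<close>, \<open>z\<close> is the sum
  of \<open>a^d(x,z) b^(dim Q - d(x,z))\<close> over the cubes \<open>Q\<close> containing both. Hence the sum of
  \<open>c t^d(z,w)\<close> over the vertices \<open>z\<close> of the star of \<open>x\<close> splits into contributions of the cubes \<open>Q\<close> at
  \<open>x\<close>. The distance to \<open>w\<close> is additive on the coordinates of \<open>Q\<close>, so each contribution is a product
  over the coordinates; it vanishes unless all edges of \<open>Q\<close> at \<open>x\<close> lead towards \<open>w\<close>, and is
  \<open>(-1)^dim Q t^d(x,w)\<close> otherwise. The neighbours of \<open>x\<close> nearer to \<open>w\<close> span a cube, so these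
  contributions cancel unless \<open>x = w\<close>. As stars are embedded, summing over an orbit of vertices \<open>w\<close>
  shows that one product of the two matrices is the identity, and then so is the other.

  The facts on distances follow from the quadrangle condition: two neighbours \<open>v\<close>, \<open>v'\<close> of \<open>u\<close> that are
  nearer to \<open>w\<close> than \<open>u\<close> lie in a square with \<open>u\<close> whose fourth vertex is still nearer. To prove it,
  edge paths starting at \<open>w\<close> are considered up to swapping two consecutive edges across a square. By
  flagness two equivalent paths that end with different edges end in the two sides of a square.
  It follows that the classes of the paths without cancellation form a covering of the complex. As
  the complex is simply connected, this covering has a global section, which assigns to every vertex
  the class of the geodesics from \<open>w\<close> to it.
\<close>

section \<open>Cubes and squares\<close>

text \<open>The constants \<open>a\<close> and \<open>b\<close> are the solution of
  \<open>a t + b = 0\<close> and \<open>a + b t = -t\<close>; the left sides are the factors of one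
  coordinate of \<open>Q\<close> in which \<open>x\<close> lies on the side near to
  \<open>w\<close>, respectively on the far side. The main obstacle is that distances are
  combinatorial while simple connectivity concerns a topological realization. The covering bridges
  the two. Swaps preserve length, so a class of paths has a length, which a homotopy class has not.
  A global section picks one reduced class for each vertex, and the lengths picked at adjacent
  vertices differ by exactly one. An edge path from \<open>w\<close> with \<open>n\<close> edges
  therefore ends at a vertex whose class has at most \<open>n\<close> edges, which is why the chosen
  classes consist of geodesics. That edges and squares lift uniquely to classes rests on the
  comparison of last edges of equivalent paths, where flagness supplies 3-cubes.\<close>

lemma cube_chart_inj: "cube_chart K C n \<kappa> \<Longrightarrow> inj_on \<kappa> (Pow {..<n})"
  by (auto simp: cube_chart_def bij_betw_def)

lemma cube_chart_image: "cube_chart K C n \<kappa> \<Longrightarrow> C = \<kappa> ` Pow {..<n}"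
  by (auto simp: cube_chart_def bij_betw_def)

lemma cube_chart_eq_iff:
  "cube_chart K C n \<kappa> \<Longrightarrow> U \<subseteq> {..<n} \<Longrightarrow> V \<subseteq> {..<n} \<Longrightarrow> \<kappa> U = \<kappa> V \<longleftrightarrow> U = V"
  using inj_on_eq_iff[OF cube_chart_inj] by blast

lemma cube_chart_face_iff:
  "cube_chart K C n \<kappa> \<Longrightarrow>
    A \<in> K \<and> A \<subseteq> C \<longleftrightarrow> (\<exists>S T. A = \<kappa> ` {U. S \<subseteq> U \<and> U \<subseteq> T} \<and> S \<subseteq> T \<and> T \<subseteq> {..<n})"
  unfolding cube_chart_def set_eq_iff mem_Collect_eq by simp

lemma cube_chart_face:
  "cube_chart K C n \<kappa> \<Longrightarrow> S \<subseteq> T \<Longrightarrow> T \<subseteq> {..<n} \<Longrightarrow> \<kappa> ` {U. S \<subseteq> U \<and> U \<subseteq> T} \<in> K"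
  using cube_chart_face_iff by blast

lemma cube_chart_mem: "cube_chart K C n \<kappa> \<Longrightarrow> C \<in> K"
  using cube_chart_face[of K C n \<kappa> "{}" "{..<n}"] cube_chart_image[of K C n \<kappa>] by (simp add: Pow_def)

lemma cube_chart_card: "cube_chart K C n \<kappa> \<Longrightarrow> card C = 2 ^ n"
  using bij_betw_same_card[of \<kappa> "Pow {..<n}" C] by (simp add: cube_chart_def card_Pow)

lemma cube_dim_eq:
  assumes "cube_chart K C n \<kappa>"
  shows "cube_dim K C = n"
  unfolding cube_dim_def
proof (rule the_equality)
  fix m assume "\<exists>\<kappa>. cube_chart K C m \<kappa>"
  then have "(2::nat) ^ m = 2 ^ n" using cube_chart_card assms by metis
  then show "m = n" by simp
qed (use assms in blast)

lemma cube_chart_finite: "cube_chart K C n \<kappa> \<Longrightarrow> finite C"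
  using cube_chart_image by (metis finite_Pow_iff finite_imageI finite_lessThan)

text \<open>Reflecting the cube in the coordinates of \<open>A\<close> permutes its faces. The face
  with bounds \<open>S\<close> and \<open>T\<close> has the coordinates in \<open>S\<close> fixed at
  1 and those outside \<open>T\<close> fixed at 0; for coordinates in \<open>A\<close> the two roles
  are exchanged.\<close>

lemma sym_diff_interval:
  assumes "S \<subseteq> T"
  shows "(\<lambda>U. sym_diff U A) ` {U. S \<subseteq> U \<and> U \<subseteq> T} =
    {V. (S - A) \<union> (A - T) \<subseteq> V \<and> V \<subseteq> (T - A) \<union> (A - S)}" (is "?l = ?r")
proof
  show "?l \<subseteq> ?r" by auto
  show "?r \<subseteq> ?l"
  proof
    fix V assume "V \<in> ?r"
    then have "S \<subseteq> sym_diff V A" "sym_diff V A \<subseteq> T" using assms by auto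
    moreover have "V = sym_diff (sym_diff V A) A" by auto
    ultimately show "V \<in> ?l" by blast
  qed
qed

text \<open>Any corner can serve as origin: the new chart sends the empty set to
  \<open>\<kappa> A\<close>. This is why computations at a vertex of a cube may assume that the
  vertex is \<open>\<kappa> {}\<close>.\<close>

lemma cube_chart_rebase:
  assumes ch: "cube_chart K C n \<kappa>" and A: "A \<subseteq> {..<n}"
  shows "cube_chart K C n (\<lambda>U. \<kappa> (sym_diff U A))"
proof -
  have invol: "sym_diff (sym_diff U A) A = U" for U by blast
  have bA: "bij_betw (\<lambda>U. sym_diff U A) (Pow {..<n}) (Pow {..<n})"
    by (rule bij_betw_byWitness[where f' = "\<lambda>U. sym_diff U A"]) (use A in auto)
  have b: "bij_betw (\<lambda>U. \<kappa> (sym_diff U A)) (Pow {..<n}) C"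
    using bij_betw_trans[OF bA, of \<kappa> C] ch by (simp add: cube_chart_def comp_def)
  have im: "(\<lambda>U. \<kappa> (sym_diff U A)) ` X = \<kappa> ` (\<lambda>U. sym_diff U A) ` X" for X by (simp add: image_image)
  have "(\<exists>S T. B = \<kappa> ` {U. S \<subseteq> U \<and> U \<subseteq> T} \<and> S \<subseteq> T \<and> T \<subseteq> {..<n}) \<longleftrightarrow>
    (\<exists>S T. B = (\<lambda>U. \<kappa> (sym_diff U A)) ` {U. S \<subseteq> U \<and> U \<subseteq> T} \<and> S \<subseteq> T \<and> T \<subseteq> {..<n})" (is "?L \<longleftrightarrow> ?R") for B
  proof
    assume ?L
    then obtain S T where ST: "B = \<kappa> ` {U. S \<subseteq> U \<and> U \<subseteq> T}" "S \<subseteq> T" "T \<subseteq> {..<n}" by blast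
    let ?S = "(S - A) \<union> (A - T)" and ?T = "(T - A) \<union> (A - S)"
    have "(\<lambda>U. sym_diff U A) ` {V. ?S \<subseteq> V \<and> V \<subseteq> ?T} = {U. S \<subseteq> U \<and> U \<subseteq> T}"
      unfolding sym_diff_interval[OF ST(2), symmetric] image_image invol by simp
    moreover have "?S \<subseteq> ?T" using ST(2) by auto
    moreover have "?T \<subseteq> {..<n}" using ST(2,3) A by auto
    moreover have "B = (\<lambda>U. \<kappa> (sym_diff U A)) ` {V. ?S \<subseteq> V \<and> V \<subseteq> ?T}"
      unfolding im using calculation(1) ST(1) by simp
    ultimately show ?R by (intro exI[of _ ?S] exI[of _ ?T] conjI)
  next
    assume ?R
    then obtain S T where ST: "B = (\<lambda>U. \<kappa> (sym_diff U A)) ` {U. S \<subseteq> U \<and> U \<subseteq> T}" "S \<subseteq> T" "T \<subseteq> {..<n}" by blast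
    have "(S - A) \<union> (A - T) \<subseteq> (T - A) \<union> (A - S)" using ST(2) by auto
    moreover have "(T - A) \<union> (A - S) \<subseteq> {..<n}" using ST(3) A by auto
    moreover have "B = \<kappa> ` {V. (S - A) \<union> (A - T) \<subseteq> V \<and> V \<subseteq> (T - A) \<union> (A - S)}"
      using ST(1) unfolding im sym_diff_interval[OF ST(2)] .
    ultimately show ?L
      by (intro exI[of _ "(S - A) \<union> (A - T)"] exI[of _ "(T - A) \<union> (A - S)"] conjI)
  qed
  then have "{B \<in> K. B \<subseteq> C} = {(\<lambda>U. \<kappa> (sym_diff U A)) ` {U. S \<subseteq> U \<and> U \<subseteq> T} | S T. S \<subseteq> T \<and> T \<subseteq> {..<n}}"
    unfolding cube_chart_face_iff[OF ch] by simp
  then show ?thesis using b unfolding cube_chart_def by (rule conjI[rotated])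
qed

lemma cube_chart_edge:
  assumes ch: "cube_chart K C n \<kappa>" and U: "U \<subseteq> {..<n}" "i < n" "i \<notin> U"
  shows "adjacent K (\<kappa> U) (\<kappa> (insert i U))"
proof -
  have "{V. U \<subseteq> V \<and> V \<subseteq> insert i U} = {U, insert i U}" by blast
  then have "{\<kappa> U, \<kappa> (insert i U)} \<in> K"
    using cube_chart_face[OF ch, of U "insert i U"] U by auto
  moreover have "\<kappa> U \<noteq> \<kappa> (insert i U)" using cube_chart_eq_iff[OF ch, of U "insert i U"] U by auto
  ultimately show ?thesis by (simp add: adjacent_def)
qed

text \<open>An edge at the origin comes from an interval \<open>{{}, U}\<close> of subsets. Being an
  interval, it contains \<open>{i}\<close> for every \<open>i \<in> U\<close>, so \<open>U\<close>
  is a singleton.\<close>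

lemma cube_chart_adjacent_iff:
  assumes ch: "cube_chart K C n \<kappa>" and U: "U \<subseteq> {..<n}"
  shows "adjacent K (\<kappa> {}) (\<kappa> U) \<longleftrightarrow> (\<exists>i<n. U = {i})"
proof
  assume a: "adjacent K (\<kappa> {}) (\<kappa> U)"
  then have "{\<kappa> {}, \<kappa> U} \<in> K \<and> {\<kappa> {}, \<kappa> U} \<subseteq> C"
    using cube_chart_image[OF ch] U by (auto simp: adjacent_def)
  from iffD1[OF cube_chart_face_iff[OF ch] this]
  obtain S T where ST: "{\<kappa> {}, \<kappa> U} = \<kappa> ` {V. S \<subseteq> V \<and> V \<subseteq> T}" "S \<subseteq> T" "T \<subseteq> {..<n}"
    by (elim exE conjE)
  have "\<kappa> ` {{}, U} = \<kappa> ` {V. S \<subseteq> V \<and> V \<subseteq> T}" using ST(1) by simp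
  moreover have "{{}, U} \<subseteq> Pow {..<n}" "{V. S \<subseteq> V \<and> V \<subseteq> T} \<subseteq> Pow {..<n}" using U ST by auto
  ultimately have eq: "{{}, U} = {V. S \<subseteq> V \<and> V \<subseteq> T}"
    by (rule iffD1[OF inj_on_image_eq_iff[OF cube_chart_inj[OF ch]], rotated 2])
  have "U \<noteq> {}" using a by (metis adjacent_def)
  then obtain i where "i \<in> U" by blast
  have "{} \<in> {V. S \<subseteq> V \<and> V \<subseteq> T}" "U \<in> {V. S \<subseteq> V \<and> V \<subseteq> T}" using eq by blast+
  then have "{i} \<in> {V. S \<subseteq> V \<and> V \<subseteq> T}" using \<open>i \<in> U\<close> by auto
  then have "{i} = U" unfolding eq[symmetric] by auto
  then show "\<exists>i<n. U = {i}" using U by auto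
qed (use cube_chart_edge[OF ch, of "{}"] in auto)

lemma cube_chart_adjacentE:
  assumes ch: "cube_chart K C n \<kappa>" and U: "U \<subseteq> {..<n}" and V: "V \<subseteq> {..<n}"
    and adj: "adjacent K (\<kappa> U) (\<kappa> V)"
  obtains i where "i < n" "i \<notin> U" "V = insert i U" | i where "i < n" "i \<notin> V" "U = insert i V"
proof -
  let ?W = "sym_diff V U"
  have inv: "sym_diff ?W U = V" by auto
  have W: "?W \<subseteq> {..<n}" using U V by auto
  have "adjacent K (\<kappa> (sym_diff {} U)) (\<kappa> (sym_diff ?W U))" unfolding inv using adj by simp
  then obtain i where i: "i < n" "?W = {i}"
    using iffD1[OF cube_chart_adjacent_iff[OF cube_chart_rebase[OF ch U] W]] by blast
  have V: "V = sym_diff {i} U" using inv unfolding i(2) by simp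
  show thesis
  proof (cases "i \<in> U")
    case True
    then have "V = U - {i}" using V by simp
    then have "i \<notin> V" "U = insert i V" using True by auto
    then show thesis by (rule that(2)[OF i(1)])
  next
    case False
    then have "V = insert i U" using V by simp
    then show thesis by (rule that(1)[OF i(1) False])
  qed
qed

lemma adjacent_sym: "adjacent K u v \<longleftrightarrow> adjacent K v u"
  by (auto simp: adjacent_def insert_commute)

definition square :: "'v set set \<Rightarrow> 'v \<Rightarrow> 'v \<Rightarrow> 'v \<Rightarrow> 'v \<Rightarrow> bool" where
  "square K a b c d \<longleftrightarrow> {a, b, c, d} \<in> K \<and> a \<noteq> c \<and> b \<noteq> d \<and>
     adjacent K a b \<and> adjacent K b c \<and> adjacent K c d \<and> adjacent K d a"

lemma square_rotate: "square K a b c d \<Longrightarrow> square K b c d a"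
  by (auto simp: square_def insert_commute)

lemma square_flip: "square K a b c d \<Longrightarrow> square K a d c b"
  by (auto simp: square_def insert_commute adjacent_sym)

lemma square_distinct:
  "square K a b c d \<Longrightarrow> a \<noteq> b \<and> a \<noteq> c \<and> a \<noteq> d \<and> b \<noteq> c \<and> b \<noteq> d \<and> c \<noteq> d"
  by (auto simp: square_def adjacent_def)

lemma cube_chart_square:
  assumes ch: "cube_chart K C n \<kappa>" and U: "U \<subseteq> {..<n}" "i < n" "j < n" "i \<noteq> j" "i \<notin> U" "j \<notin> U"
  shows "square K (\<kappa> U) (\<kappa> (insert i U)) (\<kappa> (insert i (insert j U))) (\<kappa> (insert j U))"
proof -
  have "{V. U \<subseteq> V \<and> V \<subseteq> insert i (insert j U)} = {U, insert i U, insert i (insert j U), insert j U}"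
    by blast
  moreover have "\<kappa> ` {V. U \<subseteq> V \<and> V \<subseteq> insert i (insert j U)} \<in> K"
    by (rule cube_chart_face[OF ch]) (use U in auto)
  ultimately have 1: "{\<kappa> U, \<kappa> (insert i U), \<kappa> (insert i (insert j U)), \<kappa> (insert j U)} \<in> K" by simp
  have "adjacent K (\<kappa> U) (\<kappa> (insert i U))" "adjacent K (\<kappa> U) (\<kappa> (insert j U))"
    by (rule cube_chart_edge[OF ch]; use U in simp)+
  moreover have "adjacent K (\<kappa> (insert j U)) (\<kappa> (insert i (insert j U)))"
    "adjacent K (\<kappa> (insert i U)) (\<kappa> (insert j (insert i U)))"
    by (rule cube_chart_edge[OF ch]; use U in simp)+
  moreover have "\<kappa> U \<noteq> \<kappa> (insert i (insert j U))" "\<kappa> (insert i U) \<noteq> \<kappa> (insert j U)"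
    by (subst cube_chart_eq_iff[OF ch]; use U in auto)+
  ultimately show ?thesis using 1 by (simp add: square_def adjacent_sym insert_commute)
qed

locale cube_cx =
  fixes K :: "'v set set"
  assumes cube_complex: "cube_complex K"
begin

lemma Int_cube: "C \<in> K \<Longrightarrow> D \<in> K \<Longrightarrow> x \<in> C \<Longrightarrow> x \<in> D \<Longrightarrow> C \<inter> D \<in> K"
  using cube_complex by (auto simp: cube_complex_def)

lemma chart_exists: assumes "C \<in> K" obtains \<kappa> where "cube_chart K C (cube_dim K C) \<kappa>"
proof -
  obtain n \<kappa> where "cube_chart K C n \<kappa>"
    using assms cube_complex unfolding cube_complex_def by blast
  then show thesis using that cube_dim_eq by metis
qed

lemma chart_at:
  assumes "C \<in> K" "x \<in> C"
  obtains \<kappa> where "cube_chart K C (cube_dim K C) \<kappa>" "\<kappa> {} = x"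
proof -
  obtain \<kappa> where ch: "cube_chart K C (cube_dim K C) \<kappa>" using chart_exists assms by blast
  then obtain A where "A \<subseteq> {..<cube_dim K C}" "x = \<kappa> A" using assms cube_chart_image by blast
  then show thesis using that[OF cube_chart_rebase[OF ch]] by (metis Diff_empty Diff_eq_empty_iff Un_empty_left empty_subsetI)
qed

lemma finite_cube: "C \<in> K \<Longrightarrow> finite C"
  using chart_exists cube_chart_finite by metis

lemma card_cube: "C \<in> K \<Longrightarrow> card C = 2 ^ cube_dim K C"
  using chart_exists cube_chart_card by metis

lemma adjacent_vertices: "adjacent K u v \<Longrightarrow> u \<in> \<Union>K \<and> v \<in> \<Union>K"
  by (auto simp: adjacent_def)

lemma neighbours_in_cube:
  assumes "cube_chart K C n \<kappa>"
  shows "{u \<in> C. adjacent K (\<kappa> {}) u} = (\<lambda>i. \<kappa> {i}) ` {..<n}"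
proof -
  have "u \<in> (\<lambda>i. \<kappa> {i}) ` {..<n}" if "u \<in> C" "adjacent K (\<kappa> {}) u" for u
  proof -
    obtain U where U: "U \<subseteq> {..<n}" "u = \<kappa> U" using \<open>u \<in> C\<close> cube_chart_image[OF assms] by auto
    then show ?thesis using cube_chart_adjacent_iff[OF assms U(1)] that(2) by auto
  qed
  moreover have "\<kappa> {i} \<in> C" "adjacent K (\<kappa> {}) (\<kappa> {i})" if "i < n" for i
    using cube_chart_image[OF assms] cube_chart_adjacent_iff[OF assms, of "{i}"] that by auto
  ultimately show ?thesis by auto
qed

lemma card_neighbours_in_cube:
  assumes "C \<in> K" "x \<in> C"
  shows "card {u \<in> C. adjacent K x u} = cube_dim K C"
proof -
  obtain \<kappa> where ch: "cube_chart K C (cube_dim K C) \<kappa>" and x: "\<kappa> {} = x" using chart_at assms by blast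
  have "inj_on (\<lambda>i. \<kappa> {i}) {..<cube_dim K C}"
    by (rule inj_onI) (use cube_chart_eq_iff[OF ch] in auto)
  then show ?thesis using neighbours_in_cube[OF ch] x by (simp add: card_image)
qed

text \<open>The cardinality of the intersection is a power of 2 and at least 3.\<close>

lemma square_unique:
  assumes "square K a b c d" "square K a b c d'"
  shows "d = d'"
proof -
  let ?C = "{a,b,c,d}" and ?D = "{a,b,c,d'}"
  note dis = square_distinct[OF assms(1)] square_distinct[OF assms(2)]
  have CD: "?C \<in> K" "?D \<in> K" using assms unfolding square_def by blast+
  have I: "?C \<inter> ?D \<in> K" by (rule Int_cube[OF CD, of a]) auto
  have "card ?C = 4" "card ?D = 4" using dis by auto
  have "card {a,b,c} = 3" using dis by auto
  moreover have "card {a,b,c} \<le> card (?C \<inter> ?D)" by (rule card_mono) auto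
  ultimately have ge: "3 \<le> card (?C \<inter> ?D)" by simp
  have "\<not> 2 ^ n = (3::nat)" for n :: nat
    by (cases n) (auto, presburger)
  then have "card (?C \<inter> ?D) \<noteq> 3" using card_cube[OF I] by metis
  then have "card (?C \<inter> ?D) \<ge> card ?D" using ge \<open>card ?D = 4\<close> by simp
  then have "?C \<inter> ?D = ?D" by (intro card_seteq) auto
  then have "d' \<in> {a,b,c,d}" by blast
  then show ?thesis using dis by auto
qed

lemma square_unique_opposite:
  assumes "square K a b c d" "square K a b c' d"
  shows "c = c'"
  using assms[THEN square_rotate, THEN square_rotate, THEN square_rotate] by (rule square_unique)

text \<open>A vertex of a 2-cube has exactly two neighbours in it, so the diagonal corner
  \<open>c\<close> is not one of them, and the simplex given by the square is
  \<open>{b, d}\<close>.\<close>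

lemma square_link:
  assumes "square K a b c d"
  shows "{b, d} \<in> link K a"
proof -
  let ?C = "{a,b,c,d}"
  have C: "?C \<in> K" using assms by (simp add: square_def)
  note dis = square_distinct[OF assms]
  have "(2::nat) ^ cube_dim K ?C = 2 ^ 2" using card_cube[OF C] dis by auto
  then have "cube_dim K ?C = 2" by (metis one_less_numeral_iff power_inject_exp semiring_norm(76))
  then have "card {u \<in> ?C. adjacent K a u} = 2" using card_neighbours_in_cube[OF C] by simp
  moreover have "{b,d} \<subseteq> {u \<in> ?C. adjacent K a u}" using assms by (auto simp: square_def adjacent_sym)
  ultimately have "{b,d} = {u \<in> ?C. adjacent K a u}"
    using dis by (intro card_seteq) auto
  then show ?thesis unfolding link_def using C by blast
qed

lemma singleton_link:
  assumes "adjacent K a b"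
  shows "{b} \<in> link K a"
proof -
  have "{b} = {u \<in> {a,b}. adjacent K a u}" using assms by (auto simp: adjacent_def)
  moreover have "{a,b} \<in> K" using assms by (simp add: adjacent_def)
  ultimately show ?thesis unfolding link_def by blast
qed

end

locale flag_cube_cx = cube_cx K for K :: "'v set set" +
  assumes flag_links: "v \<in> \<Union>K \<Longrightarrow> flag (link K v)"
begin

text \<open>The squares make the elements of \<open>A\<close> pairwise joined in the link of
  \<open>v\<close>; flagness then makes \<open>A\<close> a simplex, that is, the exact set of
  neighbours of \<open>v\<close> in some cube.\<close>

lemma neighbours_span_cube:
  assumes "finite A" "v \<in> \<Union>K" "\<And>a. a \<in> A \<Longrightarrow> adjacent K v a"
    and "\<And>a b. a \<in> A \<Longrightarrow> b \<in> A \<Longrightarrow> a \<noteq> b \<Longrightarrow> \<exists>c. square K v a c b"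
  obtains C where "C \<in> K" "v \<in> C" "{u \<in> C. adjacent K v u} = A"
proof -
  have "{a, b} \<in> link K v" if "a \<in> A" "b \<in> A" for a b
  proof (cases "a = b")
    case True then show ?thesis using singleton_link assms(3) that by simp
  next
    case False then show ?thesis using square_link assms(4) that by blast
  qed
  then have "A \<in> link K v" using flag_links[OF assms(2)] assms(1) unfolding flag_def by blast
  then obtain C where "A = {u \<in> C. adjacent K v u}" "C \<in> K" "v \<in> C"
    unfolding link_def by blast
  then show thesis using that[of C] by simp
qed

text \<open>The neighbours \<open>b\<close>, \<open>c\<close>, \<open>d\<close> span a 3-cube at
  \<open>a\<close>. Its squares at \<open>a\<close> must be the given ones, since three corners
  determine a square, and \<open>w\<close> is the corner opposite to \<open>a\<close>.\<close>

lemma cube_completion: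
  assumes "square K a b p c" "square K a c q d" "square K a b r d"
  obtains w where "square K b p w r" "square K c p w q" "square K d q w r" "p \<noteq> r"
proof -
  have dis: "b \<noteq> c" "c \<noteq> d" "b \<noteq> d" using assms by (auto simp: square_def)
  have sq: "\<exists>e. square K a x e y" if "x \<in> {b,c,d}" "y \<in> {b,c,d}" "x \<noteq> y" for x y
    using that assms assms[THEN square_flip] by auto
  have adj: "a \<in> \<Union>K" "\<And>x. x \<in> {b,c,d} \<Longrightarrow> adjacent K a x"
    using assms by (auto simp: square_def adjacent_sym)
  obtain C where C: "C \<in> K" "a \<in> C" and nb: "{u \<in> C. adjacent K a u} = {b,c,d}"
    by (rule neighbours_span_cube[of "{b,c,d}" a]) (use adj sq in simp_all)
  obtain \<kappa> n where ch: "cube_chart K C n \<kappa>" and a: "\<kappa> {} = a" using chart_at[OF C] by metis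
  have "b \<in> (\<lambda>i. \<kappa> {i}) ` {..<n}" "c \<in> (\<lambda>i. \<kappa> {i}) ` {..<n}" "d \<in> (\<lambda>i. \<kappa> {i}) ` {..<n}"
    unfolding neighbours_in_cube[OF ch, symmetric] a nb by auto
  then obtain i j k where ijk: "i < n" "j < n" "k < n" "b = \<kappa> {i}" "c = \<kappa> {j}" "d = \<kappa> {k}" by auto
  have ne: "i \<noteq> j" "j \<noteq> k" "i \<noteq> k" using dis ijk by auto
  have "square K a b (\<kappa> {i,j}) c" using cube_chart_square[OF ch, of "{}" i j] ijk ne a by simp
  then have p: "p = \<kappa> {i,j}" using assms(1) square_unique_opposite by blast
  have "square K a c (\<kappa> {j,k}) d" using cube_chart_square[OF ch, of "{}" j k] ijk ne a by simp
  then have q: "q = \<kappa> {j,k}" using assms(2) square_unique_opposite by blast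
  have "square K a b (\<kappa> {i,k}) d" using cube_chart_square[OF ch, of "{}" i k] ijk ne a by simp
  then have r: "r = \<kappa> {i,k}" using assms(3) square_unique_opposite by blast
  have "square K b p (\<kappa> {i,j,k}) r" "square K c p (\<kappa> {i,j,k}) q" "square K d q (\<kappa> {i,j,k}) r"
    using cube_chart_square[OF ch, of "{i}" j k] cube_chart_square[OF ch, of "{j}" i k]
      cube_chart_square[OF ch, of "{k}" j i] ijk ne p q r by (simp_all add: insert_commute)
  moreover have "p \<noteq> r" using p r cube_chart_eq_iff[OF ch, of "{i,j}" "{i,k}"] ijk ne by auto
  ultimately show thesis using that by blast
qed

end

section \<open>Edge paths up to swaps\<close>

text \<open>This is homotopy across squares without insertion or removal of backtracks, so that the
  length and both ends are invariants of a class.\<close>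

inductive path_swap :: "'v set set \<Rightarrow> 'v list \<Rightarrow> 'v list \<Rightarrow> bool" for K where
  swap_square: "square K a b c d \<Longrightarrow> path_swap K (c # b # a # p) (c # d # a # p)"
| swap_Cons: "path_swap K p q \<Longrightarrow> path_swap K (x # p) (x # q)"

abbreviation path_swaps :: "'v set set \<Rightarrow> 'v list \<Rightarrow> 'v list \<Rightarrow> bool" where
  "path_swaps K \<equiv> (path_swap K)\<^sup>*\<^sup>*"

definition backtracks :: "'v list \<Rightarrow> bool" where
  "backtracks p \<longleftrightarrow> (\<exists>xs a b ys. p = xs @ a # b # a # ys)"

text \<open>Quantifying over all swapped paths makes reducedness a property of the class and detects
  cancellations that show up only after some swaps.\<close>

definition reduced_path :: "'v set set \<Rightarrow> 'v list \<Rightarrow> bool" where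
  "reduced_path K p \<longleftrightarrow> (\<forall>q. path_swaps K p q \<longrightarrow> \<not> backtracks q)"

text \<open>Edge paths are listed from their end to their start.\<close>

definition edge_path :: "'v set set \<Rightarrow> 'v list \<Rightarrow> bool" where
  "edge_path K p \<longleftrightarrow> p \<noteq> [] \<and> set p \<subseteq> \<Union>K \<and> successively (adjacent K) p"

lemma swap_sym: "path_swap K p q \<Longrightarrow> path_swap K q p"
  by (induction rule: path_swap.induct) (auto intro: path_swap.intros square_flip)

lemma swaps_sym: "path_swaps K p q \<Longrightarrow> path_swaps K q p"
  by (induction rule: rtranclp_induct) (auto intro: converse_rtranclp_into_rtranclp swap_sym)

lemma swap_length: "path_swap K p q \<Longrightarrow> length p = length q"
  by (induction rule: path_swap.induct) auto

lemma swaps_length: "path_swaps K p q \<Longrightarrow> length p = length q"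
  by (induction rule: rtranclp_induct) (auto dest: swap_length)

lemma swap_hd: "path_swap K p q \<Longrightarrow> hd p = hd q"
  by (cases rule: path_swap.cases) auto

lemma swaps_hd: "path_swaps K p q \<Longrightarrow> hd p = hd q"
  by (induction rule: rtranclp_induct) (auto dest: swap_hd)

lemma swap_last: "path_swap K p q \<Longrightarrow> last p = last q"
proof (induction rule: path_swap.induct)
  case (swap_Cons p q x)
  then show ?case using swap_length[OF swap_Cons.hyps] by auto
qed simp

lemma swaps_last: "path_swaps K p q \<Longrightarrow> last p = last q"
  by (induction rule: rtranclp_induct) (auto dest: swap_last)

lemma swaps_Cons: "path_swaps K p q \<Longrightarrow> path_swaps K (x # p) (x # q)"
  by (induction rule: rtranclp_induct) (auto intro: swap_Cons rtranclp.rtrancl_into_rtrancl)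

lemma swaps_square: "square K a b c d \<Longrightarrow> path_swaps K (c # b # a # p) (c # d # a # p)"
  by (rule r_into_rtranclp) (rule swap_square)

lemma swap_edge_path: "path_swap K p q \<Longrightarrow> edge_path K p \<Longrightarrow> edge_path K q"
proof (induction rule: path_swap.induct)
  case (swap_square a b c d p)
  then have "adjacent K c d" "adjacent K d a" by (auto simp: square_def)
  moreover have "d \<in> \<Union>K"
    using swap_square by (intro UnionI[of "{a,b,c,d}"]) (auto simp: square_def)
  ultimately show ?case using swap_square by (auto simp: edge_path_def)
next
  case (swap_Cons p q x)
  have ne: "p \<noteq> []" "q \<noteq> []" using swap_Cons.hyps by (auto elim: path_swap.cases)
  then show ?case using swap_Cons swap_hd[OF swap_Cons.hyps]
    by (auto simp: edge_path_def successively_Cons)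
qed

lemma swaps_edge_path: "path_swaps K p q \<Longrightarrow> edge_path K p \<Longrightarrow> edge_path K q"
  by (induction rule: rtranclp_induct) (auto intro: swap_edge_path)

lemma swaps_ConsE:
  assumes "path_swaps K (x # p) q" obtains q' where "q = x # q'"
  using swaps_hd[OF assms] swaps_length[OF assms] by (cases q) auto

lemma backtracks_Cons:
  "backtracks (x # p) \<longleftrightarrow> backtracks p \<or> (\<exists>b ys. p = b # x # ys)"
proof
  assume "backtracks (x # p)"
  then obtain xs a b ys where "x # p = xs @ a # b # a # ys" unfolding backtracks_def by blast
  then show "backtracks p \<or> (\<exists>b ys. p = b # x # ys)"
    by (cases xs) (auto simp: backtracks_def)
next
  have "backtracks (x # p)" if "backtracks p"
    using that unfolding backtracks_def by (metis append_Cons)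
  moreover have "backtracks (x # b # x # ys)" for b ys
    unfolding backtracks_def by (metis append_Nil)
  ultimately show "backtracks p \<or> (\<exists>b ys. p = b # x # ys) \<Longrightarrow> backtracks (x # p)" by blast
qed

lemma reduced_swaps: "path_swaps K p q \<Longrightarrow> reduced_path K p \<Longrightarrow> reduced_path K q"
  unfolding reduced_path_def by (meson rtranclp_trans)

lemma reduced_ConsD: "reduced_path K (x # p) \<Longrightarrow> reduced_path K p"
  unfolding reduced_path_def using swaps_Cons backtracks_Cons by metis

lemma not_reduced_backtrack: "\<not> reduced_path K (x # y # x # p)"
  unfolding reduced_path_def using backtracks_Cons by fastforce

lemma not_reduced_swaps_backtrack: "path_swaps K p (x # y # x # q) \<Longrightarrow> \<not> reduced_path K p"
  using not_reduced_backtrack reduced_swaps by metis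

context flag_cube_cx
begin

text \<open>
  Induction over the chain of swaps: two successive squares at the end of the path are replaced by
  one square of the 3-cube that completes them.
\<close>

lemma swaps_last_edge:
  "path_swaps K (v # p) (v # q) \<Longrightarrow>
    path_swaps K p q \<or> (\<exists>u w z r. square K z u v w \<and> path_swaps K p (u # z # r) \<and> path_swaps K q (w # z # r))"
proof (induction "length p" arbitrary: v p q rule: less_induct)
  case less
  let ?R = "\<lambda>q. path_swaps K p q \<or>
    (\<exists>u w z r. square K z u v w \<and> path_swaps K p (u # z # r) \<and> path_swaps K q (w # z # r))"
  \<comment> \<open>The claim is carried along the chain of swaps for the tail of the current path;
    all paths of the chain keep the head \<open>v\<close>.\<close>
  have "?R (tl q)" if "path_swaps K (v # p) q" for q
    using that
  proof (induction rule: rtranclp_induct)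
    case (step q q')
    show ?case using step(2)
    proof (cases rule: path_swap.cases)
      case (swap_Cons s s' x)
      then have st: "path_swap K (tl q) (tl q')" by simp
      show ?thesis using step.IH
      proof (elim disjE exE conjE)
        assume "path_swaps K p (tl q)"
        then show ?thesis using st rtranclp.rtrancl_into_rtrancl by metis
      next
        fix u w z r assume "square K z u v w" "path_swaps K p (u # z # r)" "path_swaps K (tl q) (w # z # r)"
        moreover then have "path_swaps K (tl q') (w # z # r)"
          using swap_sym[OF st] converse_rtranclp_into_rtranclp by metis
        ultimately show ?thesis by blast
      qed
    next
      case (swap_square a b c d s)
      have v: "c = v" using swaps_hd[OF step(1)] swap_square by simp
      note sq = swap_square(3)[unfolded v]
      show ?thesis using step.IH
      proof (elim disjE exE conjE)
        assume "path_swaps K p (tl q)"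
        then show ?thesis using swap_square sq by auto
      next
        fix u w z r assume h: "square K z u v w" "path_swaps K p (u # z # r)" "path_swaps K (tl q) (w # z # r)"
        then have bw: "b = w" and b: "path_swaps K (b # a # s) (b # z # r)"
          using swaps_hd[OF h(3)] swap_square by auto
        have len: "length (a # s) < length p"
          using swaps_length[OF step(1)] swap_square by simp
        \<comment> \<open>The paths \<open>b # a # s\<close> and \<open>b # z # r\<close> are
          equivalent and their tails are shorter than \<open>p\<close>, so the outer induction
          compares their last edges at \<open>b\<close>.\<close>
        from less.hyps[OF len b] show ?thesis
        proof (elim disjE exE conjE)
          assume as: "path_swaps K (a # s) (z # r)"
          then have "a = z" using swaps_hd by fastforce
          then have "u = d"
            using square_unique[of a b v d u] sq h(1) bw square_flip by metis
          then have "path_swaps K p (d # z # r)" using h(2) by simp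
          also have "path_swaps K (d # z # r) (d # a # s)" by (rule swaps_Cons) (rule swaps_sym[OF as])
          finally show ?thesis using swap_square by simp
        next
          fix a' z' y t
          assume y: "square K y a' b z'" "path_swaps K (a # s) (a' # y # t)" "path_swaps K (z # r) (z' # y # t)"
          then have [simp]: "a' = a" "z' = z" using swaps_hd by fastforce+
          have "square K b v d a" using square_rotate[OF sq] .
          moreover have "square K b v u z"
            using h(1) bw square_flip square_rotate by metis
          moreover have "square K b a y z"
            using y(1) square_flip square_rotate by (metis \<open>a' = a\<close> \<open>z' = z\<close>)
          \<comment> \<open>The three squares at \<open>b\<close> span a 3-cube. Its corner
            \<open>x\<close> opposite to \<open>b\<close> gives the square \<open>x\<close>,
            \<open>u\<close>, \<open>v\<close>, \<open>d\<close>, which replaces the two squares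
            sharing the edge from \<open>b\<close> to \<open>v\<close>.\<close>
          ultimately obtain x where x: "square K v d x u" "square K a d x y" "square K z y x u" "d \<noteq> u"
            using cube_completion[of b v d a y z u] square_flip square_rotate by metis
          have "square K x u v d" using x(1) square_flip square_rotate by metis
          moreover have "path_swaps K p (u # x # y # t)"
          proof -
            have "square K y z u x" using x(3) square_flip square_rotate by metis
            note h(2)
            also have "path_swaps K (u # z # r) (u # z # y # t)" using y(3) by (auto intro: swaps_Cons)
            also have "path_swaps K \<dots> (u # x # y # t)" using \<open>square K y z u x\<close> by (rule swaps_square)
            finally show ?thesis .
          qed
          moreover have "path_swaps K (tl q') (d # x # y # t)"
          proof -
            have "square K y a d x" using x(2) square_flip square_rotate by metis
            have "path_swaps K (tl q') (d # a # y # t)" using y(2) swap_square by (auto intro: swaps_Cons)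
            also have "path_swaps K \<dots> (d # x # y # t)" using \<open>square K y a d x\<close> by (rule swaps_square)
            finally show ?thesis .
          qed
          ultimately show ?thesis by blast
        qed
      qed
    qed
  qed simp
  from this[OF less.prems] show ?case by simp
qed

text \<open>In the square alternative of \<open>swaps_last_edge\<close> two opposite corners of the
  square would both be \<open>u\<close>.\<close>

lemma swaps_ConsD:
  assumes "path_swaps K (v # u # p) (v # u # q)"
  shows "path_swaps K (u # p) (u # q)"
  using swaps_last_edge[OF assms]
proof (elim disjE exE conjE)
  fix u' w z r assume "square K z u' v w" "path_swaps K (u # p) (u' # z # r)" "path_swaps K (u # q) (w # z # r)"
  then show ?thesis using swaps_hd square_distinct by (metis list.sel(1))
qed

lemma swaps_Cons_Cons:
  assumes "path_swaps K (v # u # p) (v # w # q)" "u \<noteq> w"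
  obtains z r where "square K z u v w" "path_swaps K (u # p) (u # z # r)" "path_swaps K (w # q) (w # z # r)"
proof -
  have "\<not> path_swaps K (u # p) (w # q)" using swaps_hd assms(2) by fastforce
  then obtain u' w' z r where h: "square K z u' v w'" "path_swaps K (u # p) (u' # z # r)" "path_swaps K (w # q) (w' # z # r)"
    using swaps_last_edge[OF assms(1)] by blast
  then have "u' = u" "w' = w" using swaps_hd by fastforce+
  then show thesis using that h by blast
qed

text \<open>A cancellation caused by the new step to \<open>u\<close> can be brought to the end of
  the path by swaps, so that some representative reaches \<open>v\<close> through \<open>u\<close>.
  In the covering this means that the edge from \<open>v\<close> to \<open>u\<close> lifts either by
  appending \<open>u\<close> or by removing the last vertex.\<close>

lemma not_reduced_Cons:
  assumes "reduced_path K (v # p)" "\<not> reduced_path K (u # v # p)"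
  shows "\<exists>q. path_swaps K (v # p) (v # u # q)"
  using assms
proof (induction "length p" arbitrary: v p u rule: less_induct)
  case less
  obtain q where q: "path_swaps K (u # v # p) (u # q)" "backtracks (u # q)"
    using less.prems(2) swaps_ConsE unfolding reduced_path_def by metis
  show ?case
  proof (cases "backtracks q")
    case True
    then obtain u' q' where q': "q = u' # q'" by (cases q) (auto simp: backtracks_def)
    have nq: "\<not> reduced_path K q" using True unfolding reduced_path_def by blast
    then have "u' \<noteq> v"
      using less.prems(1) q(1) swaps_ConsD reduced_swaps unfolding q' by metis
    then obtain z r where zr: "square K z v u u'" "path_swaps K (v # p) (v # z # r)" "path_swaps K q (u' # z # r)"
      using swaps_Cons_Cons q(1) unfolding q' by metis
    \<comment> \<open>The path \<open>u' # z # r\<close> is not reduced while the shorter path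
      \<open>z # r\<close> is, so by induction \<open>z # r\<close> can be made to arrive through
      \<open>u'\<close>. Swapping across the square then turns \<open>v # z # u'\<close> into
      \<open>v # u # u'\<close>.\<close>
    have "length r < length p" using swaps_length[OF zr(2)] by simp
    moreover have "reduced_path K (z # r)" using zr(2) less.prems(1) reduced_swaps reduced_ConsD by metis
    moreover have "\<not> reduced_path K (u' # z # r)" using nq zr(3) reduced_swaps swaps_sym by metis
    ultimately obtain s where "path_swaps K (z # r) (z # u' # s)" using less.hyps by blast
    then have "path_swaps K (v # p) (v # z # u' # s)" using zr(2) swaps_Cons rtranclp_trans by metis
    also have "path_swaps K \<dots> (v # u # u' # s)"
      by (rule swaps_square) (rule square_rotate[OF square_rotate[OF square_rotate[OF zr(1)]]])
    finally show ?thesis by blast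
  next
    case False
    then obtain u' s where q': "q = u' # u # s" using q(2) backtracks_Cons by metis
    show ?thesis
    proof (cases "u' = v")
      case True
      then show ?thesis using q(1) swaps_ConsD unfolding q' by blast
    next
      case False
      then obtain z r where zr: "square K z v u u'" "path_swaps K (v # p) (v # z # r)" "path_swaps K q (u' # z # r)"
        using swaps_Cons_Cons q(1) unfolding q' by metis
      have "u \<noteq> z" using square_distinct[OF zr(1)] by blast
      then obtain y t where yt: "square K y u u' z" "path_swaps K (z # r) (z # y # t)"
        using swaps_Cons_Cons zr(3) unfolding q' by metis
      \<comment> \<open>Both squares contain \<open>u\<close>, \<open>u'\<close>, \<open>z\<close>
        as consecutive corners, so they coincide. The reduced path would then end with the backtrack
        \<open>v\<close>, \<open>z\<close>, \<open>v\<close>.\<close>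
      have "y = v"
        using zr(1) yt(1) square_unique square_flip square_rotate by metis
      then have "path_swaps K (v # p) (v # z # v # t)" using zr(2) yt(2) swaps_Cons rtranclp_trans by metis
      then show ?thesis using less.prems(1) not_reduced_swaps_backtrack[of K "v # p" v z t] by simp
    qed
  qed
qed

end

section \<open>Coverings\<close>

text \<open>A combinatorial covering of the complex: \<open>E\<close> is the set of its vertices and \<open>R\<close> its adjacency.\<close>

locale covering = cube_cx K for K :: "'v set set" +
  fixes E :: "'s set" and pr :: "'s \<Rightarrow> 'v" and R :: "'s \<Rightarrow> 's \<Rightarrow> bool"
  assumes R_sym: "R s t \<Longrightarrow> R t s"
    and R_lift: "s \<in> E \<Longrightarrow> adjacent K (pr s) v \<Longrightarrow> \<exists>t\<in>E. pr t = v \<and> R s t"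
    and R_unique: "s \<in> E \<Longrightarrow> t \<in> E \<Longrightarrow> t' \<in> E \<Longrightarrow> R s t \<Longrightarrow> R s t' \<Longrightarrow> pr t = pr t' \<Longrightarrow> t = t'"
    and R_square: "s \<in> E \<Longrightarrow> t \<in> E \<Longrightarrow> t' \<in> E \<Longrightarrow> R s t \<Longrightarrow> R s t' \<Longrightarrow>
      square K (pr s) (pr t) c (pr t') \<Longrightarrow> \<exists>m\<in>E. pr m = c \<and> R t m \<and> R t' m"
begin

text \<open>A sheet of the covering over \<open>C\<close>; for \<open>C = \<Union>K\<close> it is a
  global section.\<close>

definition flat_section :: "'v set \<Rightarrow> ('v \<Rightarrow> 's) \<Rightarrow> bool" where
  "flat_section C \<tau> \<longleftrightarrow>
     (\<forall>v\<in>C. \<tau> v \<in> E \<and> pr (\<tau> v) = v) \<and> (\<forall>u\<in>C. \<forall>v\<in>C. adjacent K u v \<longrightarrow> R (\<tau> u) (\<tau> v))"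

lemma flat_section_subset: "flat_section C \<tau> \<Longrightarrow> D \<subseteq> C \<Longrightarrow> flat_section D \<tau>"
  unfolding flat_section_def by blast

text \<open>Induction on the dimension: a sheet over the face of the first \<open>m\<close>
  coordinates is pushed in direction \<open>m\<close> by lifting edges. The squares in direction
  \<open>m\<close>, together with uniqueness of lifts, make the pushed face flat.\<close>

lemma flat_section_exists:
  assumes "C \<in> K" "pr s \<in> C" "s \<in> E"
  obtains \<tau> where "flat_section C \<tau>" "\<tau> (pr s) = s"
proof -
  obtain n \<kappa> where ch: "cube_chart K C n \<kappa>" and k0: "\<kappa> {} = pr s" using chart_at assms by metis
  have "\<exists>\<sigma>. \<sigma> {} = s \<and> (\<forall>U. U \<subseteq> {..<m} \<longrightarrow> \<sigma> U \<in> E \<and> pr (\<sigma> U) = \<kappa> U) \<and>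
    (\<forall>U i. U \<subseteq> {..<m} \<longrightarrow> i < m \<longrightarrow> i \<notin> U \<longrightarrow> R (\<sigma> U) (\<sigma> (insert i U)))" if "m \<le> n" for m
    using that
  proof (induction m)
    case 0
    show ?case by (rule exI[of _ "\<lambda>_. s"]) (use assms k0 in auto)
  next
    case (Suc m)
    then obtain \<sigma> where \<sigma>: "\<sigma> {} = s" "\<And>U. U \<subseteq> {..<m} \<Longrightarrow> \<sigma> U \<in> E \<and> pr (\<sigma> U) = \<kappa> U"
      and \<sigma>R: "\<And>U i. U \<subseteq> {..<m} \<Longrightarrow> i < m \<Longrightarrow> i \<notin> U \<Longrightarrow> R (\<sigma> U) (\<sigma> (insert i U))"
      by auto
    have "\<exists>t. t \<in> E \<and> pr t = \<kappa> (insert m V) \<and> R (\<sigma> V) t" if V: "V \<subseteq> {..<m}" for V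
    proof -
      have "adjacent K (\<kappa> V) (\<kappa> (insert m V))"
        by (rule cube_chart_edge[OF ch]) (use V Suc.prems in auto)
      then show ?thesis using R_lift \<sigma>(2)[OF V] by metis
    qed
    then obtain up where up: "\<And>V. V \<subseteq> {..<m} \<Longrightarrow> up V \<in> E \<and> pr (up V) = \<kappa> (insert m V) \<and> R (\<sigma> V) (up V)"
      by metis
    define \<sigma>' where "\<sigma>' U = (if m \<in> U then up (U - {m}) else \<sigma> U)" for U
    have sub: "U - {m} \<subseteq> {..<m}" "m \<notin> U \<Longrightarrow> U \<subseteq> {..<m}" if "U \<subseteq> {..<Suc m}" for U
      using that by (auto simp: less_Suc_eq)
    show ?case
    proof (intro exI[of _ \<sigma>'] conjI allI impI)
      show "\<sigma>' {} = s" using \<sigma> by (simp add: \<sigma>'_def)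
    next
      fix U assume U: "U \<subseteq> {..<Suc m}"
      have "m \<in> U \<Longrightarrow> insert m (U - {m}) = U" by blast
      then show "\<sigma>' U \<in> E" "pr (\<sigma>' U) = \<kappa> U"
        using up[OF sub(1)[OF U]] \<sigma>(2)[OF sub(2)[OF U]] by (auto simp: \<sigma>'_def)
    next
      fix U i assume U: "U \<subseteq> {..<Suc m}" and i: "i < Suc m" "i \<notin> U"
      show "R (\<sigma>' U) (\<sigma>' (insert i U))"
      proof (cases "i = m")
        case True
        then show ?thesis using i up[OF sub(2)[OF U]] by (simp add: \<sigma>'_def)
      next
        case im: False
        then have "i < m" using i by simp
        show ?thesis
        proof (cases "m \<in> U")
          case False
          then show ?thesis using im \<sigma>R[OF sub(2)[OF U] \<open>i < m\<close> i(2)] by (simp add: \<sigma>'_def)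
        next
          case True
          let ?V = "U - {m}"
          have V: "?V \<subseteq> {..<m}" "insert i ?V \<subseteq> {..<m}" "i \<notin> ?V" "m \<notin> ?V"
            using sub[OF U] \<open>i < m\<close> i by auto
          have "square K (\<kappa> ?V) (\<kappa> (insert i ?V)) (\<kappa> (insert i (insert m ?V))) (\<kappa> (insert m ?V))"
            by (rule cube_chart_square[OF ch]) (use V im \<open>i < m\<close> Suc.prems in auto)
          then have "square K (pr (\<sigma> ?V)) (pr (\<sigma> (insert i ?V))) (\<kappa> (insert m (insert i ?V))) (pr (up ?V))"
            using \<sigma>(2)[OF V(1)] \<sigma>(2)[OF V(2)] up[OF V(1)] by (simp add: insert_commute)
          moreover have "R (\<sigma> ?V) (\<sigma> (insert i ?V))" using \<sigma>R V(1,3) \<open>i < m\<close> by blast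
          ultimately obtain t where t: "t \<in> E" "pr t = \<kappa> (insert m (insert i ?V))"
            "R (\<sigma> (insert i ?V)) t" "R (up ?V) t"
            using R_square \<sigma>(2)[OF V(1)] \<sigma>(2)[OF V(2)] up[OF V(1)] by metis
          have "t = up (insert i ?V)"
            by (rule R_unique[of "\<sigma> (insert i ?V)"]) (use t up[OF V(2)] \<sigma>(2)[OF V(2)] in auto)
          moreover have "insert i U - {m} = insert i ?V" using im by auto
          ultimately show ?thesis using t True by (simp add: \<sigma>'_def)
        qed
      qed
    qed
  qed
  from this[of n] obtain \<sigma> where \<sigma>: "\<sigma> {} = s" "\<And>U. U \<subseteq> {..<n} \<Longrightarrow> \<sigma> U \<in> E \<and> pr (\<sigma> U) = \<kappa> U"
    and \<sigma>R: "\<And>U i. U \<subseteq> {..<n} \<Longrightarrow> i < n \<Longrightarrow> i \<notin> U \<Longrightarrow> R (\<sigma> U) (\<sigma> (insert i U))" by auto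
  define \<tau> where "\<tau> v = \<sigma> (inv_into (Pow {..<n}) \<kappa> v)" for v
  have \<tau>: "\<tau> (\<kappa> U) = \<sigma> U" if "U \<subseteq> {..<n}" for U
    using inv_into_f_f[OF cube_chart_inj[OF ch]] that by (simp add: \<tau>_def)
  have "flat_section C \<tau>"
    unfolding flat_section_def
  proof (intro conjI ballI impI)
    fix v assume "v \<in> C"
    then obtain U where "U \<subseteq> {..<n}" "v = \<kappa> U" using cube_chart_image[OF ch] by auto
    then show "\<tau> v \<in> E" "pr (\<tau> v) = v" using \<tau> \<sigma>(2) by auto
  next
    fix u v assume uv: "u \<in> C" "v \<in> C" "adjacent K u v"
    then obtain U V where UV: "U \<subseteq> {..<n}" "u = \<kappa> U" "V \<subseteq> {..<n}" "v = \<kappa> V"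
      using cube_chart_image[OF ch] by auto
    then have "adjacent K (\<kappa> U) (\<kappa> V)" using uv by simp
    then show "R (\<tau> u) (\<tau> v)"
      by (rule cube_chart_adjacentE[OF ch UV(1,3)]) (use UV \<tau> \<sigma>R R_sym in auto)
  qed
  moreover have "\<tau> (pr s) = s" using \<tau>[of "{}"] k0 \<sigma>(1) by simp
  ultimately show thesis using that by blast
qed

lemma flat_section_unique:
  assumes "C \<in> K" "flat_section C \<tau>" "flat_section C \<tau>'" "u \<in> C" "\<tau> u = \<tau>' u" "v \<in> C"
  shows "\<tau> v = \<tau>' v"
proof -
  obtain n \<kappa> where ch: "cube_chart K C n \<kappa>" and k0: "\<kappa> {} = u" using chart_at assms by metis
  have "\<tau> (\<kappa> U) = \<tau>' (\<kappa> U)" if "finite U" "U \<subseteq> {..<n}" for U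
    using that
  proof (induction U rule: finite_induct)
    case empty
    then show ?case using assms k0 by simp
  next
    case (insert i U)
    have "adjacent K (\<kappa> U) (\<kappa> (insert i U))"
      by (rule cube_chart_edge[OF ch]) (use insert in auto)
    moreover have "\<kappa> U \<in> C" "\<kappa> (insert i U) \<in> C" using insert.prems cube_chart_image[OF ch] by auto
    moreover have "\<tau> (\<kappa> U) = \<tau>' (\<kappa> U)" using insert by simp
    ultimately show ?case
      using assms(2,3) R_unique[of "\<tau> (\<kappa> U)" "\<tau> (\<kappa> (insert i U))" "\<tau>' (\<kappa> (insert i U))"]
      unfolding flat_section_def by metis
  qed
  moreover obtain V where "V \<subseteq> {..<n}" "v = \<kappa> V" using \<open>v \<in> C\<close> cube_chart_image[OF ch] by auto
  ultimately show ?thesis using finite_subset finite_lessThan by metis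
qed

end

section \<open>The covering by swap classes of reduced paths\<close>

context flag_cube_cx
begin

definition path_class :: "'v list \<Rightarrow> 'v list set" where
  "path_class p = {q. path_swaps K p q}"

definition path_classes :: "'v \<Rightarrow> 'v list set set" where
  "path_classes x = {path_class p | p. edge_path K p \<and> reduced_path K p \<and> last p = x}"

definition class_end :: "'v list set \<Rightarrow> 'v" where
  "class_end \<alpha> = hd (SOME p. p \<in> \<alpha>)"

definition class_length :: "'v list set \<Rightarrow> nat" where
  "class_length \<alpha> = length (SOME p. p \<in> \<alpha>)"

definition extends :: "'v list set \<Rightarrow> 'v list set \<Rightarrow> bool" where
  "extends \<alpha> \<beta> \<longleftrightarrow> (\<exists>p u. \<alpha> = path_class p \<and> \<beta> = path_class (u # p))"

definition class_adjacent :: "'v list set \<Rightarrow> 'v list set \<Rightarrow> bool" where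
  "class_adjacent \<alpha> \<beta> \<longleftrightarrow> extends \<alpha> \<beta> \<or> extends \<beta> \<alpha>"

lemma path_class_eq_iff: "path_class p = path_class q \<longleftrightarrow> path_swaps K p q"
proof
  assume "path_class p = path_class q"
  moreover have "q \<in> path_class q" by (simp add: path_class_def)
  ultimately show "path_swaps K p q" unfolding path_class_def by blast
next
  assume "path_swaps K p q"
  then show "path_class p = path_class q"
    unfolding path_class_def by (auto dest: swaps_sym intro: rtranclp_trans)
qed

lemma class_end_path_class: "class_end (path_class p) = hd p"
proof -
  have "(SOME q. q \<in> path_class p) \<in> path_class p" by (rule someI[of _ p]) (simp add: path_class_def)
  then show ?thesis unfolding class_end_def path_class_def using swaps_hd by force
qed

lemma class_length_path_class: "class_length (path_class p) = length p"
proof -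
  have "(SOME q. q \<in> path_class p) \<in> path_class p" by (rule someI[of _ p]) (simp add: path_class_def)
  then show ?thesis unfolding class_length_def path_class_def using swaps_length by force
qed

lemma path_class_mem_iff:
  "path_class p \<in> path_classes x \<longleftrightarrow> edge_path K p \<and> reduced_path K p \<and> last p = x"
proof
  assume "path_class p \<in> path_classes x"
  then obtain q where "path_swaps K p q" "edge_path K q" "reduced_path K q" "last q = x"
    unfolding path_classes_def using path_class_eq_iff by auto
  then have "path_swaps K q p" "edge_path K q" "reduced_path K q" "last q = x"
    using swaps_sym by auto
  then show "edge_path K p \<and> reduced_path K p \<and> last p = x"
    using swaps_edge_path reduced_swaps swaps_last by metis
qed (auto simp: path_classes_def)

lemma extends_class_length: "extends \<alpha> \<beta> \<Longrightarrow> class_length \<beta> = Suc (class_length \<alpha>)"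
  unfolding extends_def using class_length_path_class by auto

lemma extends_unique_below:
  assumes "extends \<beta> \<alpha>" "extends \<beta>' \<alpha>" "\<alpha> \<in> path_classes x" "\<beta> \<in> path_classes x" "\<beta>' \<in> path_classes x"
    and "class_end \<beta> = class_end \<beta>'"
  shows "\<beta> = \<beta>'"
proof -
  obtain p u q w where pq: "\<beta> = path_class p" "\<alpha> = path_class (u # p)" "\<beta>' = path_class q" "\<alpha> = path_class (w # q)"
    using assms unfolding extends_def by blast
  then have sw: "path_swaps K (u # p) (w # q)" using path_class_eq_iff by metis
  have "edge_path K p" "edge_path K q" using assms pq path_class_mem_iff by metis+
  then obtain a p' b q' where "p = a # p'" "q = b # q'" by (metis edge_path_def neq_Nil_conv)
  moreover then have "a = b" using assms(6) pq class_end_path_class by simp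
  moreover have "u = w" using swaps_hd[OF sw] by simp
  ultimately show ?thesis using sw swaps_ConsD path_class_eq_iff pq by metis
qed

lemma extends_unique_above:
  assumes "extends \<alpha> \<beta>" "extends \<alpha> \<beta>'" "class_end \<beta> = class_end \<beta>'"
  shows "\<beta> = \<beta>'"
proof -
  obtain p u q w where pq: "\<alpha> = path_class p" "\<beta> = path_class (u # p)" "\<alpha> = path_class q" "\<beta>' = path_class (w # q)"
    using assms unfolding extends_def by blast
  then have "path_swaps K p q" "u = w" using path_class_eq_iff assms(3) class_end_path_class by (metis, simp)
  then show ?thesis using pq swaps_Cons path_class_eq_iff by metis
qed

text \<open>Otherwise \<open>\<beta>\<close> would have a representative ending with
  \<open>u\<close>, \<open>w\<close>, \<open>u\<close>, against reducedness.\<close>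

lemma extends_not_both:
  assumes "extends \<alpha> \<beta>" "extends \<beta>' \<alpha>" "\<beta> \<in> path_classes x" "\<beta>' \<in> path_classes x"
  shows "class_end \<beta> \<noteq> class_end \<beta>'"
proof
  assume eq: "class_end \<beta> = class_end \<beta>'"
  obtain p u q w where pq: "\<alpha> = path_class p" "\<beta> = path_class (u # p)" "\<beta>' = path_class q" "\<alpha> = path_class (w # q)"
    using assms unfolding extends_def by blast
  have "edge_path K q" using assms pq path_class_mem_iff by metis
  then obtain q' where q': "q = u # q'"
    using eq pq class_end_path_class by (metis edge_path_def list.sel(1) neq_Nil_conv)
  have "path_swaps K p (w # u # q')" using pq q' path_class_eq_iff by metis
  then have "path_swaps K (u # p) (u # w # u # q')" by (rule swaps_Cons)
  then show False using not_reduced_swaps_backtrack assms(3) pq path_class_mem_iff by metis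
qed

text \<open>The quadrangle condition inside the covering: representatives of \<open>\<alpha>\<close>
  with different last edges can be chosen so that they differ by a single swap at the end.\<close>

lemma extends_below_square:
  assumes "extends \<beta> \<alpha>" "extends \<beta>' \<alpha>" "\<alpha> \<in> path_classes x" "\<beta> \<in> path_classes x" "\<beta>' \<in> path_classes x"
    and "class_end \<beta> \<noteq> class_end \<beta>'"
  obtains \<gamma> where "\<gamma> \<in> path_classes x" "extends \<gamma> \<beta>" "extends \<gamma> \<beta>'"
    "square K (class_end \<gamma>) (class_end \<beta>) (class_end \<alpha>) (class_end \<beta>')"
proof -
  obtain p u q w where pq: "\<beta> = path_class p" "\<alpha> = path_class (u # p)" "\<beta>' = path_class q" "\<alpha> = path_class (w # q)"
    using assms unfolding extends_def by blast
  then have sw: "path_swaps K (u # p) (w # q)" using path_class_eq_iff by metis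
  have "edge_path K p" "edge_path K q" using assms pq path_class_mem_iff by metis+
  then obtain a p' b q' where ab: "p = a # p'" "q = b # q'" by (metis edge_path_def neq_Nil_conv)
  then have "a \<noteq> b" using assms(6) pq class_end_path_class by simp
  have "u = w" using swaps_hd[OF sw] by simp
  then obtain z r where zr: "square K z a u b" "path_swaps K (a # p') (a # z # r)" "path_swaps K (b # q') (b # z # r)"
    using swaps_Cons_Cons[OF _ \<open>a \<noteq> b\<close>, of u p' q'] sw ab by metis
  have eq: "\<beta> = path_class (a # z # r)" "\<beta>' = path_class (b # z # r)"
    using zr pq ab path_class_eq_iff by metis+
  have "edge_path K (a # z # r)" "reduced_path K (a # z # r)" "last (a # z # r) = x"
    using path_class_mem_iff assms(4) eq by metis+
  then have "path_class (z # r) \<in> path_classes x"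
    unfolding path_class_mem_iff using reduced_ConsD by (auto simp: edge_path_def)
  moreover have "extends (path_class (z # r)) \<beta>" "extends (path_class (z # r)) \<beta>'"
    unfolding extends_def eq by blast+
  ultimately show thesis using that[of "path_class (z # r)"] zr(1) eq pq class_end_path_class by simp
qed

text \<open>If some representative of \<open>\<alpha>\<close> arrives through \<open>u\<close>, the
  lift goes down by dropping its last vertex. Otherwise \<open>not_reduced_Cons\<close> makes the
  prolonged path reduced and the lift goes up.\<close>

lemma extend_class:
  assumes "\<alpha> \<in> path_classes x" "adjacent K (class_end \<alpha>) u"
  shows "\<exists>\<beta>\<in>path_classes x. class_end \<beta> = u \<and> class_adjacent \<alpha> \<beta>"
proof -
  obtain p where p: "\<alpha> = path_class p" "edge_path K p" "reduced_path K p" "last p = x"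
    using assms(1) unfolding path_classes_def by blast
  then obtain v p' where v: "p = v # p'" by (metis edge_path_def neq_Nil_conv)
  have adj: "adjacent K v u" using assms(2) p v class_end_path_class by simp
  show ?thesis
  proof (cases "\<exists>q. path_swaps K (v # p') (v # u # q)")
    case True
    then obtain q where q: "path_swaps K (v # p') (v # u # q)" by blast
    then have eq: "\<alpha> = path_class (v # u # q)" using p v path_class_eq_iff by metis
    then have "edge_path K (v # u # q)" "reduced_path K (v # u # q)" "last (v # u # q) = x"
      using path_class_mem_iff assms(1) by metis+
    then have "path_class (u # q) \<in> path_classes x"
      unfolding path_class_mem_iff using reduced_ConsD by (auto simp: edge_path_def)
    moreover have "class_adjacent \<alpha> (path_class (u # q))"
      unfolding class_adjacent_def extends_def eq by blast
    ultimately show ?thesis using class_end_path_class by (metis list.sel(1))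
  next
    case False
    then have "reduced_path K (u # p)" using not_reduced_Cons p(3) unfolding v by blast
    moreover have "edge_path K (u # p)" "last (u # p) = x"
      using p adj adjacent_vertices[OF adj] unfolding v by (auto simp: edge_path_def adjacent_sym)
    ultimately have "path_class (u # p) \<in> path_classes x" unfolding path_class_mem_iff by blast
    moreover have "class_adjacent \<alpha> (path_class (u # p))"
      unfolding class_adjacent_def extends_def p(1) by blast
    ultimately show ?thesis using class_end_path_class by (metis list.sel(1))
  qed
qed

text \<open>The square is itself a swap of the last two edges of a representative of
  \<open>\<beta>'\<close>; it replaces the intermediate class \<open>\<alpha>\<close> by
  \<open>\<gamma>\<close>.\<close>

lemma extends_square_mixed:
  assumes "extends \<beta> \<alpha>" "extends \<alpha> \<beta>'" "\<alpha> \<in> path_classes x" "\<beta> \<in> path_classes x" "\<beta>' \<in> path_classes x"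
    and "square K (class_end \<alpha>) (class_end \<beta>) c (class_end \<beta>')"
  shows "\<exists>\<gamma>\<in>path_classes x. class_end \<gamma> = c \<and> extends \<beta> \<gamma> \<and> extends \<gamma> \<beta>'"
proof -
  obtain p u q w where pq: "\<beta> = path_class p" "\<alpha> = path_class (u # p)" "\<alpha> = path_class q" "\<beta>' = path_class (w # q)"
    using assms unfolding extends_def by blast
  have "edge_path K p" using assms pq path_class_mem_iff by metis
  then obtain b r where b: "p = b # r" by (metis edge_path_def neq_Nil_conv)
  have "path_swaps K q (u # p)" using pq path_class_eq_iff by metis
  then have "path_swaps K (w # q) (w # u # b # r)" unfolding b by (rule swaps_Cons)
  moreover have "square K u b c w" using assms(6) pq class_end_path_class b by simp
  then have "square K b u w c" using square_flip square_rotate by metis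
  then have "path_swaps K (w # u # b # r) (w # c # b # r)" by (rule swaps_square)
  ultimately have "path_swaps K (w # q) (w # c # b # r)" by (rule rtranclp_trans)
  then have eq: "\<beta>' = path_class (w # c # p)" using pq b path_class_eq_iff by metis
  then have "edge_path K (w # c # p)" "reduced_path K (w # c # p)" "last (w # c # p) = x"
    using path_class_mem_iff assms(5) by metis+
  then have "path_class (c # p) \<in> path_classes x"
    unfolding path_class_mem_iff using reduced_ConsD by (auto simp: edge_path_def)
  moreover have "extends \<beta> (path_class (c # p))" "extends (path_class (c # p)) \<beta>'"
    unfolding extends_def using pq(1) eq by blast+
  ultimately show ?thesis using class_end_path_class by (metis list.sel(1))
qed

text \<open>Each edge at a class goes up (prolongs it) or down. For the square condition, two edges
  going down are the quadrangle condition, one of each kind is a single swap, and two edges going up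
  are the remaining work.\<close>

lemma covering_path_classes: "covering K (path_classes x) class_end class_adjacent"
proof
  show "class_adjacent s t \<Longrightarrow> class_adjacent t s" for s t unfolding class_adjacent_def by blast
  show "s \<in> path_classes x \<Longrightarrow> adjacent K (class_end s) v \<Longrightarrow>
    \<exists>t\<in>path_classes x. class_end t = v \<and> class_adjacent s t" for s v
    by (rule extend_class)
next
  fix s t t' assume "s \<in> path_classes x" "t \<in> path_classes x" "t' \<in> path_classes x"
    "class_adjacent s t" "class_adjacent s t'" "class_end t = class_end t'"
  then show "t = t'"
    unfolding class_adjacent_def
    using extends_unique_below extends_unique_above extends_not_both by metis
next
  fix s t t' c
  assume mem: "s \<in> path_classes x" "t \<in> path_classes x" "t' \<in> path_classes x"
    and adj: "class_adjacent s t" "class_adjacent s t'"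
    and sq: "square K (class_end s) (class_end t) c (class_end t')"
  have ne: "class_end t \<noteq> class_end t'" using square_distinct[OF sq] by blast
  consider "extends s t" "extends s t'" | "extends t s" "extends t' s"
    | "extends t s" "extends s t'" | "extends s t" "extends t' s"
    using adj unfolding class_adjacent_def by blast
  then show "\<exists>m\<in>path_classes x. class_end m = c \<and> class_adjacent t m \<and> class_adjacent t' m"
  proof cases
    case 1
    have "adjacent K (class_end t) c" using sq by (simp add: square_def)
    then obtain m where m: "m \<in> path_classes x" "class_end m = c" "class_adjacent t m"
      using extend_class[OF mem(2)] by blast
    \<comment> \<open>If \<open>m\<close> were below \<open>t\<close>, the quadrangle at
      \<open>t\<close> would give a class \<open>g\<close> below \<open>s\<close>. By uniqueness of
      squares \<open>g\<close> ends where \<open>t'\<close> does, although \<open>t'\<close> lies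
      above \<open>s\<close>.\<close>
    have "\<not> extends m t"
    proof
      assume "extends m t"
      moreover have "class_end m \<noteq> class_end s" using square_distinct[OF sq] m(2) by metis
      ultimately obtain g where g: "g \<in> path_classes x" "extends g s"
        "square K (class_end g) (class_end m) (class_end t) (class_end s)"
        using extends_below_square[OF _ 1(1) mem(2) m(1) mem(1)] by metis
      have "square K (class_end m) (class_end t) (class_end s) (class_end g)"
        using g(3) by (rule square_rotate)
      moreover have "square K (class_end m) (class_end t) (class_end s) (class_end t')"
        using sq m(2) square_flip square_rotate by metis
      ultimately have "class_end g = class_end t'" using square_unique by blast
      then show False using extends_not_both[OF 1(2) g(2) mem(3) g(1)] by simp
    qed
    then have tm: "extends t m" using m(3) unfolding class_adjacent_def by blast
    have "square K (class_end t) (class_end s) (class_end t') (class_end m)"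
      using sq m(2) square_flip square_rotate by metis
    obtain p u q w where pq: "s = path_class p" "t = path_class (u # p)" "s = path_class q" "t' = path_class (w # q)"
      using 1 unfolding extends_def by blast
    obtain p1 u1 where p1: "t = path_class p1" "m = path_class (u1 # p1)" using tm unfolding extends_def by blast
    have u1: "u1 = c" using p1 m(2) class_end_path_class by simp
    have "edge_path K p" using mem pq path_class_mem_iff by metis
    then obtain a r where a: "p = a # r" by (metis edge_path_def neq_Nil_conv)
    have "path_swaps K (w # p) (w # q)" using pq path_class_eq_iff swaps_Cons by metis
    then have t': "t' = path_class (w # p)" using pq path_class_eq_iff by metis
    have "path_swaps K p1 (u # p)" using pq p1 path_class_eq_iff by metis
    then have "path_swaps K (c # p1) (c # u # p)" by (rule swaps_Cons)
    also have "path_swaps K \<dots> (c # w # p)"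
      unfolding a using sq pq t' a class_end_path_class by (intro swaps_square) simp
    finally have "m = path_class (c # w # p)" using path_class_eq_iff p1 u1 by metis
    then have "extends t' m" unfolding extends_def t' by blast
    then show ?thesis using m unfolding class_adjacent_def by blast
  next
    case 2
    then obtain g where g: "g \<in> path_classes x" "extends g t" "extends g t'"
      "square K (class_end g) (class_end t) (class_end s) (class_end t')"
      using extends_below_square mem ne by metis
    have "square K (class_end t) (class_end s) (class_end t') (class_end g)"
      using g(4) by (rule square_rotate)
    moreover have "square K (class_end t) (class_end s) (class_end t') c"
      using sq square_flip square_rotate by metis
    ultimately have "class_end g = c" using square_unique by blast
    then show ?thesis using g unfolding class_adjacent_def by blast
  next
    case 3
    then show ?thesis using extends_square_mixed mem sq unfolding class_adjacent_def by blast
  next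
    case 4
    then show ?thesis using extends_square_mixed[OF 4(2,1) mem(1,3,2) square_flip[OF sq]]
      unfolding class_adjacent_def by blast
  qed
qed

end

section \<open>Lifts of continuous maps\<close>

definition supp :: "('v \<Rightarrow> real) \<Rightarrow> 'v set" where
  "supp w = {v. w v \<noteq> 0}"

definition vertex_point :: "'v \<Rightarrow> 'v \<Rightarrow> real" where
  "vertex_point v = (\<lambda>u. if u = v then 1 else 0)"

definition edge_point :: "'v \<Rightarrow> 'v \<Rightarrow> real \<Rightarrow> 'v \<Rightarrow> real" where
  "edge_point u v t = (\<lambda>x. if x = u then 1 - t else if x = v then t else 0)"

lemma supp_vertex_point: "supp (vertex_point v) = {v}"
  by (auto simp: supp_def vertex_point_def)

lemma supp_edge_point: "supp (edge_point u v t) \<subseteq> {u, v}"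
  by (auto simp: supp_def edge_point_def)

lemma edge_point_0: "edge_point u v 0 = vertex_point u"
  by (auto simp: edge_point_def vertex_point_def)

lemma edge_point_1: "u \<noteq> v \<Longrightarrow> edge_point u v 1 = vertex_point v"
  by (auto simp: edge_point_def vertex_point_def)

lemma path_edge_point: "path (edge_point u v)"
proof -
  have "continuous_on {0..1} (\<lambda>t. edge_point u v t x)" for x
    by (cases "x = u"; cases "x = v") (auto simp: edge_point_def intro!: continuous_intros)
  then show ?thesis unfolding path_def by (rule continuous_on_coordinatewise_then_product)
qed

text \<open>A factor of the product vanishes exactly if \<open>U\<close> misses a coordinate equal
  to 1 or contains one equal to 0. So the support is the face whose relative interior contains the
  point, and it names the smallest cube around the point without reference to a chart.\<close>

lemma supp_cube_point:
  assumes ch: "cube_chart K C n \<kappa>"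
  shows "supp (cube_point C n \<kappa> p) = \<kappa> ` {U. {i. i < n \<and> p i = 1} \<subseteq> U \<and> U \<subseteq> {i. i < n \<and> p i \<noteq> 0}}"
    (is "?l = \<kappa> ` ?I")
proof -
  have *: "\<kappa> U \<in> ?l \<longleftrightarrow> U \<in> ?I" if "U \<subseteq> {..<n}" for U
  proof -
    have "\<kappa> U \<in> C" using cube_chart_image[OF ch] that by blast
    moreover have "inv_into (Pow {..<n}) \<kappa> (\<kappa> U) = U"
      using inv_into_f_f[OF cube_chart_inj[OF ch]] that by simp
    ultimately have "cube_point C n \<kappa> p (\<kappa> U) = (\<Prod>i<n. if i \<in> U then p i else 1 - p i)"
      by (simp add: cube_point_def)
    then have "\<kappa> U \<in> ?l \<longleftrightarrow> (\<forall>i\<in>{..<n}. (if i \<in> U then p i else 1 - p i) \<noteq> 0)"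
      unfolding supp_def mem_Collect_eq by (simp only: prod_zero_iff[OF finite_lessThan] bex_simps not_False_eq_True ball_simps)
    then show ?thesis using that by (auto split: if_splits)
  qed
  have "?l \<subseteq> C" by (auto simp: supp_def cube_point_def split: if_splits)
  then have sub: "?l \<subseteq> \<kappa> ` Pow {..<n}" using cube_chart_image[OF ch] by simp
  show ?thesis
  proof (intro equalityI subsetI)
    fix v assume v: "v \<in> ?l"
    then obtain U where "U \<subseteq> {..<n}" "v = \<kappa> U" using sub by auto
    then show "v \<in> \<kappa> ` ?I" using * v by simp
  next
    fix v assume "v \<in> \<kappa> ` ?I"
    then obtain U where U: "U \<in> ?I" "v = \<kappa> U" by blast
    then have "U \<subseteq> {..<n}" by auto
    then show "v \<in> ?l" using * U by simp
  qed
qed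

context cube_cx
begin

lemma cube_nonempty: "C \<in> K \<Longrightarrow> C \<noteq> {}"
  using card_cube by fastforce

lemma supp_cube:
  assumes "w \<in> realization K" shows "supp w \<in> K"
proof -
  obtain C n \<kappa> p where ch: "cube_chart K C n \<kappa>" and w: "w = cube_point C n \<kappa> p"
    using assms by (auto simp: realization_def cell_def)
  show ?thesis unfolding w supp_cube_point[OF ch] by (rule cube_chart_face[OF ch]) auto
qed

lemma vertex_point_cell:
  assumes "C \<in> K" "v \<in> C" shows "vertex_point v \<in> cell K C"
proof -
  obtain n \<kappa> where ch: "cube_chart K C n \<kappa>" and k0: "\<kappa> {} = v" using chart_at assms by metis
  have "cube_point C n \<kappa> (\<lambda>_. 0) u = vertex_point v u" for u
  proof (cases "u \<in> C")
    case True
    then obtain U where U: "U \<subseteq> {..<n}" "u = \<kappa> U" using cube_chart_image[OF ch] by auto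
    have inv: "inv_into (Pow {..<n}) \<kappa> u = U"
      using inv_into_f_f[OF cube_chart_inj[OF ch]] U by simp
    have "u = v \<longleftrightarrow> U = {}" using cube_chart_eq_iff[OF ch U(1), of "{}"] U k0 by auto
    moreover have "(\<Prod>i<n. if i \<in> U then 0 else 1 - 0) = (0::real)" if "U \<noteq> {}"
      using that U by (auto intro!: prod_zero)
    ultimately show ?thesis using True inv by (auto simp: cube_point_def vertex_point_def)
  next
    case False
    then show ?thesis using assms by (auto simp: cube_point_def vertex_point_def)
  qed
  then have "vertex_point v = cube_point C n \<kappa> (\<lambda>_. 0)" by auto
  then show ?thesis unfolding cell_def using ch by force
qed

lemma vertex_point_realization: "v \<in> \<Union>K \<Longrightarrow> vertex_point v \<in> realization K"
  using vertex_point_cell by (auto simp: realization_def)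

lemma edge_point_realization:
  assumes adj: "adjacent K u v" and t: "t \<in> {0..1}"
  shows "edge_point u v t \<in> realization K"
proof -
  have C: "{u, v} \<in> K" "u \<noteq> v" using adj by (auto simp: adjacent_def)
  obtain n \<kappa> where ch: "cube_chart K {u, v} n \<kappa>" and k0: "\<kappa> {} = u" using chart_at[OF C(1), of u] by (metis insertI1)
  have "(2::nat) ^ n = 2 ^ 1" using cube_chart_card[OF ch] C(2) by simp
  then have n: "n = 1" by (metis one_less_numeral_iff power_inject_exp semiring_norm(76))
  obtain U where U: "U \<subseteq> {..<n}" "v = \<kappa> U" using cube_chart_image[OF ch] by auto
  then have "U \<noteq> {}" using C(2) k0 by auto
  then have "U = {0}" using U(1) by (auto simp: n lessThan_Suc)
  note inv = inv_into_f_f[OF cube_chart_inj[OF ch]]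
  have "inv_into (Pow {..<n}) \<kappa> u = {}" using inv[of "{}"] k0 by simp
  moreover have "inv_into (Pow {..<n}) \<kappa> v = {0}" using inv[of U] U \<open>U = {0}\<close> by simp
  ultimately have "edge_point u v t = cube_point {u,v} n \<kappa> (\<lambda>_. t)"
    unfolding edge_point_def cube_point_def n using C(2) by (auto simp: fun_eq_iff)
  then have "edge_point u v t \<in> cell K {u,v}" unfolding cell_def using ch t by force
  then show ?thesis using C(1) by (auto simp: realization_def)
qed

text \<open>The finitely many nonzero weights of \<open>h q\<close> stay nonzero near
  \<open>q\<close>. Supports can grow, as they do near a vertex, but not shrink; this semicontinuity
  is what lifting draws from the topology of the realization.\<close>

lemma supp_locally_increasing:
  fixes h :: "'b::topological_space \<Rightarrow> 'v \<Rightarrow> real"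
  assumes "continuous_on A h" "h ` A \<subseteq> realization K" "q \<in> A"
  obtains N where "open N" "q \<in> N" "\<And>q'. q' \<in> N \<inter> A \<Longrightarrow> supp (h q) \<subseteq> supp (h q')"
proof -
  have fin: "finite (supp (h q))" using supp_cube finite_cube assms by blast
  have "\<exists>N. open N \<and> q \<in> N \<and> (\<forall>q'\<in>A. q' \<in> N \<longrightarrow> h q' v \<in> - {0})" if "v \<in> supp (h q)" for v
  proof -
    have "continuous_on A (\<lambda>q. h q v)" using assms(1) by (rule continuous_on_product_then_coordinatewise)
    moreover have "open (- {0::real})" "h q v \<in> - {0}" using that by (auto simp: supp_def)
    ultimately show ?thesis using assms(3) unfolding continuous_on_topological by blast
  qed
  then obtain N where N: "\<And>v. v \<in> supp (h q) \<Longrightarrow> open (N v) \<and> q \<in> N v \<and> (\<forall>q'\<in>A. q' \<in> N v \<longrightarrow> h q' v \<in> - {0})"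
    by metis
  show thesis
  proof (rule that[of "\<Inter>v\<in>supp (h q). N v"])
    show "open (\<Inter>v\<in>supp (h q). N v)" using fin N by (intro open_INT) auto
    show "q \<in> (\<Inter>v\<in>supp (h q). N v)" using N by auto
    show "supp (h q) \<subseteq> supp (h q')" if "q' \<in> (\<Inter>v\<in>supp (h q). N v) \<inter> A" for q'
      using N that by (fastforce simp: supp_def)
  qed
qed

end

context covering
begin

text \<open>
  A point of the covering over \<open>h q\<close> is represented by a flat section over the support of \<open>h q\<close>,
  which is a cube, so that no topology on the covering is needed.
\<close>

definition lift_on :: "'b::topological_space set \<Rightarrow> ('b \<Rightarrow> 'v \<Rightarrow> real) \<Rightarrow> ('b \<Rightarrow> 'v \<Rightarrow> 's) \<Rightarrow> bool" where
  "lift_on A h \<Sigma> \<longleftrightarrow> (\<forall>q\<in>A. flat_section (supp (h q)) (\<Sigma> q)) \<and>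
     (\<forall>q\<in>A. \<exists>N. open N \<and> q \<in> N \<and> (\<forall>q'\<in>N \<inter> A. \<forall>v\<in>supp (h q) \<inter> supp (h q'). \<Sigma> q' v = \<Sigma> q v))"

text \<open>Lifts through every prescribed point of the covering are required, because gluing has to
  start the second lift at a value of the first.\<close>

definition liftable_on :: "'b::topological_space set \<Rightarrow> ('b \<Rightarrow> 'v \<Rightarrow> real) \<Rightarrow> bool" where
  "liftable_on A h \<longleftrightarrow> (\<forall>q\<in>A. \<forall>s\<in>E. pr s \<in> supp (h q) \<longrightarrow> (\<exists>\<Sigma>. lift_on A h \<Sigma> \<and> \<Sigma> q (pr s) = s))"

lemma lift_onD: "lift_on A h \<Sigma> \<Longrightarrow> q \<in> A \<Longrightarrow> flat_section (supp (h q)) (\<Sigma> q)"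
  by (simp add: lift_on_def)

lemma lift_on_nhd:
  assumes "lift_on A h \<Sigma>" "q \<in> A"
  obtains N where "open N" "q \<in> N"
    "\<And>q' v. q' \<in> N \<Longrightarrow> q' \<in> A \<Longrightarrow> v \<in> supp (h q) \<Longrightarrow> v \<in> supp (h q') \<Longrightarrow> \<Sigma> q' v = \<Sigma> q v"
  using assms unfolding lift_on_def by (metis IntI)

lemma lift_on_cong:
  assumes "lift_on A h \<Sigma>" "\<And>q. q \<in> A \<Longrightarrow> h q = h' q"
  shows "lift_on A h' \<Sigma>"
  using assms unfolding lift_on_def by (metis IntD2)

lemma lift_on_compose:
  fixes f :: "'b::topological_space \<Rightarrow> 'c::topological_space"
  assumes l: "lift_on A h \<Sigma>" and f: "continuous_on B f" "f ` B \<subseteq> A"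
  shows "lift_on B (\<lambda>x. h (f x)) (\<lambda>x. \<Sigma> (f x))"
  unfolding lift_on_def
proof (intro conjI ballI)
  fix q assume "q \<in> B"
  then have fq: "f q \<in> A" using f by blast
  show "flat_section (supp (h (f q))) (\<Sigma> (f q))" using lift_onD[OF l fq] .
  obtain N where N: "open N" "f q \<in> N"
    "\<And>q' v. q' \<in> N \<Longrightarrow> q' \<in> A \<Longrightarrow> v \<in> supp (h (f q)) \<Longrightarrow> v \<in> supp (h q') \<Longrightarrow> \<Sigma> q' v = \<Sigma> (f q) v"
    using lift_on_nhd[OF l fq] by metis
  obtain M where "open M" "q \<in> M" "\<forall>y\<in>B. y \<in> M \<longrightarrow> f y \<in> N"
    using f(1) \<open>q \<in> B\<close> N(1,2) unfolding continuous_on_topological by metis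
  then show "\<exists>M. open M \<and> q \<in> M \<and> (\<forall>q'\<in>M \<inter> B. \<forall>v\<in>supp (h (f q)) \<inter> supp (h (f q')). \<Sigma> (f q') v = \<Sigma> (f q) v)"
    using N(3) f(2) by (intro exI[of _ M]) (simp add: image_subset_iff)
qed

text \<open>Agreement at one vertex of a support spreads over the whole support, since a flat
  section over a cube is determined by one value. A vertex \<open>v\<close> of
  \<open>supp (h a)\<close> stays in the supports near \<open>a\<close>, and both lifts are constant
  at \<open>v\<close> there. So agreement is locally constant on the connected set
  \<open>A\<close>.\<close>

lemma lift_on_unique:
  fixes h :: "'b::topological_space \<Rightarrow> 'v \<Rightarrow> real"
  assumes conn: "connected A" and h: "continuous_on A h" "h ` A \<subseteq> realization K"
    and l: "lift_on A h \<Sigma>" "lift_on A h \<Sigma>'"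
    and start: "p \<in> A" "u \<in> supp (h p)" "\<Sigma> p u = \<Sigma>' p u"
    and q: "q \<in> A" "v \<in> supp (h q)"
  shows "\<Sigma> q v = \<Sigma>' q v"
proof -
  have cube: "supp (h x) \<in> K" if "x \<in> A" for x using supp_cube h(2) that by blast
  let ?P = "\<lambda>x. \<forall>v\<in>supp (h x). \<Sigma> x v = \<Sigma>' x v"
  have agree: "?P x" if "x \<in> A" "v \<in> supp (h x)" "\<Sigma> x v = \<Sigma>' x v" for x v
    using flat_section_unique[OF cube lift_onD[OF l(1)] lift_onD[OF l(2)]] that by blast
  have "?P q"
  proof (rule connected_induction_simple[OF conn start(1) q(1), of ?P])
    show "?P p" using agree start by blast
  next
    fix a assume a: "a \<in> A"
    obtain N1 where N1: "open N1" "a \<in> N1" "\<And>q'. q' \<in> N1 \<inter> A \<Longrightarrow> supp (h a) \<subseteq> supp (h q')"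
      using supp_locally_increasing[OF h a] by metis
    obtain N2 where N2: "open N2" "a \<in> N2"
      "\<And>q' v. q' \<in> N2 \<Longrightarrow> q' \<in> A \<Longrightarrow> v \<in> supp (h a) \<Longrightarrow> v \<in> supp (h q') \<Longrightarrow> \<Sigma> q' v = \<Sigma> a v"
      using lift_on_nhd[OF l(1) a] by metis
    obtain N3 where N3: "open N3" "a \<in> N3"
      "\<And>q' v. q' \<in> N3 \<Longrightarrow> q' \<in> A \<Longrightarrow> v \<in> supp (h a) \<Longrightarrow> v \<in> supp (h q') \<Longrightarrow> \<Sigma>' q' v = \<Sigma>' a v"
      using lift_on_nhd[OF l(2) a] by metis
    obtain v where v: "v \<in> supp (h a)" using cube[OF a] cube_nonempty by blast
    let ?T = "A \<inter> (N1 \<inter> N2 \<inter> N3)"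
    have "?P y" if "x \<in> ?T" "y \<in> ?T" "?P x" for x y
    proof -
      have vx: "v \<in> supp (h x)" "v \<in> supp (h y)" using that v N1(3) by blast+
      have "\<Sigma> a v = \<Sigma>' a v" using N2(3)[of x v] N3(3)[of x v] that v vx by auto
      then have "\<Sigma> y v = \<Sigma>' y v" using N2(3)[of y v] N3(3)[of y v] that v vx by auto
      then show ?thesis using agree that vx by blast
    qed
    moreover have "openin (top_of_set A) ?T"
      using N1(1) N2(1) N3(1) by (intro openin_open_Int open_Int)
    ultimately show "\<exists>T. openin (top_of_set A) T \<and> a \<in> T \<and> (\<forall>x\<in>T. \<forall>y\<in>T. ?P x \<longrightarrow> ?P y)"
      using a N1(2) N2(2) N3(2) by (intro exI[of _ ?T]) blast
  qed
  then show ?thesis using q(2) by blast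
qed

text \<open>On the connected overlap the two lifts agree as soon as they agree at one point.
  Closedness gives the local condition for the glued lift: a point outside \<open>A\<close> has a
  neighbourhood avoiding \<open>A\<close>, and likewise for \<open>B\<close>.\<close>

lemma liftable_on_Un:
  fixes h :: "'b::topological_space \<Rightarrow> 'v \<Rightarrow> real"
  assumes h: "continuous_on (A \<union> B) h" "h ` (A \<union> B) \<subseteq> realization K"
    and cl: "closed A" "closed B" and AB: "connected (A \<inter> B)" "A \<inter> B \<noteq> {}"
    and lA: "liftable_on A h" and lB: "liftable_on B h"
  shows "liftable_on (A \<union> B) h"
proof -
  have half: "\<exists>\<Sigma>. lift_on (A \<union> B) h \<Sigma> \<and> \<Sigma> q (pr s) = s"
    if h: "continuous_on (A \<union> B) h" "h ` (A \<union> B) \<subseteq> realization K"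
      and cl: "closed A" "closed B" and AB: "connected (A \<inter> B)" "A \<inter> B \<noteq> {}"
      and lA: "liftable_on A h" and lB: "liftable_on B h"
      and q: "q \<in> A" "s \<in> E" "pr s \<in> supp (h q)" for A B q s
  proof -
    obtain \<Sigma> where S: "lift_on A h \<Sigma>" "\<Sigma> q (pr s) = s" using lA q unfolding liftable_on_def by blast
    obtain r where r: "r \<in> A" "r \<in> B" using AB by blast
    then have "supp (h r) \<in> K" using supp_cube h(2) by blast
    then obtain v where v: "v \<in> supp (h r)" using cube_nonempty by blast
    have "\<Sigma> r v \<in> E" "pr (\<Sigma> r v) = v" using lift_onD[OF S(1) r(1)] v unfolding flat_section_def by auto
    then obtain \<Sigma>' where S': "lift_on B h \<Sigma>'" "\<Sigma>' r v = \<Sigma> r v"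
      using lB r v unfolding liftable_on_def by metis
    have restr: "lift_on (A \<inter> B) h \<Sigma>" "lift_on (A \<inter> B) h \<Sigma>'"
      using lift_on_compose[OF S(1), of "A \<inter> B" "\<lambda>x. x"] lift_on_compose[OF S'(1), of "A \<inter> B" "\<lambda>x. x"] by auto
    have "continuous_on (A \<inter> B) h" "h ` (A \<inter> B) \<subseteq> realization K"
      using h continuous_on_subset by (blast, blast)
    then have agree: "\<Sigma> x w = \<Sigma>' x w" if "x \<in> A" "x \<in> B" "w \<in> supp (h x)" for x w
      using lift_on_unique[OF AB(1) _ _ restr, of r v x w] r v S'(2) that by simp
    define \<Psi> where "\<Psi> x = (if x \<in> A then \<Sigma> x else \<Sigma>' x)" for x
    have PA: "\<Psi> x w = \<Sigma> x w" if "x \<in> A" for x w using that by (simp add: \<Psi>_def)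
    have PB: "\<Psi> x w = \<Sigma>' x w" if "x \<in> B" "w \<in> supp (h x)" for x w
      using that agree by (simp add: \<Psi>_def)
    have "lift_on (A \<union> B) h \<Psi>"
      unfolding lift_on_def
    proof (intro conjI ballI)
      fix x assume "x \<in> A \<union> B"
      then show "flat_section (supp (h x)) (\<Psi> x)"
        using lift_onD[OF S(1)] lift_onD[OF S'(1)] by (auto simp: \<Psi>_def)
    next
      fix x assume x: "x \<in> A \<union> B"
      have "\<exists>N. open N \<and> x \<in> N \<and> (\<forall>q'\<in>N \<inter> A. \<forall>v\<in>supp (h x) \<inter> supp (h q'). \<Psi> q' v = \<Psi> x v)"
      proof (cases "x \<in> A")
        case True
        then obtain N where N: "open N" "x \<in> N"
          "\<And>q' v. q' \<in> N \<Longrightarrow> q' \<in> A \<Longrightarrow> v \<in> supp (h x) \<Longrightarrow> v \<in> supp (h q') \<Longrightarrow> \<Sigma> q' v = \<Sigma> x v"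
          using lift_on_nhd[OF S(1)] by metis
        have "\<Psi> q' v = \<Psi> x v" if "q' \<in> N \<inter> A" "v \<in> supp (h x) \<inter> supp (h q')" for q' v
          using that N(3)[of q' v] PA[of q' v] PA[of x v] True by simp
        then show ?thesis using N(1,2) by blast
      next
        case False
        then show ?thesis using cl(1) by (intro exI[of _ "- A"]) auto
      qed
      then obtain N1 where N1: "open N1" "x \<in> N1" "\<forall>q'\<in>N1 \<inter> A. \<forall>v\<in>supp (h x) \<inter> supp (h q'). \<Psi> q' v = \<Psi> x v"
        by blast
      have "\<exists>N. open N \<and> x \<in> N \<and> (\<forall>q'\<in>N \<inter> B. \<forall>v\<in>supp (h x) \<inter> supp (h q'). \<Psi> q' v = \<Psi> x v)"
      proof (cases "x \<in> B")
        case True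
        then obtain N where N: "open N" "x \<in> N"
          "\<And>q' v. q' \<in> N \<Longrightarrow> q' \<in> B \<Longrightarrow> v \<in> supp (h x) \<Longrightarrow> v \<in> supp (h q') \<Longrightarrow> \<Sigma>' q' v = \<Sigma>' x v"
          using lift_on_nhd[OF S'(1)] by metis
        have "\<Psi> q' v = \<Psi> x v" if "q' \<in> N \<inter> B" "v \<in> supp (h x) \<inter> supp (h q')" for q' v
          using that N(3)[of q' v] PB[of q' v] PB[of x v] True by simp
        then show ?thesis using N(1,2) by blast
      next
        case False
        then show ?thesis using cl(2) by (intro exI[of _ "- B"]) auto
      qed
      then obtain N2 where N2: "open N2" "x \<in> N2" "\<forall>q'\<in>N2 \<inter> B. \<forall>v\<in>supp (h x) \<inter> supp (h q'). \<Psi> q' v = \<Psi> x v"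
        by blast
      show "\<exists>N. open N \<and> x \<in> N \<and> (\<forall>q'\<in>N \<inter> (A \<union> B). \<forall>v\<in>supp (h x) \<inter> supp (h q'). \<Psi> q' v = \<Psi> x v)"
        using N1 N2 by (intro exI[of _ "N1 \<inter> N2"]) auto
    qed
    moreover have "\<Psi> q (pr s) = s" using PA q S(2) by simp
    ultimately show ?thesis by blast
  qed
  have "\<exists>\<Sigma>. lift_on (A \<union> B) h \<Sigma> \<and> \<Sigma> q (pr s) = s" if "q \<in> B" "s \<in> E" "pr s \<in> supp (h q)" for q s
    using half[of B A q s] h cl AB lA lB that by (simp add: Un_commute Int_commute)
  then show ?thesis
    using half[OF h cl AB lA lB] unfolding liftable_on_def by blast
qed

text \<open>The open star of \<open>v\<close> is evenly covered: the value over \<open>v\<close>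
  selects the sheet, and two supports meet in a cube containing \<open>v\<close>, on which sheets
  with the same value at \<open>v\<close> agree. The whole space serves as neighbourhood of every
  point.\<close>

lemma liftable_on_star:
  fixes h :: "'b::topological_space \<Rightarrow> 'v \<Rightarrow> real"
  assumes h: "h ` A \<subseteq> realization K" and v: "\<And>q. q \<in> A \<Longrightarrow> v \<in> supp (h q)"
  shows "liftable_on A h"
  unfolding liftable_on_def
proof (intro ballI impI)
  fix q s assume q: "q \<in> A" and s: "s \<in> E" "pr s \<in> supp (h q)"
  have cube: "supp (h x) \<in> K" if "x \<in> A" for x using supp_cube h that by blast
  obtain \<tau> where \<tau>: "flat_section (supp (h q)) \<tau>" "\<tau> (pr s) = s"
    using flat_section_exists[OF cube[OF q] s(2,1)] by blast
  have "\<tau> v \<in> E" "pr (\<tau> v) = v" using \<tau>(1) v[OF q] unfolding flat_section_def by auto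
  then have "\<exists>\<sigma>. flat_section (supp (h x)) \<sigma> \<and> \<sigma> v = \<tau> v" if "x \<in> A" for x
    using flat_section_exists[OF cube[OF that], of "\<tau> v"] v[OF that] by metis
  then obtain \<Sigma> where S: "\<And>x. x \<in> A \<Longrightarrow> flat_section (supp (h x)) (\<Sigma> x) \<and> \<Sigma> x v = \<tau> v" by metis
  have "\<Sigma> x w = \<Sigma> y w" if "x \<in> A" "y \<in> A" "w \<in> supp (h x)" "w \<in> supp (h y)" for x y w
  proof (rule flat_section_unique[where C = "supp (h x) \<inter> supp (h y)" and u = v])
    show "supp (h x) \<inter> supp (h y) \<in> K" using Int_cube cube v that by blast
    show "flat_section (supp (h x) \<inter> supp (h y)) (\<Sigma> x)" "flat_section (supp (h x) \<inter> supp (h y)) (\<Sigma> y)"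
      using S that flat_section_subset by blast+
  qed (use S that v in auto)
  then have "lift_on A h \<Sigma>" unfolding lift_on_def using S by (metis IntD1 IntD2 UNIV_I open_UNIV)
  moreover have "\<Sigma> q (pr s) = \<tau> (pr s)"
    by (rule flat_section_unique[OF cube[OF q], of _ _ v]) (use S q \<tau> v s in auto)
  ultimately show "\<exists>\<Sigma>. lift_on A h \<Sigma> \<and> \<Sigma> q (pr s) = s" using \<tau>(2) by auto
qed

text \<open>Bisection takes the place of a Lebesgue number. For each height \<open>y\<close>,
  bisection in the horizontal direction lifts all sufficiently thin strips around \<open>y\<close>;
  bisection in the vertical direction then glues strips. Small rectangles are mapped into the open
  star of a vertex.\<close>

lemma liftable_on_square:
  fixes h :: "real \<times> real \<Rightarrow> 'v \<Rightarrow> real"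
  assumes h: "continuous_on ({0..1} \<times> {0..1}) h" "h ` ({0..1} \<times> {0..1}) \<subseteq> realization K"
  shows "liftable_on ({0..1} \<times> {0..1}) h"
proof -
  have glue: "liftable_on (A \<union> B) h"
    if "A \<union> B \<subseteq> {0..1} \<times> {0..1}" "closed A" "closed B" "connected (A \<inter> B)" "A \<inter> B \<noteq> {}"
      "liftable_on A h" "liftable_on B h" for A B
    using that h by (intro liftable_on_Un) (auto intro: continuous_on_subset)
  have strip: "\<exists>\<delta>>0. \<forall>c d. 0 \<le> c \<longrightarrow> d \<le> 1 \<longrightarrow> c \<le> y \<longrightarrow> y \<le> d \<longrightarrow> d - c < \<delta> \<longrightarrow> liftable_on ({0..1} \<times> {c..d}) h"
    if y: "y \<in> {0..1}" for y
  proof -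
    let ?Q = "\<lambda>a b. 0 \<le> a \<longrightarrow> b \<le> 1 \<longrightarrow>
      (\<exists>\<delta>>0. \<forall>c d. 0 \<le> c \<longrightarrow> d \<le> 1 \<longrightarrow> c \<le> y \<longrightarrow> y \<le> d \<longrightarrow> d - c < \<delta> \<longrightarrow> liftable_on ({a..b} \<times> {c..d}) h)"
    have "?Q 0 1"
    proof (rule Bolzano[of 0 1 ?Q])
      fix a b c :: real assume ab: "?Q a b" and bc: "?Q b c" and le: "a \<le> b" "b \<le> c"
      show "?Q a c"
      proof (intro impI)
        assume ac: "0 \<le> a" "c \<le> 1"
        obtain d1 where d1: "d1 > 0" "\<And>c d. 0 \<le> c \<Longrightarrow> d \<le> 1 \<Longrightarrow> c \<le> y \<Longrightarrow> y \<le> d \<Longrightarrow> d - c < d1 \<Longrightarrow> liftable_on ({a..b} \<times> {c..d}) h"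
          using ab ac le by auto
        obtain d2 where d2: "d2 > 0" "\<And>c' d. 0 \<le> c' \<Longrightarrow> d \<le> 1 \<Longrightarrow> c' \<le> y \<Longrightarrow> y \<le> d \<Longrightarrow> d - c' < d2 \<Longrightarrow> liftable_on ({b..c} \<times> {c'..d}) h"
          using bc ac le by auto
        have "liftable_on ({a..c} \<times> {e..d}) h"
          if "0 \<le> e" "d \<le> 1" "e \<le> y" "y \<le> d" "d - e < min d1 d2" for e d
        proof -
          have U: "{a..c} \<times> {e..d} = {a..b} \<times> {e..d} \<union> {b..c} \<times> {e..d}" using le by auto
          have I: "({a..b} \<times> {e..d}) \<inter> ({b..c} \<times> {e..d}) = {b} \<times> {e..d}" using le by auto
          show ?thesis unfolding U
          proof (rule glue)
            show "{a..b} \<times> {e..d} \<union> {b..c} \<times> {e..d} \<subseteq> {0..1} \<times> {0..1}" using that ac le by auto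
            show "connected ({a..b} \<times> {e..d} \<inter> {b..c} \<times> {e..d})"
              unfolding I by (intro connected_Times) auto
            show "{a..b} \<times> {e..d} \<inter> {b..c} \<times> {e..d} \<noteq> {}" unfolding I using that by auto
          qed (use that d1 d2 in \<open>auto intro!: closed_Times\<close>)
        qed
        then show "\<exists>\<delta>>0. \<forall>e d. 0 \<le> e \<longrightarrow> d \<le> 1 \<longrightarrow> e \<le> y \<longrightarrow> y \<le> d \<longrightarrow> d - e < \<delta> \<longrightarrow> liftable_on ({a..c} \<times> {e..d}) h"
          using d1(1) d2(1) by (intro exI[of _ "min d1 d2"]) auto
      qed
    next
      fix x :: real assume x: "0 \<le> x" "x \<le> 1"
      have xy: "(x, y) \<in> {0..1} \<times> {0..1}" using x y by auto
      then obtain N where N: "open N" "(x, y) \<in> N"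
        "\<And>q'. q' \<in> N \<inter> {0..1} \<times> {0..1} \<Longrightarrow> supp (h (x, y)) \<subseteq> supp (h q')"
        using supp_locally_increasing[OF h] by metis
      obtain e where e: "e > 0" "ball (x, y) e \<subseteq> N" using N(1,2) open_contains_ball by blast
      have "supp (h (x, y)) \<in> K" using supp_cube h(2) xy by blast
      then obtain v where v: "v \<in> supp (h (x, y))" using cube_nonempty by blast
      \<comment> \<open>Sides shorter than \<open>e / 2\<close> keep the rectangle inside the ball
        of radius \<open>e\<close>, as the distance is at most the sum of the coordinate
        distances.\<close>
      have "liftable_on ({a..b} \<times> {c..d}) h"
        if "a \<le> x" "x \<le> b" "b - a < e / 2" "0 \<le> a" "b \<le> 1" "0 \<le> c" "d \<le> 1" "c \<le> y" "y \<le> d" "d - c < e / 2" for a b c d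
      proof (rule liftable_on_star)
        have sub: "{a..b} \<times> {c..d} \<subseteq> {0..1} \<times> {0..1}" using that by auto
        then show "h ` ({a..b} \<times> {c..d}) \<subseteq> realization K" using h(2) by blast
        fix q assume q: "q \<in> {a..b} \<times> {c..d}"
        have "dist (x, y) q \<le> dist x (fst q) + dist y (snd q)"
          unfolding dist_prod_def by (rule order_trans[OF sqrt_sum_squares_le_sum_abs]) simp
        also have "\<dots> < e" using q that by (auto simp: dist_real_def)
        finally have "q \<in> N" using e(2) by auto
        then show "v \<in> supp (h q)" using N(3) v q sub by blast
      qed
      then show "\<exists>d>0. \<forall>a b. a \<le> x \<and> x \<le> b \<and> b - a < d \<longrightarrow> ?Q a b"
        using e(1) by (intro exI[of _ "e / 2"]) (auto intro!: exI[of _ "e / 2"])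
    qed simp
    then show ?thesis by simp
  qed
  let ?P = "\<lambda>c d. 0 \<le> c \<longrightarrow> d \<le> 1 \<longrightarrow> liftable_on ({0..1} \<times> {c..d}) h"
  have "?P 0 1"
  proof (rule Bolzano[of 0 1 ?P])
    fix a b c :: real assume ab: "?P a b" and bc: "?P b c" and le: "a \<le> b" "b \<le> c"
    show "?P a c"
    proof (intro impI)
      assume ac: "0 \<le> a" "c \<le> 1"
      have U: "{0..1} \<times> {a..c} = {0..1} \<times> {a..b} \<union> {0..1::real} \<times> {b..c}" using le by auto
      have I: "({0..1} \<times> {a..b}) \<inter> ({0..1::real} \<times> {b..c}) = {0..1} \<times> {b}" using le by auto
      show "liftable_on ({0..1} \<times> {a..c}) h" unfolding U
      proof (rule glue)
        show "{0..1} \<times> {a..b} \<union> {0..1} \<times> {b..c} \<subseteq> {0..1::real} \<times> {0..1}" using ac le by auto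
        show "connected ({0..1::real} \<times> {a..b} \<inter> {0..1} \<times> {b..c})"
          unfolding I by (intro connected_Times) auto
        show "{0..1::real} \<times> {a..b} \<inter> {0..1} \<times> {b..c} \<noteq> {}" unfolding I by auto
      qed (use ab bc ac le in \<open>auto intro!: closed_Times\<close>)
    qed
  next
    fix y :: real assume "0 \<le> y" "y \<le> 1"
    then obtain \<delta> where "\<delta> > 0" "\<And>c d. 0 \<le> c \<Longrightarrow> d \<le> 1 \<Longrightarrow> c \<le> y \<Longrightarrow> y \<le> d \<Longrightarrow> d - c < \<delta> \<Longrightarrow> liftable_on ({0..1} \<times> {c..d}) h"
      using strip[of y] by auto
    then show "\<exists>d>0. \<forall>a b. a \<le> y \<and> y \<le> b \<and> b - a < d \<longrightarrow> ?P a b" by auto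
  qed simp
  then show ?thesis by simp
qed

text \<open>A path is regarded as a map of the square that is constant in the first coordinate, and
  the lift is restricted to one side.\<close>

lemma path_lift:
  assumes p: "path p" "path_image p \<subseteq> realization K" and s: "s \<in> E" "pr s \<in> supp (p 0)"
  obtains \<Sigma> where "lift_on {0..1} p \<Sigma>" "\<Sigma> 0 (pr s) = s"
proof -
  have "continuous_on ({0..1} \<times> {0..1}) (\<lambda>z::real \<times> real. p (snd z))"
    by (rule continuous_on_compose2[OF p(1)[unfolded path_def]]) (auto intro: continuous_on_snd continuous_on_id)
  moreover have "(\<lambda>z::real \<times> real. p (snd z)) ` ({0..1} \<times> {0..1}) \<subseteq> realization K"
    using p(2) unfolding path_image_def by auto
  ultimately have "liftable_on ({0..1} \<times> {0..1}) (\<lambda>z::real \<times> real. p (snd z))"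
    by (rule liftable_on_square)
  moreover have "(0, 0) \<in> {0..1::real} \<times> {0..1::real}" by simp
  moreover have "pr s \<in> supp (p (snd (0::real, 0::real)))" using s(2) by simp
  ultimately obtain \<Sigma> where S: "lift_on ({0..1} \<times> {0..1}) (\<lambda>z::real \<times> real. p (snd z)) \<Sigma>" "\<Sigma> (0, 0) (pr s) = s"
    using s(1) unfolding liftable_on_def by blast
  have "lift_on {0..1} (\<lambda>x. p (snd (0::real, x))) (\<lambda>x. \<Sigma> (0, x))"
    by (rule lift_on_compose[OF S(1), of "{0..1}" "\<lambda>x. (0, x)"]) (auto intro: continuous_intros)
  then show thesis using that[of "\<lambda>x. \<Sigma> (0, x)"] S(2) by simp
qed

text \<open>The homotopy to a constant loop is free, so its two sides are the same path but need not
  be constant. The lifts of the sides agree at the constant end \<open>t = 1\<close>, hence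
  everywhere, and at \<open>t = 0\<close> this compares the two ends of the lift of
  \<open>p\<close>.\<close>

lemma loop_lift_closed:
  assumes sc: "simply_connected (realization K)"
    and p: "path p" "path_image p \<subseteq> realization K" "p 0 = p 1"
    and l: "lift_on {0..1} p \<Sigma>" and v: "v \<in> supp (p 0)"
  shows "\<Sigma> 0 v = \<Sigma> 1 v"
proof -
  define c where "c = (\<lambda>_::real. p 0)"
  have "path c \<and> pathfinish c = pathstart c \<and> path_image c \<subseteq> realization K"
    using p(2) by (auto simp: c_def path_def path_image_def pathstart_def pathfinish_def)
  then have "homotopic_loops (realization K) p c"
    using sc p unfolding simply_connected_def by (metis pathfinish_def pathstart_def)
  then obtain h where hc: "continuous_on ({0..1::real} \<times> {0..1::real}) h"
    and hi: "h \<in> {0..1} \<times> {0..1} \<rightarrow> realization K"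
    and h0: "\<forall>x\<in>{0..1}. h (0, x) = p x" and h1: "\<forall>x\<in>{0..1}. h (1, x) = c x"
    and hl: "\<forall>t\<in>{0..1}. pathfinish (h \<circ> Pair t) = pathstart (h \<circ> Pair t)"
    unfolding homotopic_loops by blast
  have hi: "h ` ({0..1} \<times> {0..1}) \<subseteq> realization K" using hi by (simp only: image_subset_iff_funcset)
  have h0: "h (0, x) = p x" if "x \<in> {0..1}" for x using h0 that by blast
  have h1: "h (1, x) = p 0" if "x \<in> {0..1}" for x using h1 that unfolding c_def by blast
  have hl: "h (t, 0) = h (t, 1)" if "t \<in> {0..1}" for t
    using hl that by (simp add: pathfinish_def pathstart_def)
  have sv: "\<Sigma> 0 v \<in> E" "pr (\<Sigma> 0 v) = v" using lift_onD[OF l, of 0] v unfolding flat_section_def by auto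
  have "liftable_on ({0..1} \<times> {0..1}) h" using liftable_on_square hc hi by blast
  then obtain \<Psi> where P: "lift_on ({0..1} \<times> {0..1}) h \<Psi>" "\<Psi> (0, 0) v = \<Sigma> 0 v"
    using sv v h0[of 0] unfolding liftable_on_def
    by (metis atLeastAtMost_iff mem_Sigma_iff order_refl zero_le_one)
  have row: "lift_on {0..1} (\<lambda>x. h (t, x)) (\<lambda>x. \<Psi> (t, x))" if "t \<in> {0..1}" for t
    by (rule lift_on_compose[OF P(1), of "{0..1}" "\<lambda>x. (t, x)"]) (use that in \<open>auto intro: continuous_intros\<close>)
  have col: "lift_on {0..1} (\<lambda>t. h (t, x)) (\<lambda>t. \<Psi> (t, x))" if "x \<in> {0..1}" for x
    by (rule lift_on_compose[OF P(1), of "{0..1}" "\<lambda>t. (t, x)"]) (use that in \<open>auto intro: continuous_intros\<close>)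
  have pc: "continuous_on {0..1} p" "p ` {0..1} \<subseteq> realization K"
    using p unfolding path_def path_image_def by auto
  have bottom: "\<Psi> (0, x) w = \<Sigma> x w" if "x \<in> {0..1}" "w \<in> supp (p x)" for x w
    by (rule lift_on_unique[OF connected_Icc pc _ l, of _ 0 v])
      (use lift_on_cong[OF row[of 0] h0] P(2) v that in auto)
  have top: "\<Psi> (1, 1) v = \<Psi> (1, 0) v"
  proof -
    have c: "lift_on {0..1} (\<lambda>x. p 0) (\<lambda>x. \<Psi> (1, x))" using lift_on_cong[OF row[of 1] h1] by simp
    have "flat_section (supp (p 0)) (\<Psi> (1, 0))" using lift_onD[OF c, of 0] by simp
    then have "lift_on {0..1::real} (\<lambda>x. p 0) (\<lambda>x. \<Psi> (1, 0))" unfolding lift_on_def by blast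
    moreover have "p 0 \<in> realization K" using pc(2) by (simp add: image_subset_iff)
    ultimately show ?thesis
      using lift_on_unique[OF connected_Icc _ _ c, of "\<lambda>x. \<Psi> (1, 0)" 0 v 1 v] v by auto
  qed
  have sides: "\<Psi> (0, 1) v = \<Psi> (0, 0) v"
  proof (rule lift_on_unique[OF connected_Icc, of 0 1 "\<lambda>t. h (t, 0)" "\<lambda>t. \<Psi> (t, 1)" "\<lambda>t. \<Psi> (t, 0)" 1 v])
    show "continuous_on {0..1} (\<lambda>t. h (t, 0))"
      by (rule continuous_on_compose2[OF hc]) (auto intro: continuous_intros)
    show "(\<lambda>t. h (t, 0)) ` {0..1} \<subseteq> realization K" using hi by auto
    show "lift_on {0..1} (\<lambda>t. h (t, 0)) (\<lambda>t. \<Psi> (t, 1))"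
      using lift_on_cong[OF col[of 1], of "\<lambda>t. h (t, 0)"] hl by simp
  qed (use col[of 0] top v h1[of 0] h0[of 0] in auto)
  show ?thesis using bottom[of 0 v] bottom[of 1 v] sides v p(3) by simp
qed

end

text \<open>By definition of simple connectivity any two loops are freely homotopic; for the
  constant loops at \<open>a\<close> and \<open>b\<close> the trace of the base point is a path
  between them.\<close>

lemma simply_connected_path_exists:
  assumes "simply_connected S" "a \<in> S" "b \<in> S"
  obtains \<gamma> where "path \<gamma>" "path_image \<gamma> \<subseteq> S" "\<gamma> 0 = a" "\<gamma> 1 = b"
proof -
  have "path (\<lambda>_::real. c) \<and> pathfinish (\<lambda>_::real. c) = pathstart (\<lambda>_. c) \<and> path_image (\<lambda>_::real. c) \<subseteq> S"
    if "c \<in> S" for c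
    using that by (auto simp: path_def path_image_def pathstart_def pathfinish_def)
  then have "homotopic_loops S (\<lambda>_. a) (\<lambda>_. b)"
    using assms unfolding simply_connected_def by blast
  then obtain h where h: "continuous_on ({0..1::real} \<times> {0..1::real}) h" "h \<in> {0..1} \<times> {0..1} \<rightarrow> S"
    "\<forall>x\<in>{0..1}. h (0, x) = a" "\<forall>x\<in>{0..1}. h (1, x) = b"
    unfolding homotopic_loops by blast
  show thesis
  proof (rule that[of "\<lambda>t. h (t, 0)"])
    show "path (\<lambda>t. h (t, 0))"
      unfolding path_def by (rule continuous_on_compose2[OF h(1)]) (auto intro: continuous_intros)
    show "path_image (\<lambda>t. h (t, 0)) \<subseteq> S" using h(2) by (auto simp: path_image_def)
  qed (use h in auto)
qed

context covering
begin

text \<open>Monodromy: \<open>\<sigma> v\<close> is the end of the lift of a path from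
  \<open>x\<close> to \<open>v\<close>. For an edge from \<open>u\<close> to \<open>v\<close>, the
  path to \<open>u\<close>, the edge and the path back from \<open>v\<close> form a loop; as its
  lift closes up, \<open>\<sigma> u\<close> and \<open>\<sigma> v\<close> are joined by the lifted
  edge.\<close>

theorem global_section:
  assumes sc: "simply_connected (realization K)" and x: "x \<in> \<Union>K" and s: "s \<in> E" "pr s = x"
  obtains \<sigma> where "flat_section (\<Union>K) \<sigma>" "\<sigma> x = s"
proof -
  have "\<exists>\<gamma>. path \<gamma> \<and> path_image \<gamma> \<subseteq> realization K \<and> \<gamma> 0 = vertex_point x \<and> \<gamma> 1 = vertex_point v"
    if "v \<in> \<Union>K" for v
    using simply_connected_path_exists[OF sc vertex_point_realization[OF x] vertex_point_realization[OF that]]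
    by metis
  then obtain \<gamma> where g: "\<And>v. v \<in> \<Union>K \<Longrightarrow> path (\<gamma> v)" "\<And>v. v \<in> \<Union>K \<Longrightarrow> path_image (\<gamma> v) \<subseteq> realization K"
    and g0: "\<And>v. v \<in> \<Union>K \<Longrightarrow> \<gamma> v 0 = vertex_point x" and g1: "\<And>v. v \<in> \<Union>K \<Longrightarrow> \<gamma> v 1 = vertex_point v"
    by metis
  have start: "pr s \<in> supp (vertex_point x)" using s by (simp add: supp_vertex_point)
  have "\<exists>\<Sigma>. lift_on {0..1} (\<gamma> v) \<Sigma> \<and> \<Sigma> 0 x = s" if "v \<in> \<Union>K" for v
    using path_lift[OF g[OF that] s(1)] start g0[OF that] s(2) by metis
  then obtain \<Sigma> where S: "\<And>v. v \<in> \<Union>K \<Longrightarrow> lift_on {0..1} (\<gamma> v) (\<Sigma> v)" and S0: "\<And>v. v \<in> \<Union>K \<Longrightarrow> \<Sigma> v 0 x = s"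
    by metis
  define \<sigma> where "\<sigma> v = \<Sigma> v 1 v" for v
  have unique: "\<Psi> 1 v = \<sigma> v" if v: "v \<in> \<Union>K" and P: "lift_on {0..1} (\<gamma> v) \<Psi>" "\<Psi> 0 x = s" for v \<Psi>
    unfolding \<sigma>_def
  proof (rule lift_on_unique[OF connected_Icc _ _ P(1) S[OF v], of 0 x])
    show "continuous_on {0..1} (\<gamma> v)" "\<gamma> v ` {0..1} \<subseteq> realization K"
      using g[OF v] by (auto simp: path_def path_image_def)
  qed (use P(2) S0[OF v] g0[OF v] g1[OF v] in \<open>simp_all add: supp_vertex_point\<close>)
  have \<sigma>: "\<sigma> v \<in> E \<and> pr (\<sigma> v) = v" if "v \<in> \<Union>K" for v
    using lift_onD[OF S[OF that], of 1] g1[OF that] unfolding \<sigma>_def flat_section_def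
    by (simp add: supp_vertex_point)
  have "R (\<sigma> u) (\<sigma> v)" if adj: "adjacent K u v" for u v
  proof -
    have uv: "u \<in> \<Union>K" "v \<in> \<Union>K" "u \<noteq> v" using adjacent_vertices[OF adj] adj by (auto simp: adjacent_def)
    \<comment> \<open>The loop runs along \<open>\<gamma> u\<close> on \<open>[0, 1/4]\<close>,
      along the edge on \<open>[1/4, 1/2]\<close> and backwards along \<open>\<gamma> v\<close> on
      \<open>[1/2, 1]\<close>; this is the source of the reparametrizations below.\<close>
    define p where "p = (\<gamma> u +++ edge_point u v) +++ reversepath (\<gamma> v)"
    have ends: "pathfinish (\<gamma> u) = pathstart (edge_point u v)"
      "pathfinish (\<gamma> u +++ edge_point u v) = pathstart (reversepath (\<gamma> v))"
      using uv g1 by (simp_all add: pathfinish_def pathstart_def edge_point_0 edge_point_1 reversepath_def joinpaths_def)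
    have pp: "path p" unfolding p_def using ends g uv path_edge_point by simp
    have "path_image (edge_point u v) \<subseteq> realization K"
      using edge_point_realization[OF adj] by (auto simp: path_image_def)
    then have pimg: "path_image p \<subseteq> realization K"
      unfolding p_def using g(1)[OF uv(2)] g(2)[OF uv(1)] g(2)[OF uv(2)]
      by (intro subset_path_image_join) simp_all
    have p0: "p 0 = vertex_point x" "p 1 = vertex_point x"
      unfolding p_def joinpaths_def reversepath_def using g0 uv by auto
    obtain \<Psi> where P: "lift_on {0..1} p \<Psi>" "\<Psi> 0 x = s"
      using path_lift[OF pp pimg s(1)] start p0 s(2) by metis
    have P1: "\<Psi> 1 x = s"
      using loop_lift_closed[OF sc pp pimg _ P(1), of x] p0 P(2) by (simp add: supp_vertex_point)
    have "lift_on {0..1} (\<gamma> u) (\<lambda>t. \<Psi> (t / 4))"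
    proof (rule lift_on_cong[OF lift_on_compose[OF P(1)]])
      show "continuous_on {0..1} (\<lambda>t::real. t / 4)" by (intro continuous_intros) auto
    qed (auto simp: p_def joinpaths_def)
    from unique[OF uv(1) this] have Pu: "\<Psi> (1 / 4) u = \<sigma> u" using P(2) by simp
    have "lift_on {0..1} (\<gamma> v) (\<lambda>t. \<Psi> (1 - t / 2))"
    proof (rule lift_on_cong[OF lift_on_compose[OF P(1)]])
      show "continuous_on {0..1} (\<lambda>t::real. 1 - t / 2)" by (intro continuous_intros) auto
      show "p (1 - t / 2) = \<gamma> v t" if "t \<in> {0..1}" for t
        using that uv g1[OF uv(2)] by (cases "t = 1") (auto simp: p_def joinpaths_def reversepath_def edge_point_1)
    qed auto
    from unique[OF uv(2) this] have Pv: "\<Psi> (1 / 2) v = \<sigma> v" using P1 by simp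
    have middle: "lift_on {0..1} (edge_point u v) (\<lambda>t. \<Psi> (1 / 4 + t / 4))"
    proof (rule lift_on_cong[OF lift_on_compose[OF P(1)]])
      show "continuous_on {0..1} (\<lambda>t::real. 1 / 4 + t / 4)" by (intro continuous_intros) auto
      show "p (1 / 4 + t / 4) = edge_point u v t" if "t \<in> {0..1}" for t
      proof (cases "t = 0")
        case True
        then show ?thesis using g1[OF uv(1)] by (simp add: p_def joinpaths_def edge_point_0)
      next
        case False
        then have "p (1 / 4 + t / 4) = edge_point u v (2 * (2 * (1 / 4 + t / 4)) - 1)"
          using that by (simp add: p_def joinpaths_def)
        also have "2 * (2 * (1 / 4 + t / 4)) - 1 = t" by simp
        finally show ?thesis .
      qed
    qed auto
    have edge: "{u, v} \<in> K" using adj by (simp add: adjacent_def)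
    obtain \<tau> where \<tau>: "flat_section {u, v} \<tau>" "\<tau> u = \<sigma> u"
      using flat_section_exists[OF edge, of "\<sigma> u"] \<sigma>[OF uv(1)] by auto
    \<comment> \<open>All supports along the edge lie in \<open>{u, v}\<close>, so one flat section
      over the edge is a lift independent of the parameter.\<close>
    have "lift_on {0..1::real} (edge_point u v) (\<lambda>_. \<tau>)"
      unfolding lift_on_def using flat_section_subset[OF \<tau>(1) supp_edge_point] by blast
    moreover have "edge_point u v ` {0..1} \<subseteq> realization K"
      using edge_point_realization[OF adj] by blast
    ultimately have "\<Psi> (1 / 4 + 1 / 4) v = \<tau> v"
      using lift_on_unique[OF connected_Icc _ _ middle, of "\<lambda>_. \<tau>" 0 u 1 v]
        path_edge_point[of u v] \<tau>(2) Pu uv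
      by (auto simp: path_def edge_point_0 edge_point_1 supp_vertex_point)
    then have "\<tau> v = \<sigma> v" using Pv by simp
    then show ?thesis using \<tau> adj unfolding flat_section_def by auto
  qed
  then have "flat_section (\<Union>K) \<sigma>" unfolding flat_section_def using \<sigma> by blast
  moreover have "\<sigma> x = s"
    using loop_lift_closed[OF sc g[OF x] _ S[OF x], of x] g0[OF x] g1[OF x] S0[OF x]
    by (simp add: \<sigma>_def supp_vertex_point)
  ultimately show thesis using that by blast
qed

end

section \<open>Distances\<close>

locale cat0_cx = flag_cube_cx K for K :: "'v set set" +
  assumes simply_connected: "simply_connected (realization K)"
begin

abbreviation d :: "'v \<Rightarrow> 'v \<Rightarrow> nat" where
  "d \<equiv> l1_dist K"

lemma edge_path_relpow:
  "edge_path K p \<Longrightarrow> (adjacent K ^^ (length p - 1)) (hd p) (last p)"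
proof (induction p)
  case (Cons v p)
  show ?case
  proof (cases p)
    case (Cons u q)
    then have "edge_path K p" "adjacent K v u" using Cons.prems by (auto simp: edge_path_def)
    then have "(adjacent K ^^ length q) u (last p)" using Cons.IH Cons by simp
    then have "(adjacent K ^^ Suc (length q)) v (last p)" using \<open>adjacent K v u\<close> by (rule relpowp_Suc_I2[rotated])
    then show ?thesis using Cons by simp
  qed simp
qed (simp add: edge_path_def)

lemma relpowp_adjacent_sym: "(adjacent K ^^ n) u v \<Longrightarrow> (adjacent K ^^ n) v u"
proof (induction n arbitrary: v)
  case (Suc n)
  then obtain w where "(adjacent K ^^ n) u w" "adjacent K w v" by (elim relpowp_Suc_E)
  then show ?case using Suc.IH adjacent_sym relpowp_Suc_I2 by metis
qed simp

lemma l1_dist_sym: "d u v = d v u"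
proof -
  have "(adjacent K ^^ n) u v \<longleftrightarrow> (adjacent K ^^ n) v u" for n using relpowp_adjacent_sym by blast
  then show ?thesis by (simp add: l1_dist_def)
qed

text \<open>
  By simple connectivity the covering by the classes of reduced paths starting at \<open>w\<close> has a global
  section. It assigns to each vertex a class of geodesics from \<open>w\<close>.
\<close>

lemma geodesic_class_exists:
  assumes w: "w \<in> \<Union>K"
  obtains \<sigma> where
    "\<And>v. v \<in> \<Union>K \<Longrightarrow> \<sigma> v \<in> path_classes w \<and> class_end (\<sigma> v) = v \<and> class_length (\<sigma> v) = Suc (d w v)"
    "\<And>u v. adjacent K u v \<Longrightarrow> class_adjacent (\<sigma> u) (\<sigma> v)"
    "\<And>v. v \<in> \<Union>K \<Longrightarrow> (adjacent K ^^ d w v) w v"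
proof -
  interpret covering K "path_classes w" class_end class_adjacent by (rule covering_path_classes)
  have "\<not> backtracks q" if "path_swaps K [w] q" for q
    using swaps_length[OF that] by (auto simp: backtracks_def)
  then have "path_class [w] \<in> path_classes w"
    unfolding path_class_mem_iff using w by (auto simp: edge_path_def reduced_path_def)
  moreover have "class_end (path_class [w]) = w" by (simp add: class_end_path_class)
  ultimately obtain \<sigma> where flat: "flat_section (\<Union>K) \<sigma>" and \<sigma>w: "\<sigma> w = path_class [w]"
    using global_section[OF simply_connected w] by blast
  have \<sigma>: "\<sigma> v \<in> path_classes w \<and> class_end (\<sigma> v) = v" if "v \<in> \<Union>K" for v
    using flat that unfolding flat_section_def by blast
  have adj: "class_adjacent (\<sigma> u) (\<sigma> v)" if "adjacent K u v" for u v
    using flat that adjacent_vertices[OF that] unfolding flat_section_def by blast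
  \<comment> \<open>Lengths count vertices, hence the \<open>Suc\<close>. As each edge changes the
    length by one, no path from \<open>w\<close> to \<open>v\<close> is shorter than those in
    \<open>\<sigma> v\<close>, and \<open>reach\<close> below shows that this length is
    attained.\<close>
  have upper: "class_length (\<sigma> v) \<le> Suc n" if "(adjacent K ^^ n) w v" for n v
    using that
  proof (induction n arbitrary: v)
    case 0
    then show ?case using \<sigma>w class_length_path_class by simp
  next
    case (Suc n)
    then obtain u where "(adjacent K ^^ n) w u" "adjacent K u v" by (elim relpowp_Suc_E)
    then show ?case using Suc.IH adj extends_class_length unfolding class_adjacent_def by fastforce
  qed
  have reach: "(adjacent K ^^ (class_length (\<sigma> v) - 1)) w v" "class_length (\<sigma> v) > 0" if v: "v \<in> \<Union>K" for v
  proof -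
    obtain p where p: "\<sigma> v = path_class p" "edge_path K p" "last p = w"
      using \<sigma>[OF v] unfolding path_classes_def by blast
    then have "hd p = v" using \<sigma>[OF v] class_end_path_class by simp
    then show "(adjacent K ^^ (class_length (\<sigma> v) - 1)) w v" "class_length (\<sigma> v) > 0"
      using edge_path_relpow[OF p(2)] p relpowp_adjacent_sym class_length_path_class
      by (auto simp: edge_path_def)
  qed
  have len: "d w v = class_length (\<sigma> v) - 1" if v: "v \<in> \<Union>K" for v
    unfolding l1_dist_def
  proof (rule Least_equality)
    show "(adjacent K ^^ (class_length (\<sigma> v) - 1)) w v" by (rule reach[OF v])
    show "class_length (\<sigma> v) - 1 \<le> n" if "(adjacent K ^^ n) w v" for n using upper[OF that] by simp
  qed
  show thesis
  proof (rule that)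
    show "\<sigma> v \<in> path_classes w \<and> class_end (\<sigma> v) = v \<and> class_length (\<sigma> v) = Suc (d w v)" if "v \<in> \<Union>K" for v
      using \<sigma>[OF that] len[OF that] reach(2)[OF that] by simp
    show "(adjacent K ^^ d w v) w v" if "v \<in> \<Union>K" for v using reach(1)[OF that] len[OF that] by simp
  qed (rule adj)
qed

lemma l1_dist_path: "w \<in> \<Union>K \<Longrightarrow> v \<in> \<Union>K \<Longrightarrow> (adjacent K ^^ d w v) w v"
  using geodesic_class_exists by metis

text \<open>The geodesic classes of \<open>u\<close> and \<open>v\<close> are adjacent in the
  covering, so one prolongs the other, and equal distances cannot occur.\<close>

lemma l1_dist_adjacent:
  assumes "w \<in> \<Union>K" "adjacent K u v"
  shows "d w v = Suc (d w u) \<or> d w u = Suc (d w v)"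
proof -
  obtain \<sigma> where
    \<sigma>: "\<And>v. v \<in> \<Union>K \<Longrightarrow> \<sigma> v \<in> path_classes w \<and> class_end (\<sigma> v) = v \<and> class_length (\<sigma> v) = Suc (d w v)"
    "\<And>u v. adjacent K u v \<Longrightarrow> class_adjacent (\<sigma> u) (\<sigma> v)"
    using geodesic_class_exists[OF assms(1)] by metis
  have "u \<in> \<Union>K" "v \<in> \<Union>K" using adjacent_vertices[OF assms(2)] by auto
  note len = this[THEN \<sigma>(1)]
  from \<sigma>(2)[OF assms(2)] show ?thesis unfolding class_adjacent_def
  proof
    assume "extends (\<sigma> u) (\<sigma> v)"
    from extends_class_length[OF this] show ?thesis using len by simp
  next
    assume "extends (\<sigma> v) (\<sigma> u)"
    from extends_class_length[OF this] show ?thesis using len by simp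
  qed
qed

text \<open>The geodesic classes of \<open>v\<close> and \<open>v'\<close> both lie below that of
  \<open>u\<close>, so the quadrangle condition of the covering applies. By uniqueness of lifts the
  class at its bottom is the value of the section at \<open>z\<close>, and its length is a
  distance.\<close>

lemma l1_dist_quadrangle:
  assumes w: "w \<in> \<Union>K" and adj: "adjacent K u v" "adjacent K u v'" "v \<noteq> v'"
    and dist: "d w u = Suc (d w v)" "d w u = Suc (d w v')"
  obtains z where "square K z v u v'" "d w v = Suc (d w z)"
proof -
  obtain \<sigma> where
    \<sigma>: "\<And>v. v \<in> \<Union>K \<Longrightarrow> \<sigma> v \<in> path_classes w \<and> class_end (\<sigma> v) = v \<and> class_length (\<sigma> v) = Suc (d w v)"
    and \<sigma>adj: "\<And>u v. adjacent K u v \<Longrightarrow> class_adjacent (\<sigma> u) (\<sigma> v)"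
    using geodesic_class_exists[OF w] by metis
  have uv: "u \<in> \<Union>K" "v \<in> \<Union>K" "v' \<in> \<Union>K" using adj adjacent_vertices by blast+
  have "\<not> extends (\<sigma> u) (\<sigma> v)"
    using extends_class_length[of "\<sigma> u" "\<sigma> v"] \<sigma>[OF uv(1)] \<sigma>[OF uv(2)] dist by auto
  moreover have "\<not> extends (\<sigma> u) (\<sigma> v')"
    using extends_class_length[of "\<sigma> u" "\<sigma> v'"] \<sigma>[OF uv(1)] \<sigma>[OF uv(3)] dist by auto
  ultimately have ext: "extends (\<sigma> v) (\<sigma> u)" "extends (\<sigma> v') (\<sigma> u)"
    using \<sigma>adj[OF adj(1)] \<sigma>adj[OF adj(2)] unfolding class_adjacent_def by blast+
  then obtain \<gamma> where \<gamma>: "\<gamma> \<in> path_classes w" "extends \<gamma> (\<sigma> v)" "square K (class_end \<gamma>) v u v'"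
    using extends_below_square[OF ext, of w] \<sigma>[OF uv(1)] \<sigma>[OF uv(2)] \<sigma>[OF uv(3)] adj(3) by auto
  let ?z = "class_end \<gamma>"
  have z: "adjacent K v ?z" "?z \<in> \<Union>K" using \<gamma>(3) by (auto simp: square_def adjacent_sym)
  interpret covering K "path_classes w" class_end class_adjacent by (rule covering_path_classes)
  have "\<sigma> ?z = \<gamma>"
    by (rule R_unique[of "\<sigma> v"]) (use \<sigma> \<sigma>adj z uv \<gamma> in \<open>auto simp: class_adjacent_def\<close>)
  then have "d w v = Suc (d w ?z)" using extends_class_length[OF \<gamma>(2)] \<sigma>[OF z(2)] \<sigma>[OF uv(2)] by simp
  then show thesis using that \<gamma>(3) by blast
qed

lemma l1_dist_self: "d w w = 0"
  unfolding l1_dist_def by (rule Least_equality) auto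

lemma l1_dist_eq_0_iff: "w \<in> \<Union>K \<Longrightarrow> v \<in> \<Union>K \<Longrightarrow> d w v = 0 \<longleftrightarrow> w = v"
  using l1_dist_path l1_dist_self by (metis relpowp_0_E)

text \<open>As distances change by one along each edge, the claim can fail only if two opposite
  corners are both farther from \<open>w\<close> than the other two. The quadrangle condition at a
  far corner then yields a corner nearer than these two, which by uniqueness of squares is the other
  far corner.\<close>

lemma l1_dist_parallel:
  assumes w: "w \<in> \<Union>K" and sq: "square K a b c e"
  shows "int (d w c) - int (d w e) = int (d w b) - int (d w a)"
proof -
  have adj: "adjacent K a b" "adjacent K b c" "adjacent K c e" "adjacent K e a" using sq by (auto simp: square_def)
  note dis = square_distinct[OF sq]
  note step = adj[THEN l1_dist_adjacent[OF w]]
  have no1: "\<not> (d w a = Suc (d w b) \<and> d w a = Suc (d w e) \<and> d w c = Suc (d w b))"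
  proof
    assume h: "d w a = Suc (d w b) \<and> d w a = Suc (d w e) \<and> d w c = Suc (d w b)"
    then obtain z where z: "square K z b a e" "d w b = Suc (d w z)"
      using l1_dist_quadrangle[OF w, of a b e] adj dis adjacent_sym by metis
    have "square K b a e c" using sq square_flip square_rotate by metis
    then have "z = c" using z(1) square_rotate square_unique by metis
    then show False using z h by simp
  qed
  have no2: "\<not> (d w b = Suc (d w a) \<and> d w b = Suc (d w c) \<and> d w e = Suc (d w a))"
  proof
    assume h: "d w b = Suc (d w a) \<and> d w b = Suc (d w c) \<and> d w e = Suc (d w a)"
    then obtain z where z: "square K z a b c" "d w a = Suc (d w z)"
      using l1_dist_quadrangle[OF w, of b a c] adj dis adjacent_sym by metis
    then have "z = e" using sq square_rotate square_unique by metis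
    then show False using z h by simp
  qed
  show ?thesis using step no1 no2 by linarith
qed

text \<open>Edges of the same direction are compared across squares of the cube, one coordinate
  \<open>j\<close> at a time.\<close>

lemma l1_dist_cube_step:
  assumes w: "w \<in> \<Union>K" and ch: "cube_chart K C n \<kappa>"
    and U: "finite U" "U \<subseteq> {..<n}" "i < n" "i \<notin> U"
  shows "int (d w (\<kappa> (insert i U))) - int (d w (\<kappa> U)) = int (d w (\<kappa> {i})) - int (d w (\<kappa> {}))"
  using U
proof (induction U rule: finite_induct)
  case (insert j U)
  have "square K (\<kappa> U) (\<kappa> (insert i U)) (\<kappa> (insert i (insert j U))) (\<kappa> (insert j U))"
    by (rule cube_chart_square[OF ch]) (use insert in auto)
  from l1_dist_parallel[OF w this] show ?case using insert by simp
qed simp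

text \<open>The vertex of the cube with coordinates \<open>P\<close> is the gate of \<open>w\<close>, the vertex nearest to \<open>w\<close>.\<close>

lemma l1_dist_cube:
  assumes w: "w \<in> \<Union>K" and ch: "cube_chart K C n \<kappa>" and U: "U \<subseteq> {..<n}"
  defines "P \<equiv> {i. i < n \<and> d w (\<kappa> {i}) < d w (\<kappa> {})}"
  shows "int (d w (\<kappa> U)) = int (d w (\<kappa> {})) + int (card (U - P)) - int (card (U \<inter> P))"
proof -
  have "finite U" using U finite_subset by blast
  then show ?thesis using U
  proof (induction U rule: finite_induct)
    case (insert i U)
    have i: "i < n" using insert.prems by simp
    have "adjacent K (\<kappa> {}) (\<kappa> {i})" using cube_chart_edge[OF ch, of "{}" i] i by simp
    then have s: "d w (\<kappa> {i}) = Suc (d w (\<kappa> {})) \<or> d w (\<kappa> {}) = Suc (d w (\<kappa> {i}))"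
      by (rule l1_dist_adjacent[OF w])
    have st: "int (d w (\<kappa> (insert i U))) - int (d w (\<kappa> U)) = int (d w (\<kappa> {i})) - int (d w (\<kappa> {}))"
      by (rule l1_dist_cube_step[OF w ch]) (use insert in auto)
    show ?case
    proof (cases "i \<in> P")
      case True
      then have "insert i U - P = U - P" "insert i U \<inter> P = insert i (U \<inter> P)" by auto
      then show ?thesis using st s insert True by (simp add: P_def)
    next
      case False
      then have "insert i U - P = insert i (U - P)" "insert i U \<inter> P = U \<inter> P" by auto
      moreover have "d w (\<kappa> {i}) = Suc (d w (\<kappa> {}))" using False s i by (auto simp: P_def)
      ultimately show ?thesis using st insert by simp
    qed
  qed simp
qed

text \<open>Seen from \<open>\<kappa> {}\<close> itself no coordinate leads nearer, so the gate is
  \<open>\<kappa> {}\<close> and every coordinate of \<open>U\<close> counts.\<close>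

lemma l1_dist_in_cube:
  assumes ch: "cube_chart K C n \<kappa>" and U: "U \<subseteq> {..<n}"
  shows "d (\<kappa> {}) (\<kappa> U) = card U"
proof -
  have "\<kappa> {} \<in> \<Union>K" using cube_chart_mem[OF ch] cube_chart_image[OF ch] by blast
  from l1_dist_cube[OF this ch U] show ?thesis by (simp add: l1_dist_self)
qed

text \<open>The intersection is a cube with the same neighbours of \<open>x\<close>, hence with the
  same dimension and the same number of vertices as both cubes.\<close>

lemma cube_eqI_neighbours:
  assumes "C \<in> K" "D \<in> K" "x \<in> C" "x \<in> D" "{u \<in> C. adjacent K x u} = {u \<in> D. adjacent K x u}"
  shows "C = D"
proof -
  have I: "C \<inter> D \<in> K" "x \<in> C \<inter> D" using Int_cube assms by auto
  have "{u \<in> C \<inter> D. adjacent K x u} = {u \<in> C. adjacent K x u}" using assms(5) by blast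
  then have "cube_dim K (C \<inter> D) = cube_dim K C" "cube_dim K (C \<inter> D) = cube_dim K D"
    using card_neighbours_in_cube assms I by metis+
  then have "card (C \<inter> D) = card C" "card (C \<inter> D) = card D" using card_cube assms I by metis+
  then have "C \<inter> D = C" "C \<inter> D = D"
    using card_subset_eq finite_cube assms(1,2) by (metis Int_lower1, metis Int_lower2)
  then show ?thesis by blast
qed

end

section \<open>The vertex identity\<close>

definition coeff_a :: "rat fps" where "coeff_a = - fps_X / (1 - fps_X\<^sup>2)"
definition coeff_b :: "rat fps" where "coeff_b = fps_X\<^sup>2 / (1 - fps_X\<^sup>2)"

lemma coeff_mult: "coeff_a * (1 - fps_X\<^sup>2) = - fps_X" "coeff_b * (1 - fps_X\<^sup>2) = fps_X\<^sup>2"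
proof -
  have u: "fps_nth (1 - fps_X\<^sup>2 :: rat fps) 0 \<noteq> 0" by (simp add: power2_eq_square)
  have "inverse (1 - fps_X\<^sup>2 :: rat fps) * (1 - fps_X\<^sup>2) = 1" by (rule inverse_mult_eq_1[OF u])
  then show "coeff_a * (1 - fps_X\<^sup>2) = - fps_X" "coeff_b * (1 - fps_X\<^sup>2) = fps_X\<^sup>2"
    unfolding coeff_a_def coeff_b_def fps_divide_unit[OF u] by (simp_all only: mult.assoc mult_1_right)
qed

lemma coeff_b_nth_0: "fps_nth coeff_b 0 = 0"
proof -
  have u: "fps_nth (1 - fps_X\<^sup>2 :: rat fps) 0 \<noteq> 0" by (simp add: power2_eq_square)
  show ?thesis unfolding coeff_b_def fps_divide_nth_0[OF u] by (simp add: power2_eq_square)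
qed

text \<open>In \<open>coeff_far\<close> the coordinate leads from \<open>x\<close> away from
  \<open>w\<close>: moving along it gives \<open>coeff_a\<close> and costs one step, staying gives
  \<open>coeff_b\<close>. In \<open>coeff_near\<close> it leads towards \<open>w\<close>, distances
  are counted from the nearer side, and it is staying that costs a step.\<close>

lemma coeff_far: "coeff_a * fps_X + coeff_b = 0"
  and coeff_near: "coeff_a + coeff_b * fps_X = - fps_X"
proof -
  have nz: "(1 - fps_X\<^sup>2 :: rat fps) \<noteq> 0"
    by (metis (no_types, lifting) coeff_mult(1) fps_X_neq_zero mult_zero_right neg_equal_0_iff_equal)
  have "(coeff_a * fps_X + coeff_b) * (1 - fps_X\<^sup>2) =
    (coeff_a * (1 - fps_X\<^sup>2)) * fps_X + coeff_b * (1 - fps_X\<^sup>2)" by (simp only: algebra_simps)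
  also have "\<dots> = 0" unfolding coeff_mult by (simp add: power2_eq_square)
  finally show "coeff_a * fps_X + coeff_b = 0" using nz by simp
  have "(coeff_a + coeff_b * fps_X) * (1 - fps_X\<^sup>2) =
    coeff_a * (1 - fps_X\<^sup>2) + (coeff_b * (1 - fps_X\<^sup>2)) * fps_X" by (simp only: algebra_simps)
  also have "\<dots> = - fps_X * (1 - fps_X\<^sup>2)" unfolding coeff_mult by (simp add: algebra_simps)
  finally show "coeff_a + coeff_b * fps_X = - fps_X" using nz mult_right_cancel by blast
qed

lemma prod_indicator_left:
  fixes c :: "'a::comm_monoid_mult"
  assumes "finite U"
  shows "(\<Prod>i\<in>U. if i \<in> P then 1 else c) = c ^ card (U - P)"
    and "(\<Prod>i\<in>U. if i \<in> P then c else 1) = c ^ card (U \<inter> P)"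
  using assms by (simp_all add: prod.If_cases Diff_eq)

lemma sum_Pow_signs:
  assumes "finite A"
  shows "(\<Sum>B\<in>Pow A. (- 1) ^ card B) = (if A = {} then 1 else 0 :: 'a::comm_ring_1)"
proof -
  have "(\<Sum>B\<in>Pow A. (- 1) ^ card B) = (\<Prod>x\<in>A. - 1 + 1 :: 'a)"
    unfolding prod_add[OF assms] by simp
  also have "\<dots> = (if A = {} then 1 else 0)" using assms by (simp add: power_0_left)
  finally show ?thesis .
qed

context cat0_cx
begin

lemma l1_dist_le: "(adjacent K ^^ n) u v \<Longrightarrow> d u v \<le> n"
  unfolding l1_dist_def by (rule Least_le)

text \<open>A cube containing both vertices meets \<open>C\<close> in a face, given by an interval
  that contains \<open>{}\<close> and \<open>U\<close> and hence all subsets of \<open>U\<close>. So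
  the face of the subsets of \<open>U\<close> is the least such cube, and the \<open>LEAST\<close>
  in \<open>min_cube\<close> is attained.\<close>

lemma min_cube_chart:
  assumes ch: "cube_chart K C n \<kappa>" and U: "U \<subseteq> {..<n}"
  shows "min_cube K (\<kappa> {}) (\<kappa> U) \<in> K" (is "?M \<in> K")
    and "cube_dim K (min_cube K (\<kappa> {}) (\<kappa> U)) = card U"
    and "Q \<in> K \<Longrightarrow> min_cube K (\<kappa> {}) (\<kappa> U) \<subseteq> Q \<longleftrightarrow> \<kappa> {} \<in> Q \<and> \<kappa> U \<in> Q"
proof -
  let ?F = "\<kappa> ` {V. {} \<subseteq> V \<and> V \<subseteq> U}"
  have F: "?F \<in> K" by (rule cube_chart_face[OF ch]) (use U in auto)
  have mem: "\<kappa> {} \<in> ?F" "\<kappa> U \<in> ?F" by auto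
  have least: "?F \<subseteq> Q" if Q: "Q \<in> K" "\<kappa> {} \<in> Q" "\<kappa> U \<in> Q" for Q
  proof -
    have C: "\<kappa> {} \<in> C" "\<kappa> U \<in> C" using cube_chart_image[OF ch] U by auto
    have "Q \<inter> C \<in> K" using Int_cube[OF Q(1) cube_chart_mem[OF ch] Q(2) C(1)] .
    then have "Q \<inter> C \<in> K \<and> Q \<inter> C \<subseteq> C" by blast
    from iffD1[OF cube_chart_face_iff[OF ch] this]
    obtain S T where ST: "Q \<inter> C = \<kappa> ` {V. S \<subseteq> V \<and> V \<subseteq> T}" "S \<subseteq> T" "T \<subseteq> {..<n}"
      by (elim exE conjE)
    have "V \<in> {V. S \<subseteq> V \<and> V \<subseteq> T}" if V: "\<kappa> V \<in> Q \<inter> C" "V \<subseteq> {..<n}" for V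
    proof -
      obtain W where W: "\<kappa> V = \<kappa> W" "S \<subseteq> W" "W \<subseteq> T" using V ST(1) by auto
      then have "V = W" using cube_chart_eq_iff[OF ch V(2), of W] ST(3) by auto
      then show ?thesis using W by simp
    qed
    from this[of "{}"] this[of U] have "S = {}" "U \<subseteq> T" using Q C U by auto
    then have "?F \<subseteq> Q \<inter> C" unfolding ST(1) by auto
    then show ?thesis by blast
  qed
  have M: "?M = ?F"
    unfolding min_cube_def by (rule Least_equality) (use F mem least in auto)
  show "?M \<in> K" using F M by simp
  show "Q \<in> K \<Longrightarrow> ?M \<subseteq> Q \<longleftrightarrow> \<kappa> {} \<in> Q \<and> \<kappa> U \<in> Q"
    unfolding M using mem least by blast
  have "?F = \<kappa> ` Pow U" by auto
  moreover have "inj_on \<kappa> (Pow U)" by (rule inj_on_subset[OF cube_chart_inj[OF ch]]) (use U in auto)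
  moreover have "finite U" using U finite_subset by blast
  ultimately have "card ?F = 2 ^ card U" by (simp add: card_image card_Pow)
  then have "(2::nat) ^ cube_dim K ?F = 2 ^ card U" using card_cube[OF F] by simp
  then show "cube_dim K ?M = card U" unfolding M by simp
qed

text \<open>The minimal cube has dimension \<open>d x z\<close>, and the cubes above it are those
  containing both vertices. Without a common cube both sides are 0, the sum being empty.\<close>

lemma vertex_coeff_eq:
  "vertex_coeff K x z =
    (\<Sum>Q | Q \<in> K \<and> x \<in> Q \<and> z \<in> Q. coeff_a ^ d x z * coeff_b ^ (cube_dim K Q - d x z))"
proof (cases "\<exists>C\<in>K. x \<in> C \<and> z \<in> C")
  case False
  then have e: "{Q. Q \<in> K \<and> x \<in> Q \<and> z \<in> Q} = {}" by blast
  have "f_poly K x z = 0" using False unfolding f_poly_def by (rule if_not_P)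
  then show ?thesis unfolding vertex_coeff_def e by simp
next
  case True
  then obtain C where C: "C \<in> K" "x \<in> C" "z \<in> C" by blast
  obtain n \<kappa> where ch: "cube_chart K C n \<kappa>" and x: "\<kappa> {} = x" using chart_at[OF C(1,2)] by metis
  obtain U where U: "U \<subseteq> {..<n}" "z = \<kappa> U" using C(3) cube_chart_image[OF ch] by auto
  note m = min_cube_chart[OF ch U(1), unfolded x U(2)[symmetric]]
  have dist: "d x z = card U" using l1_dist_in_cube[OF ch U(1)] x U by simp
  have set: "{Q. Q \<in> K \<and> min_cube K x z \<subseteq> Q} = {Q. Q \<in> K \<and> x \<in> Q \<and> z \<in> Q}"
    using m(3) by blast
  have "f_poly K x z = (\<Sum>Q | Q \<in> K \<and> x \<in> Q \<and> z \<in> Q. monom 1 (cube_dim K Q - d x z))"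
    using True unfolding f_poly_def set m(2) dist by simp
  then have "fps_of_poly (f_poly K x z) oo coeff_b =
      (\<Sum>Q | Q \<in> K \<and> x \<in> Q \<and> z \<in> Q. coeff_b ^ (cube_dim K Q - d x z))"
    by (simp add: fps_of_poly_sum fps_of_poly_monom' fps_compose_sum_distrib
        fps_compose_power[OF coeff_b_nth_0, symmetric] coeff_b_nth_0)
  then show ?thesis
    unfolding vertex_coeff_def coeff_a_def[symmetric] coeff_b_def[symmetric] by (simp add: sum_distrib_left)
qed

text \<open>
  The sum over the vertices of a cube factors over its coordinates, and the factor of a coordinate
  in which \<open>x\<close> agrees with the gate of \<open>w\<close> vanishes.
\<close>

lemma cube_sum:
  assumes w: "w \<in> \<Union>K" and Q: "Q \<in> K" "x \<in> Q"
  shows "(\<Sum>z\<in>Q. coeff_a ^ d x z * coeff_b ^ (cube_dim K Q - d x z) * fps_X ^ d w z) =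
    (if \<forall>u\<in>Q. adjacent K x u \<longrightarrow> d w u < d w x
     then (- 1) ^ card {u \<in> Q. adjacent K x u} * fps_X ^ d w x else 0)"
proof -
  obtain \<kappa> where ch0: "cube_chart K Q (cube_dim K Q) \<kappa>" and x: "\<kappa> {} = x" using chart_at[OF Q] by metis
  define n where "n = cube_dim K Q"
  note ch = ch0[folded n_def]
  define P where "P = {i. i < n \<and> d w (\<kappa> {i}) < d w (\<kappa> {})}"
  have P: "P \<subseteq> {..<n}" by (auto simp: P_def)
  then have finP: "finite P" using finite_subset by blast
  have dU: "int (d w (\<kappa> U)) = int (d w x) + int (card (U - P)) - int (card (U \<inter> P))" if "U \<subseteq> {..<n}" for U
    using l1_dist_cube[OF w ch that] unfolding P_def x by simp
  have dP: "d w x = d w (\<kappa> P) + card P" using dU[OF P] by simp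
  \<comment> \<open>Counted from the gate \<open>\<kappa> P\<close>, each coordinate in which
    \<open>U\<close> and \<open>P\<close> differ costs one step. This form is free of subtraction
    and splits over \<open>U\<close> and its complement.\<close>
  have dist: "d w (\<kappa> U) = d w (\<kappa> P) + card (U - P) + card (({..<n} - U) \<inter> P)" if U: "U \<subseteq> {..<n}" for U
  proof -
    have "({..<n} - U) \<inter> P = P - U \<inter> P" using P by auto
    then have "card (({..<n} - U) \<inter> P) = card P - card (U \<inter> P)"
      using card_Diff_subset[of "U \<inter> P" P] finP by auto
    moreover have "card (U \<inter> P) \<le> card P" by (rule card_mono) (use finP in auto)
    ultimately show ?thesis using dU[OF U] dP by simp
  qed
  let ?f = "\<lambda>i. coeff_a * (if i \<in> P then 1 else fps_X)"
  let ?g = "\<lambda>i. coeff_b * (if i \<in> P then fps_X else 1)"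
  have term_eq: "coeff_a ^ d x (\<kappa> U) * coeff_b ^ (n - d x (\<kappa> U)) * fps_X ^ d w (\<kappa> U) =
    fps_X ^ d w (\<kappa> P) * (prod ?f U * prod ?g ({..<n} - U))" if U: "U \<subseteq> {..<n}" for U
  proof -
    have fin: "finite U" using U finite_subset by blast
    have "card ({..<n} - U) = n - card U" using card_Diff_subset[OF fin U] by simp
    moreover have "d x (\<kappa> U) = card U" using l1_dist_in_cube[OF ch U] x by simp
    ultimately show ?thesis
      using fin by (simp add: dist[OF U] prod.distrib prod_indicator_left power_add mult_ac)
  qed
  have "(\<Sum>z\<in>Q. coeff_a ^ d x z * coeff_b ^ (n - d x z) * fps_X ^ d w z) =
      (\<Sum>U\<in>Pow {..<n}. coeff_a ^ d x (\<kappa> U) * coeff_b ^ (n - d x (\<kappa> U)) * fps_X ^ d w (\<kappa> U))"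
    unfolding cube_chart_image[OF ch] by (rule sum.reindex[OF cube_chart_inj[OF ch], unfolded comp_def])
  also have "\<dots> = (\<Sum>U\<in>Pow {..<n}. fps_X ^ d w (\<kappa> P) * (prod ?f U * prod ?g ({..<n} - U)))"
    by (rule sum.cong) (use term_eq in auto)
  also have "\<dots> = fps_X ^ d w (\<kappa> P) * (\<Prod>i<n. ?f i + ?g i)"
    unfolding prod_add[OF finite_lessThan] sum_distrib_left by simp
  also have "(\<Prod>i<n. ?f i + ?g i) = (\<Prod>i<n. if i \<in> P then - fps_X else 0)"
    by (rule prod.cong) (auto simp: coeff_far coeff_near)
  also have "fps_X ^ d w (\<kappa> P) * \<dots> = (if P = {..<n} then (- 1) ^ n * fps_X ^ d w x else 0)"
  proof (cases "P = {..<n}")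
    case True
    have "(- fps_X :: rat fps) ^ n = (- 1) ^ n * fps_X ^ n" by (rule power_minus)
    then show ?thesis using True dP by (simp add: power_add mult_ac)
  next
    case False
    then obtain i where "i < n" "i \<notin> P" using P by auto
    then have "(\<Prod>i<n. if i \<in> P then - fps_X else 0 :: rat fps) = 0"
      by (intro prod_zero) auto
    then show ?thesis using False by simp
  qed
  also have "P = {..<n} \<longleftrightarrow> (\<forall>u\<in>Q. adjacent K x u \<longrightarrow> d w u < d w x)"
  proof -
    have "(\<forall>u\<in>Q. adjacent K x u \<longrightarrow> d w u < d w x) \<longleftrightarrow> (\<forall>u\<in>{u \<in> Q. adjacent K x u}. d w u < d w x)"
      by blast
    also have "\<dots> \<longleftrightarrow> (\<forall>i<n. d w (\<kappa> {i}) < d w x)"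
      using neighbours_in_cube[OF ch] x by auto
    finally show ?thesis unfolding P_def x by auto
  qed
  also have "n = card {u \<in> Q. adjacent K x u}" using card_neighbours_in_cube[OF Q] n_def by simp
  finally show ?thesis using card_neighbours_in_cube[OF Q] by (simp add: n_def)
qed

end

section \<open>The alternating sum over the cubes at a vertex\<close>

locale locally_finite_cat0 = cat0_cx +
  assumes locally_finite: "locally_finite_complex K"
begin

lemma finite_cubes_at: "x \<in> \<Union>K \<Longrightarrow> finite {Q \<in> K. x \<in> Q}"
  using locally_finite unfolding locally_finite_complex_def by blast

lemma finite_star: "x \<in> \<Union>K \<Longrightarrow> finite (\<Union>{Q \<in> K. x \<in> Q})"
  using finite_cubes_at finite_cube by blast

lemma finite_neighbours: "x \<in> \<Union>K \<Longrightarrow> finite {u. adjacent K x u}"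
  by (rule finite_subset[OF _ finite_star]) (auto simp: adjacent_def)

text \<open>A cube at \<open>x\<close> is determined by its neighbours of \<open>x\<close>.
  Conversely, any two nearer neighbours lie in a square with \<open>x\<close> by the quadrangle
  condition, so flagness fills every set of them by a cube.\<close>

lemma descending_cubes:
  assumes w: "w \<in> \<Union>K" and x: "x \<in> \<Union>K"
  defines "A \<equiv> {u. adjacent K x u \<and> d w u < d w x}"
  shows "bij_betw (\<lambda>Q. {u \<in> Q. adjacent K x u})
    {Q \<in> K. x \<in> Q \<and> (\<forall>u\<in>Q. adjacent K x u \<longrightarrow> d w u < d w x)} (Pow A)"
proof (rule bij_betw_imageI)
  show "inj_on (\<lambda>Q. {u \<in> Q. adjacent K x u}) {Q \<in> K. x \<in> Q \<and> (\<forall>u\<in>Q. adjacent K x u \<longrightarrow> d w u < d w x)}"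
    by (rule inj_onI) (use cube_eqI_neighbours in blast)
  have fin: "finite A" unfolding A_def by (rule finite_subset[OF _ finite_neighbours[OF x]]) auto
  have "\<exists>Q. Q \<in> K \<and> x \<in> Q \<and> {u \<in> Q. adjacent K x u} = B" if B: "B \<subseteq> A" for B
  proof -
    have finB: "finite B" using B fin finite_subset by blast
    have adj: "adjacent K x a" "d w x = Suc (d w a)" if "a \<in> B" for a
      using that B l1_dist_adjacent[OF w, of x a] by (auto simp: A_def)
    have "\<exists>c. square K x a c b" if ab: "a \<in> B" "b \<in> B" "a \<noteq> b" for a b
    proof -
      obtain z where "square K z a x b"
        using l1_dist_quadrangle[OF w adj(1)[OF ab(1)] adj(1)[OF ab(2)] ab(3) adj(2)[OF ab(1)] adj(2)[OF ab(2)]] .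
      then have "square K x b z a" by (rule square_rotate[OF square_rotate])
      from square_flip[OF this] show ?thesis ..
    qed
    then show ?thesis using neighbours_span_cube[OF finB x adj(1)] by metis
  qed
  note ex = this
  show "(\<lambda>Q. {u \<in> Q. adjacent K x u}) ` {Q \<in> K. x \<in> Q \<and> (\<forall>u\<in>Q. adjacent K x u \<longrightarrow> d w u < d w x)} = Pow A"
    (is "?f ` ?L = _")
  proof (intro equalityI subsetI)
    fix B assume "B \<in> Pow A"
    then have B: "B \<subseteq> A" by simp
    from ex[OF this] obtain Q where Q: "Q \<in> K" "x \<in> Q" "?f Q = B" by (elim exE conjE)
    have "d w u < d w x" if "u \<in> Q" "adjacent K x u" for u
    proof -
      have "u \<in> ?f Q" using that by simp
      then show ?thesis using B unfolding Q(3) A_def by auto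
    qed
    then have "Q \<in> ?L" using Q by simp
    then have "?f Q \<in> ?f ` ?L" by (rule imageI)
    then show "B \<in> ?f ` ?L" unfolding Q(3) .
  qed (auto simp: A_def)
qed

theorem vertex_identity:
  assumes x: "x \<in> \<Union>K" and w: "w \<in> \<Union>K"
  shows "(\<Sum>z\<in>\<Union>{Q \<in> K. x \<in> Q}. vertex_coeff K x z * fps_X ^ d z w) = (if x = w then 1 else 0)"
proof -
  let ?S = "\<Union>{Q \<in> K. x \<in> Q}" and ?C = "{Q \<in> K. x \<in> Q}"
  let ?t = "\<lambda>Q z. coeff_a ^ d x z * coeff_b ^ (cube_dim K Q - d x z) * fps_X ^ d w z"
  let ?D = "\<lambda>Q. \<forall>u\<in>Q. adjacent K x u \<longrightarrow> d w u < d w x"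
  let ?N = "\<lambda>Q. {u \<in> Q. adjacent K x u}"
  define A where "A = {u. adjacent K x u \<and> d w u < d w x}"
  have finA: "finite A" unfolding A_def by (rule finite_subset[OF _ finite_neighbours[OF x]]) auto
  have "(\<Sum>z\<in>?S. vertex_coeff K x z * fps_X ^ d z w) = (\<Sum>z\<in>?S. \<Sum>Q\<in>{Q. Q \<in> ?C \<and> z \<in> Q}. ?t Q z)"
    unfolding vertex_coeff_eq sum_distrib_right l1_dist_sym[of _ w] by (simp add: conj_assoc)
  also have "\<dots> = (\<Sum>Q\<in>?C. \<Sum>z\<in>{z. z \<in> ?S \<and> z \<in> Q}. ?t Q z)"
    by (rule sum.swap_restrict) (use finite_star finite_cubes_at x in auto)
  also have "\<dots> = (\<Sum>Q\<in>?C. \<Sum>z\<in>Q. ?t Q z)"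
    by (rule sum.cong[OF refl], rule sum.cong) auto
  also have "\<dots> = (\<Sum>Q\<in>?C. if ?D Q then (- 1) ^ card (?N Q) * fps_X ^ d w x else 0)"
    by (rule sum.cong[OF refl]) (use cube_sum[OF w] in auto)
  also have "\<dots> = (\<Sum>Q\<in>{Q \<in> K. x \<in> Q \<and> ?D Q}. (- 1) ^ card (?N Q) * fps_X ^ d w x)"
    using finite_cubes_at[OF x] by (intro sum.mono_neutral_cong_right) auto
  also have "\<dots> = (\<Sum>B\<in>Pow A. (- 1) ^ card B * fps_X ^ d w x)"
    unfolding A_def by (rule sum.reindex_bij_betw[OF descending_cubes[OF w x]])
  also have "\<dots> = (if A = {} then 1 else 0) * fps_X ^ d w x"
    using sum_Pow_signs[OF finA, where 'a = "rat fps"] by (simp add: sum_distrib_right[symmetric])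
  also have "\<dots> = (if x = w then 1 else 0)"
  proof (cases "x = w")
    case True
    then show ?thesis by (simp add: l1_dist_self A_def)
  next
    case False
    then have "d w x \<noteq> 0" using l1_dist_eq_0_iff w x by metis
    then obtain m where m: "d w x = Suc m" by (cases "d w x") auto
    \<comment> \<open>The last step of a shortest path from \<open>w\<close> to \<open>x\<close>
      starts at a nearer neighbour of \<open>x\<close>, so \<open>A\<close> is nonempty and the
      signs cancel.\<close>
    then obtain u where u: "(adjacent K ^^ m) w u" "adjacent K u x"
      using l1_dist_path[OF w x] by (auto elim: relpowp_Suc_E)
    have "d w u \<le> m" by (rule l1_dist_le[OF u(1)])
    then have "u \<in> A" using m u(2) by (simp add: A_def adjacent_sym)
    then show ?thesis using False by auto
  qed
  finally show ?thesis .
qed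

text \<open>Local finiteness propagates from each ball to the next larger one. This allows sums over
  an infinite set of vertices to be cut off in each degree.\<close>

lemma finite_ball: "x \<in> \<Union>K \<Longrightarrow> finite {v \<in> \<Union>K. d x v \<le> n}"
proof (induction n)
  case 0
  have "{v \<in> \<Union>K. d x v \<le> 0} \<subseteq> {x}" using l1_dist_eq_0_iff[OF 0] by auto
  then show ?case by (rule finite_subset) simp
next
  case (Suc n)
  let ?B = "{v \<in> \<Union>K. d x v \<le> n}"
  have "{v \<in> \<Union>K. d x v \<le> Suc n} \<subseteq> ?B \<union> (\<Union>u\<in>?B. {v. adjacent K u v})"
  proof
    fix v assume v: "v \<in> {v \<in> \<Union>K. d x v \<le> Suc n}"
    show "v \<in> ?B \<union> (\<Union>u\<in>?B. {v. adjacent K u v})"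
    proof (cases "d x v = Suc n")
      case True
      then obtain u where u: "(adjacent K ^^ n) x u" "adjacent K u v"
        using l1_dist_path[OF Suc.prems, of v] v by (auto elim: relpowp_Suc_E)
      have "d x u \<le> n" by (rule l1_dist_le[OF u(1)])
      then show ?thesis using u adjacent_vertices[OF u(2)] by blast
    next
      case False
      then show ?thesis using v by auto
    qed
  qed
  moreover have "finite (?B \<union> (\<Union>u\<in>?B. {v. adjacent K u v}))"
    using Suc finite_neighbours by auto
  ultimately show ?case by (rule finite_subset)
qed

end

section \<open>Orbits\<close>

text \<open>From \<open>B A = 1\<close> follows \<open>det B * det A = 1\<close>, so
  \<open>det B\<close> times the adjugate of \<open>A\<close> is a right inverse of
  \<open>A\<close>. A left and a right inverse coincide. The argument takes place in a commutative
  ring, as is needed for power series.\<close>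

lemma left_inverse_imp_inverse_matrices:
  fixes A B :: "'i \<Rightarrow> 'i \<Rightarrow> 'a::comm_ring_1"
  assumes fin: "finite I"
    and BA: "\<And>i j. i \<in> I \<Longrightarrow> j \<in> I \<Longrightarrow> (\<Sum>k\<in>I. B i k * A k j) = (if i = j then 1 else 0)"
  shows "inverse_matrices I A B"
proof -
  define n where "n = card I"
  obtain f where f: "bij_betw f {0..<n} I" using ex_bij_betw_nat_finite[OF fin] n_def by blast
  have fI: "f i \<in> I" if "i < n" for i using f that by (auto simp: bij_betw_def)
  have feq: "f i = f j \<longleftrightarrow> i = j" if "i < n" "j < n" for i j
    using f that by (auto simp: bij_betw_def inj_on_def)
  let ?mat = "\<lambda>M. mat n n (\<lambda>(i, j). M (f i) (f j))"
  have entry: "(?mat M * ?mat N) $$ (i, j) = (\<Sum>k\<in>I. M (f i) k * N k (f j))" if "i < n" "j < n" for M N i j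
  proof -
    have "(?mat M * ?mat N) $$ (i, j) = (\<Sum>k = 0..<n. M (f i) (f k) * N (f k) (f j))"
      using that by (simp add: scalar_prod_def)
    also have "\<dots> = (\<Sum>k\<in>I. M (f i) k * N k (f j))"
      by (rule sum.reindex_bij_betw[OF f])
    finally show ?thesis .
  qed
  have car: "?mat A \<in> carrier_mat n n" "?mat B \<in> carrier_mat n n" by auto
  have one: "?mat B * ?mat A = 1\<^sub>m n"
    by (rule eq_matI) (use entry[of _ _ B A] BA fI feq in auto)
  define R where "R = det (?mat B) \<cdot>\<^sub>m adj_mat (?mat A)"
  note adj = adj_mat[OF car(1)]
  have R: "R \<in> carrier_mat n n" using adj(1) by (simp add: R_def)
  have "det (?mat B) * det (?mat A) = 1" using det_mult[OF car(2,1)] one by simp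
  then have dets: "det (?mat B) * (det (?mat A) * a) = a" for a by (simp add: mult.assoc[symmetric])
  have "?mat A * R = det (?mat B) \<cdot>\<^sub>m (det (?mat A) \<cdot>\<^sub>m 1\<^sub>m n)"
    unfolding R_def mult_smult_distrib[OF car(1) adj(1)] adj(2) ..
  also have "\<dots> = 1\<^sub>m n" by (rule eq_matI) (auto simp: dets)
  finally have AR: "?mat A * R = 1\<^sub>m n" .
  have "?mat B = ?mat B * (?mat A * R)" using AR car by simp
  also have "\<dots> = (?mat B * ?mat A) * R" using assoc_mult_mat[OF car(2,1) R] by simp
  also have "\<dots> = R" using one R by simp
  finally have AB: "?mat A * ?mat B = 1\<^sub>m n" using AR by simp
  have "(\<Sum>k\<in>I. A i k * B k j) = (if i = j then 1 else 0)" if "i \<in> I" "j \<in> I" for i j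
  proof -
    have "i \<in> f ` {0..<n}" "j \<in> f ` {0..<n}" using that bij_betw_imp_surj_on[OF f] by simp_all
    then obtain i' j' where "i = f i'" "i' \<in> {0..<n}" "j = f j'" "j' \<in> {0..<n}" by (elim imageE)
    then show ?thesis using entry[of i' j' A B] AB feq[of i' j'] by auto
  qed
  then show ?thesis using fin BA by (simp add: inverse_matrices_def)
qed

context locally_finite_cat0
begin

text \<open>
  Only finitely many \<open>w \<in> c\<close> contribute to the coefficient of degree \<open>n\<close>, so that the vertex
  identity can be summed over \<open>w \<in> c\<close>.
\<close>

lemma growth_series_identity:
  assumes x: "x \<in> \<Union>K" and c: "c \<subseteq> \<Union>K"
  shows "(\<Sum>z\<in>\<Union>{Q \<in> K. x \<in> Q}. vertex_coeff K x z * growth_series K z c) = (if x \<in> c then 1 else 0)"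
    (is "?L = ?R")
proof (rule fps_ext)
  fix n
  let ?S = "\<Union>{Q \<in> K. x \<in> Q}"
  \<comment> \<open>These vertices account for all terms up to degree \<open>n\<close>; adding
    \<open>{x} \<inter> c\<close> makes \<open>x \<in> W\<close> equivalent to
    \<open>x \<in> c\<close> at the end.\<close>
  define W where "W = (\<Union>z\<in>?S. {w \<in> c. d z w \<le> n}) \<union> ({x} \<inter> c)"
  have S: "finite ?S" "?S \<subseteq> \<Union>K" using finite_star[OF x] by auto
  have "finite {w \<in> c. d z w \<le> n}" if "z \<in> ?S" for z
    by (rule finite_subset[OF _ finite_ball[of z n]]) (use c S that in auto)
  then have "finite (\<Union>z\<in>?S. {w \<in> c. d z w \<le> n})" by (rule finite_UN_I[OF S(1)])
  then have W: "finite W" "W \<subseteq> c" unfolding W_def by auto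
  have nth: "fps_nth (growth_series K z c) m = fps_nth (\<Sum>w\<in>W. fps_X ^ d z w) m" if "z \<in> ?S" "m \<le> n" for z m
  proof -
    have "w \<in> W" if "w \<in> c" "d z w = m" for w
      using that \<open>z \<in> ?S\<close> \<open>m \<le> n\<close> unfolding W_def by blast
    then have "{w \<in> c. d z w = m} = {w \<in> W. d z w = m}" using W(2) by blast
    moreover have "fps_nth (\<Sum>w\<in>W. fps_X ^ d z w :: rat fps) m = of_nat (card {w \<in> W. d z w = m})"
      using W(1) by (simp add: fps_sum_nth fps_X_power_iff sum.If_cases Int_def eq_commute)
    ultimately show ?thesis by (simp add: growth_series_def)
  qed
  have "fps_nth (vertex_coeff K x z * growth_series K z c) n =
      fps_nth (vertex_coeff K x z * (\<Sum>w\<in>W. fps_X ^ d z w)) n" if "z \<in> ?S" for z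
    unfolding fps_mult_nth by (rule sum.cong[OF refl]) (simp only: nth[OF that diff_le_self])
  then have "fps_nth ?L n = fps_nth (\<Sum>z\<in>?S. vertex_coeff K x z * (\<Sum>w\<in>W. fps_X ^ d z w)) n"
    unfolding fps_sum_nth by (rule sum.cong[OF refl])
  also have "(\<Sum>z\<in>?S. vertex_coeff K x z * (\<Sum>w\<in>W. fps_X ^ d z w)) =
      (\<Sum>w\<in>W. \<Sum>z\<in>?S. vertex_coeff K x z * fps_X ^ d z w)"
    unfolding sum_distrib_left by (rule sum.swap)
  also have "\<dots> = (\<Sum>w\<in>W. if x = w then 1 else 0)"
  proof (rule sum.cong[OF refl])
    fix w assume "w \<in> W"
    then have "w \<in> \<Union>K" using W(2) c by blast
    then show "(\<Sum>z\<in>?S. vertex_coeff K x z * fps_X ^ d z w) = (if x = w then 1 else 0)"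
      by (rule vertex_identity[OF x])
  qed
  also have "\<dots> = (if x \<in> W then 1 else 0)" using W(1) by simp
  also have "x \<in> W \<longleftrightarrow> x \<in> c" using W(2) by (auto simp: W_def)
  finally show "fps_nth ?L n = fps_nth ?R n" .
qed

end

section \<open>Vertex orbits of a cocompact action with embedded stars\<close>

locale cubical_action = locally_finite_cat0 K for K :: "'v set set" +
  fixes G :: "('g, 'm) monoid_scheme" and \<phi> :: "'g \<Rightarrow> 'v \<Rightarrow> 'v"
  assumes cellular: "cellular_action G \<phi> K"
    and cocompact: "cocompact G \<phi> K"
    and embedded: "stars_embedded G \<phi> K"
begin

sublocale group_action G "\<Union>K" \<phi>
  using cellular by (simp add: cellular_action_def)

abbreviation orb :: "'v \<Rightarrow> 'v set" where
  "orb \<equiv> orbit G \<phi>"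

lemma act_vertex: "g \<in> carrier G \<Longrightarrow> v \<in> \<Union>K \<Longrightarrow> \<phi> g v \<in> \<Union>K"
  using element_image by blast

lemma act_inv: "g \<in> carrier G \<Longrightarrow> v \<in> \<Union>K \<Longrightarrow> \<phi> (inv\<^bsub>G\<^esub> g) (\<phi> g v) = v"
  using orbit_sym_aux by blast

lemma group_G: "group G"
  by (rule group_hom.axioms(1)[OF group_hom])

lemma inv_carrier: "g \<in> carrier G \<Longrightarrow> inv\<^bsub>G\<^esub> g \<in> carrier G"
  by (rule group.inv_closed[OF group_G])

lemma act_inv': "g \<in> carrier G \<Longrightarrow> v \<in> \<Union>K \<Longrightarrow> \<phi> g (\<phi> (inv\<^bsub>G\<^esub> g) v) = v"
  using act_inv[OF inv_carrier, of g v] group.inv_inv[OF group_G, of g] by simp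

lemma act_adjacent:
  assumes "g \<in> carrier G" "adjacent K u v"
  shows "adjacent K (\<phi> g u) (\<phi> g v)"
proof -
  have uv: "u \<in> \<Union>K" "v \<in> \<Union>K" "u \<noteq> v" "{u, v} \<in> K"
    using adjacent_vertices[OF assms(2)] assms(2) by (auto simp: adjacent_def)
  have "\<phi> g ` {u, v} \<in> K" using cellular assms(1) uv(4) unfolding cellular_action_def by blast
  moreover have "\<phi> g u \<noteq> \<phi> g v" using inj_on_eq_iff[OF inj_prop[OF assms(1)] uv(1,2)] uv(3) by simp
  ultimately show ?thesis by (simp add: adjacent_def)
qed

lemma act_l1_dist_le:
  assumes g: "g \<in> carrier G" and uv: "u \<in> \<Union>K" "v \<in> \<Union>K"
  shows "d (\<phi> g u) (\<phi> g v) \<le> d u v"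
proof -
  have "(adjacent K ^^ n) (\<phi> g u) (\<phi> g v)" if "(adjacent K ^^ n) u v" for n v
    using that
  proof (induction n arbitrary: v)
    case (Suc n)
    then obtain w where "(adjacent K ^^ n) u w" "adjacent K w v" by (elim relpowp_Suc_E)
    then show ?case using Suc.IH act_adjacent[OF g] relpowp_Suc_I by metis
  qed simp
  then show ?thesis using l1_dist_le l1_dist_path[OF uv] by blast
qed

lemma act_l1_dist:
  assumes g: "g \<in> carrier G" and uv: "u \<in> \<Union>K" "v \<in> \<Union>K"
  shows "d (\<phi> g u) (\<phi> g v) = d u v"
  using act_l1_dist_le[OF g uv]
    act_l1_dist_le[OF inv_carrier[OF g] act_vertex[OF g uv(1)] act_vertex[OF g uv(2)]] act_inv[OF g] uv
  by simp

lemma orb_subset: "x \<in> \<Union>K \<Longrightarrow> orb x \<subseteq> \<Union>K"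
  using act_vertex by (auto simp: orbit_def)

lemma orb_eq:
  assumes x: "x \<in> \<Union>K" and y: "y \<in> orb x"
  shows "orb y = orb x"
proof -
  have yK: "y \<in> \<Union>K" using orb_subset[OF x] y by (rule subsetD)
  have sub: "orb u \<subseteq> orb v" if "v \<in> \<Union>K" "u \<in> \<Union>K" "u \<in> orb v" for u v
    using orbit_trans[OF that(1,2) _ that(3)] orb_subset[OF that(2)] by (meson subsetD subsetI)
  show ?thesis using sub[OF x yK y] sub[OF yK x orbit_sym[OF x yK y]] by (rule equalityI)
qed

lemma orbits_mem:
  assumes "a \<in> vertex_orbits G \<phi> K" "x \<in> a"
  shows "a = orb x" "x \<in> \<Union>K"
proof -
  obtain y where y: "y \<in> \<Union>K" "a = orb y" using assms(1) unfolding orbits_def by blast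
  then show "a = orb x" using orb_eq assms(2) by simp
  show "x \<in> \<Union>K" using orb_subset[OF y(1)] y(2) assms(2) by blast
qed

lemma lift_mem:
  assumes "a \<in> vertex_orbits G \<phi> K" shows "lift a \<in> a"
proof -
  obtain x where "x \<in> \<Union>K" "a = orb x" using assms unfolding orbits_def by blast
  then have "x \<in> a" using orbit_refl by blast
  then show ?thesis unfolding lift_def by (rule someI)
qed

lemma act_orbit:
  assumes "g \<in> carrier G" "a \<in> vertex_orbits G \<phi> K" "z \<in> a"
  shows "\<phi> g z \<in> a"
proof -
  have "\<phi> g z \<in> orb z" using assms(1) by (auto simp: orbit_def)
  then show ?thesis using orbits_mem(1)[OF assms(2,3)] by simp
qed

text \<open>The isometry \<open>\<phi> g\<close> and its inverse match the vertices of
  \<open>c\<close> at distance \<open>n\<close> from \<open>x\<close> with those at distance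
  \<open>n\<close> from \<open>\<phi> g x\<close>. Hence the choice of lift in
  \<open>orbit_growth\<close> is immaterial.\<close>

lemma growth_series_act:
  assumes g: "g \<in> carrier G" and x: "x \<in> \<Union>K" and c: "c \<in> vertex_orbits G \<phi> K"
  shows "growth_series K (\<phi> g x) c = growth_series K x c"
proof -
  have "card {z \<in> c. d (\<phi> g x) z = n} = card {z \<in> c. d x z = n}" for n
  proof (rule bij_betw_same_card[of "\<phi> (inv\<^bsub>G\<^esub> g)"])
    have cK: "z \<in> \<Union>K" if "z \<in> c" for z using orbits_mem(2)[OF c that] .
    show "bij_betw (\<phi> (inv\<^bsub>G\<^esub> g)) {z \<in> c. d (\<phi> g x) z = n} {z \<in> c. d x z = n}"
    proof (rule bij_betw_byWitness[where f' = "\<phi> g"])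
      show "\<forall>z\<in>{z \<in> c. d (\<phi> g x) z = n}. \<phi> g (\<phi> (inv\<^bsub>G\<^esub> g) z) = z" using act_inv'[OF g] cK by simp
      show "\<forall>z\<in>{z \<in> c. d x z = n}. \<phi> (inv\<^bsub>G\<^esub> g) (\<phi> g z) = z" using act_inv[OF g] cK by simp
      show "\<phi> g ` {z \<in> c. d x z = n} \<subseteq> {z \<in> c. d (\<phi> g x) z = n}"
        using act_orbit[OF g c] act_l1_dist[OF g x] cK by auto
      have "d x (\<phi> (inv\<^bsub>G\<^esub> g) z) = d (\<phi> g x) z" if "z \<in> c" for z
        using act_l1_dist[OF g x act_vertex[OF inv_carrier[OF g] cK[OF that]]] act_inv'[OF g cK[OF that]] by simp
      then show "\<phi> (inv\<^bsub>G\<^esub> g) ` {z \<in> c. d (\<phi> g x) z = n} \<subseteq> {z \<in> c. d x z = n}"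
        using act_orbit[OF inv_carrier[OF g] c] by auto
    qed
  qed
  then show ?thesis by (simp add: growth_series_def)
qed

lemma point_action_vertex_point:
  assumes g: "g \<in> carrier G" and y: "y \<in> \<Union>K"
  shows "point_action G \<phi> K g (vertex_point y) = vertex_point (\<phi> g y)"
proof
  fix v
  have "\<phi> (inv\<^bsub>G\<^esub> g) v = y \<longleftrightarrow> v = \<phi> g y" if "v \<in> \<Union>K"
    using act_inv[OF g y] act_inv'[OF g that] by metis
  then show "point_action G \<phi> K g (vertex_point y) v = vertex_point (\<phi> g y) v"
    using act_vertex[OF g y] by (auto simp: point_action_def vertex_point_def)
qed

lemma quotient_proj_vertex_point:
  assumes "y \<in> \<Union>K"
  shows "quotient_proj G \<phi> K (vertex_point y) = vertex_point ` orb y"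
proof -
  have "quotient_proj G \<phi> K (vertex_point y) = (\<lambda>g. point_action G \<phi> K g (vertex_point y)) ` carrier G"
    by (simp add: quotient_proj_def orbit_def Setcompr_eq_image)
  also have "\<dots> = (\<lambda>g. vertex_point (\<phi> g y)) ` carrier G"
    by (rule image_cong[OF refl]) (rule point_action_vertex_point[OF _ assms])
  also have "\<dots> = vertex_point ` orb y"
    by (simp add: orbit_def Setcompr_eq_image image_image)
  finally show ?thesis .
qed

text \<open>Embeddedness speaks of points of the realization. Applied to vertex points it gives the
  uniqueness of lifts in a star on which the \<open>THE\<close> in \<open>orbit_coeff\<close>
  relies.\<close>

lemma star_orbit_unique:
  assumes x: "x \<in> \<Union>K" and y: "y \<in> \<Union>{Q \<in> K. x \<in> Q}" "y' \<in> \<Union>{Q \<in> K. x \<in> Q}" "orb y = orb y'"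
  shows "y = y'"
proof -
  have star: "vertex_point z \<in> closed_star K x" if z: "z \<in> \<Union>{Q \<in> K. x \<in> Q}" for z
  proof -
    obtain Q where Q: "Q \<in> {Q \<in> K. x \<in> Q}" "z \<in> Q" using z by (rule UnionE)
    then have "vertex_point z \<in> cell K Q" using vertex_point_cell by simp
    then show ?thesis unfolding closed_star_def by (rule UN_I[OF Q(1)])
  qed
  have "y \<in> \<Union>K" "y' \<in> \<Union>K" using y by auto
  then have "quotient_proj G \<phi> K (vertex_point y) = quotient_proj G \<phi> K (vertex_point y')"
    using quotient_proj_vertex_point y(3) by simp
  then have "vertex_point y = vertex_point y'"
    by (rule inj_onD[OF bspec[OF embedded[unfolded stars_embedded_def] x] _ star[OF y(1)] star[OF y(2)]])
  then have "supp (vertex_point y) = supp (vertex_point y')" by simp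
  then show ?thesis by (simp add: supp_vertex_point)
qed

text \<open>The sum has at most one term. In this form the coefficients for all orbits
  \<open>b\<close> together run over the star of \<open>lift a\<close>, so that sums over orbits can
  be regrouped.\<close>

lemma orbit_coeff_eq:
  assumes a: "a \<in> vertex_orbits G \<phi> K" and b: "b \<in> vertex_orbits G \<phi> K"
  shows "orbit_coeff K a b = (\<Sum>z | z \<in> \<Union>{Q \<in> K. lift a \<in> Q} \<and> orb z = b. vertex_coeff K (lift a) z)"
proof -
  define x where "x = lift a"
  let ?S = "\<Union>{Q \<in> K. x \<in> Q}"
  have x: "x \<in> \<Union>K" using orbits_mem(2)[OF a lift_mem[OF a]] by (simp add: x_def)
  have orb_b: "orb z = b \<longleftrightarrow> z \<in> b" if "z \<in> ?S" for z
    using orbits_mem(1)[OF b] orbit_refl[of z] that by blast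
  show ?thesis
  proof (cases "\<exists>y. y \<in> b \<inter> ?S")
    case True
    then obtain y where y: "y \<in> b" "y \<in> ?S" by blast
    have uniq: "z = y" if "z \<in> b" "z \<in> ?S" for z
    proof -
      have "orb z = b" "orb y = b" using orb_b[OF that(2)] orb_b[OF y(2)] that(1) y(1) by blast+
      then have "orb z = orb y" by simp
      then show ?thesis by (rule star_orbit_unique[OF x that(2) y(2)])
    qed
    have "(THE y. y \<in> b \<inter> ?S) = y"
    proof (rule the_equality)
      show "y \<in> b \<inter> ?S" using y by (rule IntI)
      show "z = y" if "z \<in> b \<inter> ?S" for z using that by (elim IntE) (rule uniq)
    qed
    moreover have "{z. z \<in> ?S \<and> orb z = b} = {y}" using y uniq orb_b by blast
    ultimately show ?thesis using True unfolding orbit_coeff_def Let_def x_def[symmetric] by simp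
  next
    case False
    then have e: "{z. z \<in> ?S \<and> orb z = b} = {}" using orb_b by blast
    have "orbit_coeff K a b = 0"
      using False unfolding orbit_coeff_def Let_def x_def[symmetric] by (rule if_not_P)
    then show ?thesis unfolding x_def[symmetric] e by simp
  qed
qed

text \<open>The set \<open>U v\<close> of points whose support meets the orbit of \<open>v\<close>
  is open and saturated, and these sets cover the realization. A vertex point is supported at a
  single vertex and thus lies only in the set of its own orbit, so a finite subcover of the compact
  quotient lists all orbits.\<close>

lemma finite_vertex_orbits: "finite (vertex_orbits G \<phi> K)"
proof -
  let ?X = "realization K" and ?q = "quotient_proj G \<phi> K"
  obtain Y where Y: "quotient_map (top_of_set ?X) Y ?q" "compact_space Y"
    using cocompact unfolding cocompact_def by blast
  have top: "?q ` ?X = topspace Y" using quotient_imp_surjective_map[OF Y(1)] by simp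
  define U where "U v = {w \<in> ?X. \<exists>u\<in>orb v. w u \<noteq> 0}" for v
  have self: "w \<in> ?q w" if "w \<in> ?X" for w
  proof -
    have one: "\<one>\<^bsub>G\<^esub> \<in> carrier G" "inv\<^bsub>G\<^esub> \<one>\<^bsub>G\<^esub> = \<one>\<^bsub>G\<^esub>"
      by (rule monoid.one_closed[OF group.is_monoid[OF group_G]] monoid.inv_one[OF group.is_monoid[OF group_G]])+
    have "\<phi> \<one>\<^bsub>G\<^esub> v = v" if "v \<in> \<Union>K" for v using id_eq_one that by (metis restrict_apply')
    moreover have "supp w \<subseteq> \<Union>K" using supp_cube[OF that] by blast
    ultimately have "point_action G \<phi> K \<one>\<^bsub>G\<^esub> w = w"
      unfolding point_action_def one(2) by (auto simp: supp_def fun_eq_iff)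
    then show ?thesis unfolding quotient_proj_def orbit_def mem_Collect_eq using one(1) by metis
  qed
  have saturated: "w \<in> U v" if w: "w \<in> ?X" and w': "w' \<in> U v" "?q w = ?q w'" and v: "v \<in> \<Union>K" for w w' v
  proof -
    have "w' \<in> ?q w" using self w' by (simp add: U_def)
    then obtain g where g: "g \<in> carrier G" "w' = point_action G \<phi> K g w"
      unfolding quotient_proj_def orbit_def by blast
    obtain u where u: "u \<in> orb v" "w' u \<noteq> 0" using w' by (auto simp: U_def)
    then have "u \<in> \<Union>K" using orb_subset[OF v] by blast
    then have "w (\<phi> (inv\<^bsub>G\<^esub> g) u) \<noteq> 0" using u(2) g(2) by (simp add: point_action_def)
    moreover have "orb v \<in> vertex_orbits G \<phi> K" using v by (auto simp: orbits_def)
    then have "\<phi> (inv\<^bsub>G\<^esub> g) u \<in> orb v" using act_orbit[OF inv_carrier[OF g(1)]] u(1) by blast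
    ultimately show ?thesis using w by (auto simp: U_def)
  qed
  have openU: "openin Y (?q ` U v)" if v: "v \<in> \<Union>K" for v
  proof -
    have "open {w :: 'v \<Rightarrow> real. w u \<noteq> 0}" for u
      by (intro open_Collect_neq continuous_on_product_then_coordinatewise[OF continuous_on_id] continuous_on_const)
    then have "open (\<Union>u\<in>orb v. {w :: 'v \<Rightarrow> real. w u \<noteq> 0})" by blast
    moreover have "U v = ?X \<inter> (\<Union>u\<in>orb v. {w. w u \<noteq> 0})" by (auto simp: U_def)
    ultimately have openX: "openin (top_of_set ?X) (U v)" by (simp add: openin_open_Int)
    have pre: "{w \<in> ?X. ?q w \<in> ?q ` U v} = U v"
    proof (intro equalityI subsetI)
      fix w assume w: "w \<in> {w \<in> ?X. ?q w \<in> ?q ` U v}"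
      then obtain w' where "w' \<in> U v" "?q w = ?q w'" by blast
      then show "w \<in> U v" using saturated[of w w' v] w v by simp
    qed (auto simp: U_def)
    have sub: "?q ` U v \<subseteq> topspace Y" using top by (auto simp: U_def)
    have "openin (top_of_set ?X) {w \<in> ?X. ?q w \<in> ?q ` U v} \<longleftrightarrow> openin Y (?q ` U v)"
      using Y(1) sub unfolding quotient_map_def topspace_euclidean_subtopology by (elim conjE allE impE)
    then show ?thesis using openX unfolding pre by (rule iffD1)
  qed
  have "topspace Y \<subseteq> \<Union>((\<lambda>v. ?q ` U v) ` \<Union>K)"
  proof
    fix y assume "y \<in> topspace Y"
    then obtain w where w: "w \<in> ?X" "y = ?q w" using top by blast
    obtain u where u: "u \<in> supp w" "u \<in> \<Union>K" using supp_cube[OF w(1)] cube_nonempty by blast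
    then have "w \<in> U u" using orbit_refl w(1) by (auto simp: U_def supp_def)
    then show "y \<in> \<Union>((\<lambda>v. ?q ` U v) ` \<Union>K)" using u w by blast
  qed
  moreover have "\<forall>V\<in>(\<lambda>v. ?q ` U v) ` \<Union>K. openin Y V" using openU by blast
  ultimately obtain F where F: "finite F" "F \<subseteq> (\<lambda>v. ?q ` U v) ` \<Union>K" "topspace Y \<subseteq> \<Union>F"
    using Y(2) unfolding compact_space_def compactin_def by meson
  obtain V0 where V0: "V0 \<subseteq> \<Union>K" "finite V0" "F = (\<lambda>v. ?q ` U v) ` V0"
    using finite_subset_image[OF F(1,2)] by blast
  have "vertex_orbits G \<phi> K \<subseteq> orb ` V0"
  proof
    fix a assume "a \<in> vertex_orbits G \<phi> K"
    then obtain x where x: "x \<in> \<Union>K" "a = orb x" by (auto simp: orbits_def)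
    have xp: "vertex_point x \<in> ?X" by (rule vertex_point_realization[OF x(1)])
    then have "?q (vertex_point x) \<in> \<Union>F" using F(3) top by blast
    then obtain v where v: "v \<in> V0" "?q (vertex_point x) \<in> ?q ` U v" using V0(3) by blast
    then obtain w' where w': "w' \<in> U v" "?q (vertex_point x) = ?q w'" by blast
    have "v \<in> \<Union>K" using v(1) V0(1) by blast
    from saturated[OF xp w' this] have "x \<in> orb v" by (auto simp: U_def vertex_point_def split: if_splits)
    then have "a = orb v" using orb_eq[OF \<open>v \<in> \<Union>K\<close>] x(2) by simp
    then show "a \<in> orb ` V0" using v(1) by blast
  qed
  then show ?thesis using V0(2) finite_subset by blast
qed

text \<open>Orbits partition the star of \<open>lift a\<close>, and the growth series towards
  \<open>c\<close> is the same from all vertices of an orbit. So the coefficient matrix times the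
  growth matrix collapses to \<open>growth_series_identity\<close> at \<open>lift a\<close>, and the
  coefficient matrix is a left inverse.\<close>

theorem orbit_matrices_inverse:
  "inverse_matrices (vertex_orbits G \<phi> K) (orbit_growth K) (orbit_coeff K)"
proof (rule left_inverse_imp_inverse_matrices[OF finite_vertex_orbits])
  fix a c assume a: "a \<in> vertex_orbits G \<phi> K" and c: "c \<in> vertex_orbits G \<phi> K"
  define x where "x = lift a"
  let ?S = "\<Union>{Q \<in> K. x \<in> Q}" and ?I = "vertex_orbits G \<phi> K"
  have x: "x \<in> a" "x \<in> \<Union>K" using orbits_mem(2)[OF a lift_mem[OF a]] lift_mem[OF a] by (simp_all add: x_def)
  have growth: "orbit_growth K b c = growth_series K z c" if "b \<in> ?I" "z \<in> \<Union>K" "orb z = b" for b z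
  proof -
    have "lift b \<in> orb z" using lift_mem[OF that(1)] that(3) by simp
    then obtain g where "g \<in> carrier G" "lift b = \<phi> g z" by (auto simp: orbit_def)
    then show ?thesis using growth_series_act[OF _ that(2) c] by (simp add: orbit_growth_def)
  qed
  have "(\<Sum>b\<in>?I. orbit_coeff K a b * orbit_growth K b c) =
      (\<Sum>b\<in>?I. \<Sum>z | z \<in> ?S \<and> orb z = b. vertex_coeff K x z * growth_series K z c)"
  proof (rule sum.cong[OF refl])
    fix b assume b: "b \<in> ?I"
    show "orbit_coeff K a b * orbit_growth K b c =
        (\<Sum>z | z \<in> ?S \<and> orb z = b. vertex_coeff K x z * growth_series K z c)"
      unfolding orbit_coeff_eq[OF a b, folded x_def] sum_distrib_right
      by (rule sum.cong[OF refl]) (use growth[OF b] in auto)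
  qed
  also have "\<dots> = (\<Sum>z\<in>?S. vertex_coeff K x z * growth_series K z c)"
    by (rule sum.group) (use finite_star[OF x(2)] finite_vertex_orbits in \<open>auto simp: orbits_def\<close>)
  also have "\<dots> = (if x \<in> c then 1 else 0)"
    by (rule growth_series_identity[OF x(2)]) (use orbits_mem(2)[OF c] in blast)
  also have "x \<in> c \<longleftrightarrow> a = c" using orbits_mem(1)[OF a x(1)] orbits_mem(1)[OF c, of x] x(1) by auto
  finally show "(\<Sum>b\<in>?I. orbit_coeff K a b * orbit_growth K b c) = (if a = c then 1 else 0)" .
qed

end

theorem theorem3:
  fixes K :: "'v set set"
    and G :: "('g, 'm) monoid_scheme"
    and \<phi> :: "'g \<Rightarrow> 'v \<Rightarrow> 'v"
  assumes "cat0_cube_complex K"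
    and "locally_finite_complex K"
    and "cellular_action G \<phi> K"
    and "cocompact G \<phi> K"
    and "stars_embedded G \<phi> K"
  shows "inverse_matrices (vertex_orbits G \<phi> K) (orbit_growth K) (orbit_coeff K)"
proof -
  interpret cubical_action K G \<phi>
    by unfold_locales (use assms in \<open>auto simp: cat0_cube_complex_def\<close>)
  show ?thesis by (rule orbit_matrices_inverse)
qed

end
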